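(* Let $h\in\mathbb{Z}^+$. Then: (1) For all multiplicative complements $(A_1,A_2,\ldots,A_h)$ of order $h$, we have $$\liminf_{x\to\infty}\frac{\max\{A_1(x),\ldots,A_h(x)\}}{\frac{x}{\log x}}>\frac1h.$$ (2) For all $\varepsilon>0$, there exists a multiplicative complement $(A_1,\ldots,A_h)$ of order $h$ with $$\liminf_{x\to\infty}\frac{\max\{A_1(x),\ldots,A_h(x)\}}{\frac{x}{\log x}}\le\frac1h+\varepsilon.$$
   Context: $\mathbb{Z}^+$ denotes the set of positive integers and $\log$ the natural logarithm. For $A\subseteq\mathbb{Z}^+$, the counting function $A(x)$ counts the elements of $A$ that are less than or equal to $x$, that is, $A(x)=|\{a\in A:a\le x\}|$. For $A_1,\ldots,A_h\subseteq\mathbb{Z}^+$, the $h$-tuple $(A_1,\ldots,A_h)$ is a multiplicative complement of order $h$ if every positive integer can be written in the form $a_1\cdots a_h$ with $a_i\in A_i$ for all $1\le i\le h$.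
   Formalization: Part (2) is stated only for h ≥ 2: for h = 1 the only multiplicative complement is A_1 = Z^+, whose quotient A_1(x)/(x/log x) tends to infinity, so part (2) is false there; part (1) is kept for all h ≥ 1. *)

theory Defs
  imports Complex_Main "HOL-Library.Extended_Real"
begin

definition counting :: "nat set \<Rightarrow> real \<Rightarrow> nat" where
  "counting A x = card {a \<in> A. real a \<le> x}"

(* A tuple (A_1, ..., A_h) is a function on indices of which only the values at 1, ..., h matter. *)
definition mult_complement :: "nat \<Rightarrow> (nat \<Rightarrow> nat set) \<Rightarrow> bool" where
  "mult_complement h A \<longleftrightarrow>
     (\<forall>i\<in>{1..h}. A i \<subseteq> {0<..}) \<and>
     (\<forall>n>0. \<exists>a. (\<forall>i\<in>{1..h}. a i \<in> A i) \<and> n = (\<Prod>i=1..h. a i))"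

(* The quotient may tend to infinity, so the lower limit is taken in the extended reals. *)
definition max_counting_liminf :: "nat \<Rightarrow> (nat \<Rightarrow> nat set) \<Rightarrow> ereal" where
  "max_counting_liminf h A =
     Liminf at_top (\<lambda>x::real. ereal (real (MAX i\<in>{1..h}. counting (A i) x) / (x / ln x)))"

end

(*
  Lower bound. By induction on the number of factors: if some component A_j can be dropped, the
  smaller tuple already has a larger lower limit. Otherwise some M_j is not a product of the
  components other than A_j. Every prime lies in some A_j, and for a prime p > M := max M_j in A_j
  the number p * M_j forces a second element with largest prime factor p, of size at most M * p.
  Hence the counting functions add up to at least pi(x) + pi(x/M) - M, that is, to
  (1 + 1/M + o(1)) x / ln x.

  Upper bound. The components are built in stages along a very sparse sequence of scales n. At scale
  n, put z = (ln n)^2, y = n/z; every component receives all integers up to y not yet passed, and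
  the primes in (y, n] are distributed evenly. An integer m <= n without a divisor in a suitable
  range [z, Y] is a prime p > Y times a cofactor < z. If the cofactor is small, it is represented by
  the previous stages, and p is multiplied into the factor a of the component holding p. A weight T
  with a * T(a) <= cofactor is carried along, so that only multiples p * a <= n / T(a) are
  needed; they number about (n / ln n) * sum 1/(a T(a)), and this sum is kept below epsilon.

  Both parts need the prime number theorem pi(x) ~ x / ln x, for which Newman's analytic proof is
  used: the Dirichlet series with the bounded coefficients (psi(n) - n)/n extends past Re s = 1,
  so that the sum of (psi(n) - n)/n^2 converges.
*)

theory Submission
  imports Defs "HOL-Complex_Analysis.Complex_Analysis" "HOL-Number_Theory.Prime_Powers" "HOL-Real_Asymp.Real_Asymp"
begin

subsection \<open>Newman's Tauberian theorem\<close>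

text \<open>The Tauberian theorem needs bounded coefficients, which rules out
  \<open>mangoldt n - 1\<close>; Chebyshev's bound \<open>psi n \<le> 4 * real n\<close> makes
  (psi(n) - n)/n admissible, and partial summation transfers the continuation to it. In the lower
  bound the gain 1/M depends on the tuple, so no constant above 1/h comes out, in agreement with the
  second part. In the upper bound the obstacle is the cofactor: giving all multiples p * a of large
  primes p to the components would cost a proportion of about the sum of 1/a over the old a \<ge> 2,
  which is at least 1/2 once 2 is old. The weight turns this into a sum that is empty at the stage
  {1} and grows by an amount tending to 0 with the next scale n, so a strict bound by epsilon
  survives every stage. The choice z = (ln n)^2 serves two ends: y = n/z must be o(n / ln n), so
  that all integers up to y are free, and the new integers of weight z may add only O(ln n / z) to
  the sum. Only the counts at the scales are controlled, which is enough for a lower limit.\<close>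

lemma norm_of_nat_powr: "norm (of_nat n powr s :: complex) = real n powr Re s"
  by (cases "n = 0") (auto simp: norm_powr_real_powr)

lemma powr_diff_mean_value:
  fixes x y :: real
  assumes "x > 0"
  obtains t where "x < t" "t < x + 1" "(x + 1) powr y - x powr y = y * t powr (y - 1)"
proof -
  have "\<exists>t>x. t < x + 1 \<and> (x + 1) powr y - x powr y = (x + 1 - x) * (y * t powr (y - 1))"
    by (rule MVT2) (use assms in \<open>auto intro!: derivative_eq_intros\<close>)
  with that show thesis by auto
qed

text \<open>Comparison with the integral of \<open>t powr (-1 - x)\<close>, one term at a time; the
  contribution of the upper end M is kept so that the induction telescopes.\<close>

lemma sum_powr_tail_le:
  fixes x :: real
  assumes "x > 0" "N \<ge> 1" "N \<le> M"
  shows "(\<Sum>n\<in>{N<..M}. real n powr (-1 - x)) \<le> (real N powr -x - real M powr -x) / x"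
  using \<open>N \<le> M\<close>
proof (induction M rule: dec_induct)
  case (step n)
  have n: "real n > 0" using step assms by simp
  obtain t where t: "real n < t" "t < real n + 1"
    "(real n + 1) powr -x - real n powr -x = -x * t powr (-x - 1)"
    using powr_diff_mean_value[OF n] by metis
  have [simp]: "-x - 1 = -1 - x" by simp
  have "real (Suc n) powr (-1 - x) \<le> t powr (-1 - x)"
    using t n \<open>x > 0\<close> by (intro powr_mono2') auto
  then have "x * real (Suc n) powr (-1 - x) \<le> x * t powr (-1 - x)"
    using \<open>x > 0\<close> by simp
  also have "\<dots> = real n powr -x - real (Suc n) powr -x"
    using t(3) by (simp add: algebra_simps)
  finally have "real (Suc n) powr (-1 - x) \<le> (real n powr -x - real (Suc n) powr -x) / x"
    using \<open>x > 0\<close> by (simp add: field_simps)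
  moreover have "{N<..Suc n} = insert (Suc n) {N<..n}" using step by auto
  ultimately show ?case using step.IH by (simp add: diff_divide_distrib)
qed simp

text \<open>Integral comparison again. The integrand decreases for y < 1 and increases for y \<ge>
  1; the summand 1/N pays for the last term, which the increasing case leaves over.\<close>

lemma sum_powr_le:
  fixes y :: real
  assumes "y > 0" "N \<ge> 1"
  shows "(\<Sum>n=1..N. real n powr (y - 1)) \<le> real N powr y * (1 / y + 1 / real N)"
proof -
  have "y * (\<Sum>n=1..N. real n powr (y - 1)) \<le> real N powr y + y * real N powr (y - 1)"
  proof (cases "y \<ge> 1")
    case True
    show ?thesis using \<open>N \<ge> 1\<close>
    proof (induction N rule: dec_induct)
      case (step n)
      have n: "real n > 0" using step by simp
      obtain t where t: "real n < t" "t < real n + 1"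
        "(real n + 1) powr y - real n powr y = y * t powr (y - 1)"
        using powr_diff_mean_value[OF n] by metis
      have "t powr (y - 1) \<ge> real n powr (y - 1)" using True t n by (intro powr_mono2) auto
      then have "y * t powr (y - 1) \<ge> y * real n powr (y - 1)" using \<open>y > 0\<close> by simp
      then show ?case using t(3) step.IH by (simp add: algebra_simps)
    qed simp
  next
    case False
    have "y * (\<Sum>n=1..N. real n powr (y - 1)) \<le> real N powr y" using \<open>N \<ge> 1\<close>
    proof (induction N rule: dec_induct)
      case base
      then show ?case using False by simp
    next
      case (step n)
      have n: "real n > 0" using step by simp
      obtain t where t: "real n < t" "t < real n + 1"
        "(real n + 1) powr y - real n powr y = y * t powr (y - 1)"
        using powr_diff_mean_value[OF n] by metis
      have "t powr (y - 1) \<ge> real (Suc n) powr (y - 1)" using False t n by (intro powr_mono2') auto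
      then have "y * t powr (y - 1) \<ge> y * real (Suc n) powr (y - 1)" using \<open>y > 0\<close> by simp
      then show ?case using t(3) step.IH by (simp add: algebra_simps)
    qed
    moreover have "y * real N powr (y - 1) \<ge> 0" using \<open>y > 0\<close> by simp
    ultimately show ?thesis by linarith
  qed
  moreover have "real N powr (y - 1) = real N powr y / real N"
    using assms by (simp add: powr_diff)
  ultimately show ?thesis using \<open>y > 0\<close> by (simp add: field_simps)
qed

section \<open>Arcs, kernel and the contour estimate\<close>

lemma path_image_right_semicircle:
  assumes "z \<in> path_image (part_circlepath 0 R (-(pi/2)) (pi/2))" "R > 0"
  shows "norm z = R" "Re z \<ge> 0" "\<bar>Im z\<bar> \<le> R"
proof -
  obtain t where t: "z = R * cis t" "-pi/2 \<le> t" "t \<le> pi/2"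
    using assms by (auto simp: path_image_part_circlepath cis_conv_exp)
  have "cos t \<ge> 0" using t by (intro cos_ge_zero) auto
  then show "norm z = R" "Re z \<ge> 0" using t(1) \<open>R > 0\<close> by (auto simp: norm_mult)
  then show "\<bar>Im z\<bar> \<le> R" using abs_Im_le_cmod[of z] by simp
qed

lemma path_image_left_semicircle:
  assumes "z \<in> path_image (part_circlepath 0 R (pi/2) (3*pi/2))" "R > 0"
  shows "norm z = R" "Re z \<le> 0"
proof -
  obtain t where t: "z = R * cis t" "pi/2 \<le> t" "t \<le> 3*pi/2"
    using assms by (auto simp: path_image_part_circlepath cis_conv_exp)
  have "cos (t - pi) \<ge> 0" using t by (intro cos_ge_zero) auto
  then have "cos t \<le> 0" by simp
  then show "norm z = R" "Re z \<le> 0" using t(1) \<open>R > 0\<close> by (auto simp: norm_mult mult_le_0_iff)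
qed

lemma has_contour_integral_inverse_arc:
  assumes "R > 0" "a < b"
  shows "((\<lambda>z. c / z) has_contour_integral (c * \<i> * (b - a))) (part_circlepath 0 R a b)"
proof -
  have "((\<lambda>t. c * \<i>) has_integral ((b - a) *\<^sub>R (c * \<i>))) {a..b}"
    using has_integral_const_real[of "c * \<i>" a b] assms by simp
  then have "((\<lambda>t. c / (0 + R * cis t) * R * \<i> * cis t) has_integral (c * \<i> * (b - a))) {a..b}"
    using assms by (simp add: field_simps scaleR_conv_of_real)
  then show ?thesis by (subst has_contour_integral_part_circlepath_iff) (use assms in auto)
qed

text \<open>On the circle \<open>z * cnj z\<close> is R^2, so the kernel equals (z + cnj z)/R^2. Its
  factor Re z cancels the 1/|Re z| in the bounds on the tail and on the partial sums.\<close>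

lemma newman_kernel_norm:
  fixes z :: complex and R :: real
  assumes "norm z = R" "R > 0"
  shows "norm ((1 + z\<^sup>2 / (of_real R)\<^sup>2) / z) = 2 * \<bar>Re z\<bar> / R\<^sup>2"
proof -
  have nz: "z \<noteq> 0" using assms by auto
  have "z * cnj z = R\<^sup>2" using assms complex_norm_square[of z] by simp
  then have "(1 + z\<^sup>2 / (of_real R)\<^sup>2) / z = (z + cnj z) / R\<^sup>2"
    using nz assms by (simp add: field_simps power2_eq_square)
  also have "\<dots> = of_real (2 * Re z / R\<^sup>2)" by (simp add: complex_add_cnj)
  finally show ?thesis by (simp only: norm_of_real) (simp add: abs_mult)
qed

text \<open>Cauchy's formula for S 0 with the kernel N^z (1 + z^2/R^2)/z, where S is a partial sum
  and f = z q its continued limit. On the right arc f - S is small; on the left the entire function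
  S is integrated over the full arc, while f, known only near the axis, is integrated along a thin
  rectangle. Each arc contributes C/R, the left one also C/N; the other two terms come from the
  rectangle.\<close>

lemma newman_estimate:
  fixes S f q :: "complex \<Rightarrow> complex" and R \<eta> N C M :: real
  assumes R: "R > 0" and \<eta>: "\<eta> > 0" and N: "N \<ge> 1" and C: "C \<ge> 0"
    and oV: "open V" and V: "convex V" "\<And>z. - \<eta> \<le> Re z \<Longrightarrow> \<bar>Im z\<bar> \<le> R \<Longrightarrow> z \<in> V"
    and q: "q holomorphic_on V" and f: "\<And>z. z \<in> V \<Longrightarrow> f z = z * q z"
    and S: "S holomorphic_on UNIV"
    and tail: "\<And>z. Re z > 0 \<Longrightarrow> norm (f z - S z) \<le> C * N powr -Re z / Re z"
    and head: "\<And>z. Re z < 0 \<Longrightarrow> norm (S z) \<le> C * (N powr -Re z * (1 / -Re z + 1 / N))"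
    and M: "\<And>z. -\<eta> \<le> Re z \<Longrightarrow> Re z \<le> 0 \<Longrightarrow> \<bar>Im z\<bar> \<le> R \<Longrightarrow> norm (q z * (1 + z\<^sup>2 / (of_real R)\<^sup>2)) \<le> M"
  shows "norm (S 0) \<le> C * (2 / R + 1 / N) + \<eta> * M + R * M * N powr -\<eta>"
proof -
  define P where "P z = complex_of_real N powr z" for z
  define K where "K z = 1 + z\<^sup>2 / (of_real R)\<^sup>2" for z :: complex
  \<comment> \<open>\<open>A\<close> is the right arc from -iR to iR; the left arc \<open>A'\<close>
    and the three sides \<open>B\<close> of the rectangle are two ways to close it.\<close>
  define A where "A = part_circlepath 0 R (-(pi/2)) (pi/2)"
  define A' where "A' = part_circlepath 0 R (pi/2) (3*pi/2)"
  define B1 where "B1 = linepath (\<i> * R) (\<i> * R - \<eta>)"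
  define B2 where "B2 = linepath (\<i> * R - \<eta>) (- \<i> * R - \<eta>)"
  define B3 where "B3 = linepath (- \<i> * R - \<eta>) (- \<i> * R)"
  define B where "B = B1 +++ B2 +++ B3"
  have normP: "norm (P z) = N powr Re z" for z
    using N by (simp add: P_def norm_powr_real_powr)
  have P_hol [holomorphic_intros]: "P holomorphic_on X" for X
    unfolding P_def using N by (intro holomorphic_intros) auto
  have K_hol [holomorphic_intros]: "K holomorphic_on X" for X
    unfolding K_def using R by (intro holomorphic_intros) auto
  have P0: "P 0 = 1" and K0: "K 0 = 1" using N by (auto simp: P_def K_def)
  have M0: "M \<ge> 0" using R \<eta> by (intro order_trans[OF norm_ge_zero M[of 0]]) auto
  have normK: "norm (K z / z) = 2 * \<bar>Re z\<bar> / R\<^sup>2" if "norm z = R" for z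
    using newman_kernel_norm[OF that R] by (simp add: K_def)
  have valid [simp]: "valid_path A" "valid_path A'" "valid_path B1" "valid_path B2" "valid_path B3"
    by (simp_all add: A_def A'_def B1_def B2_def B3_def valid_path_part_circlepath)
  have "cis (pi + pi/2) = -\<i>" unfolding cis_mult[symmetric] by simp
  then have cis': "cis (3*pi/2) = -\<i>" by (simp add: field_simps)
  have ends [simp]: "pathstart A = -\<i> * R" "pathfinish A = \<i> * R" "pathstart A' = \<i> * R" "pathfinish A' = -\<i> * R"
    unfolding A_def A'_def pathstart_part_circlepath pathfinish_part_circlepath cis_conv_exp[symmetric] cis'
    by simp_all
  have ends' [simp]: "pathstart B1 = \<i> * R" "pathfinish B1 = \<i> * R - \<eta>" "pathstart B2 = \<i> * R - \<eta>"
    "pathfinish B2 = -\<i> * R - \<eta>" "pathstart B3 = -\<i> * R - \<eta>" "pathfinish B3 = -\<i> * R"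
    by (simp_all add: B1_def B2_def B3_def)
  have validB [simp]: "valid_path B" and endsB [simp]: "pathstart B = \<i> * R" "pathfinish B = -\<i> * R"
    unfolding B_def by (auto intro!: valid_path_join)
  have imA: "norm z = R" "Re z \<ge> 0" "\<bar>Im z\<bar> \<le> R" if "z \<in> path_image A" for z
    using path_image_right_semicircle[OF _ R] that unfolding A_def by auto
  have imA': "norm z = R" "Re z \<le> 0" if "z \<in> path_image A'" for z
    using path_image_left_semicircle[OF _ R] that unfolding A'_def by auto
  have imB1: "-\<eta> \<le> Re z \<and> Re z \<le> 0 \<and> \<bar>Im z\<bar> \<le> R" if "z \<in> path_image B1" for z
  proof -
    have "\<exists>u. 0 \<le> u \<and> u \<le> 1 \<and> z = (1 - u) *\<^sub>R (\<i> * R) + u *\<^sub>R (\<i> * R - \<eta>)"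
      using that unfolding B1_def path_image_linepath in_segment .
    then obtain u where u: "0 \<le> u" "u \<le> 1" "z = (1 - u) *\<^sub>R (\<i> * R) + u *\<^sub>R (\<i> * R - \<eta>)" by blast
    have "Im z = R" "Re z = -(u * \<eta>)" by (auto simp: u(3) algebra_simps)
    moreover have "u * \<eta> \<le> 1 * \<eta>" "u * \<eta> \<ge> 0" using u \<eta> by (auto intro!: mult_right_mono)
    ultimately show ?thesis using R by simp
  qed
  have imB3: "-\<eta> \<le> Re z \<and> Re z \<le> 0 \<and> \<bar>Im z\<bar> \<le> R" if "z \<in> path_image B3" for z
  proof -
    have "\<exists>u. 0 \<le> u \<and> u \<le> 1 \<and> z = (1 - u) *\<^sub>R (- \<i> * R - \<eta>) + u *\<^sub>R (- \<i> * R)"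
      using that unfolding B3_def path_image_linepath in_segment .
    then obtain u where u: "0 \<le> u" "u \<le> 1" "z = (1 - u) *\<^sub>R (- \<i> * R - \<eta>) + u *\<^sub>R (- \<i> * R)" by blast
    have "Im z = -R" "Re z = -((1 - u) * \<eta>)" by (auto simp: u(3) algebra_simps)
    moreover have "(1 - u) * \<eta> \<le> 1 * \<eta>" "(1 - u) * \<eta> \<ge> 0" using u \<eta> by (auto intro!: mult_right_mono)
    ultimately show ?thesis using R by simp
  qed
  have imB2: "Re z = -\<eta> \<and> \<bar>Im z\<bar> \<le> R" if z: "z \<in> path_image B2" for z
  proof -
    have "\<exists>u. 0 \<le> u \<and> u \<le> 1 \<and> z = (1 - u) *\<^sub>R (\<i> * R - \<eta>) + u *\<^sub>R (- \<i> * R - \<eta>)"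
      using z unfolding B2_def path_image_linepath in_segment .
    then obtain u where u: "0 \<le> u" "u \<le> 1" "z = (1 - u) *\<^sub>R (\<i> * R - \<eta>) + u *\<^sub>R (- \<i> * R - \<eta>)" by blast
    have "Im z = (1 - 2 * u) * R" "Re z = -\<eta>" by (auto simp: u(3) algebra_simps)
    moreover have "\<bar>(1 - 2 * u) * R\<bar> \<le> 1 * R"
      unfolding abs_mult using u R by (intro mult_mono) auto
    ultimately show ?thesis by simp
  qed
  have subV: "path_image A \<subseteq> V" "path_image B1 \<subseteq> V" "path_image B2 \<subseteq> V" "path_image B3 \<subseteq> V"
    using V(2) imA imB1 imB2 imB3 \<eta> by (force+)
  \<comment> \<open>\<open>G\<close> is the integrand for f, its pole at 0 already removed by f = z
    q; the integrand for S is H z / z, with residue S 0.\<close>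
  define G where "G z = q z * K z * P z" for z
  define H where "H z = S z * K z * P z" for z
  have G_hol: "G holomorphic_on V" unfolding G_def by (intro holomorphic_intros q)
  have "(G has_contour_integral 0) (A +++ B)"
  proof (rule Cauchy_theorem_convex_simple[OF G_hol V(1)])
    show "valid_path (A +++ B)" by (intro valid_path_join) auto
    show "path_image (A +++ B) \<subseteq> V" unfolding B_def
      using subV by (intro subset_path_image_join) auto
  qed auto
  then have int0: "contour_integral (A +++ B) G = 0" by (rule contour_integral_unique)
  have G_int: "G contour_integrable_on p" if "valid_path p" "path_image p \<subseteq> V" for p
    using that by (intro contour_integrable_holomorphic_simple[OF G_hol oV])
  have intB: "contour_integral B G = contour_integral B1 G + contour_integral B2 G + contour_integral B3 G"
    unfolding B_def using subV by (subst contour_integral_join; (subst contour_integral_join)?) (auto intro!: G_int contour_integrable_joinI)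
  have intAB: "contour_integral A G + contour_integral B G = 0"
    using int0 subV by (subst (asm) contour_integral_join) (auto intro!: G_int simp: B_def subset_path_image_join)
  have H_hol: "H holomorphic_on UNIV" unfolding H_def by (intro holomorphic_intros S)
  \<comment> \<open>\<open>D\<close> is H z / z without its polar part S 0 / z, hence entire. The
    polar part is integrated explicitly: pi i S 0 for each half circle, so no winding number is
    needed.\<close>
  define D where "D z = (if z = 0 then deriv H 0 else (H z - H 0) / (z - 0))" for z
  have D_hol: "D holomorphic_on UNIV" unfolding D_def by (rule pole_lemma_open[OF H_hol open_UNIV])
  have D_int: "D contour_integrable_on p" if "valid_path p" for p
    using D_hol that by (intro contour_integrable_holomorphic_simple[of _ UNIV]) auto
  have "(D has_contour_integral 0) (A +++ A')"
    by (rule Cauchy_theorem_convex_simple[OF D_hol convex_UNIV]) (auto intro!: valid_path_join)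
  then have "contour_integral (A +++ A') D = 0" by (rule contour_integral_unique)
  then have intD: "contour_integral A D + contour_integral A' D = 0"
    by (subst (asm) contour_integral_join) (auto intro!: D_int)
  have H0: "H 0 = S 0" by (simp add: H_def P0 K0)
  have "((\<lambda>z. S 0 / z) has_contour_integral (S 0 * \<i> * pi)) A"
    using has_contour_integral_inverse_arc[OF R, of "-(pi/2)" "pi/2" "S 0"] by (simp add: A_def flip: of_real_diff of_real_add)
  then have "((\<lambda>z. D z + S 0 / z) has_contour_integral (contour_integral A D + S 0 * \<i> * pi)) A"
    by (intro has_contour_integral_add has_contour_integral_integral D_int valid(1))
  moreover have "D z + S 0 / z = H z / z" if "z \<in> path_image A" for z
    using imA(1)[OF that] R by (auto simp: D_def H0 diff_divide_distrib)
  ultimately have HA: "((\<lambda>z. H z / z) has_contour_integral (contour_integral A D + S 0 * \<i> * pi)) A"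
    by (rule has_contour_integral_eq)
  have "((\<lambda>z. S 0 / z) has_contour_integral (S 0 * \<i> * pi)) A'"
    using has_contour_integral_inverse_arc[OF R, of "pi/2" "3*pi/2" "S 0"] by (simp add: A'_def flip: of_real_diff of_real_add)
  then have "((\<lambda>z. D z + S 0 / z) has_contour_integral (contour_integral A' D + S 0 * \<i> * pi)) A'"
    by (intro has_contour_integral_add has_contour_integral_integral D_int valid(2))
  moreover have "D z + S 0 / z = H z / z" if "z \<in> path_image A'" for z
    using imA'(1)[OF that] R by (auto simp: D_def H0 diff_divide_distrib)
  ultimately have HA': "((\<lambda>z. H z / z) has_contour_integral (contour_integral A' D + S 0 * \<i> * pi)) A'"
    by (rule has_contour_integral_eq)
  have GA: "((\<lambda>z. G z - H z / z) has_contour_integral (contour_integral A G - (contour_integral A D + S 0 * \<i> * pi))) A"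
    using HA by (intro has_contour_integral_diff has_contour_integral_integral G_int) (use subV in auto)
  have bound1: "norm (contour_integral A G - (contour_integral A D + S 0 * \<i> * pi)) \<le> 2 * C / R\<^sup>2 * R * (pi/2 - (-(pi/2)))"
  proof (rule has_contour_integral_bound_part_circlepath[where z = 0 and s = "-(pi/2)" and t = "pi/2" and f = "\<lambda>z. G z - H z / z"])
    fix z assume "z \<in> path_image (part_circlepath 0 R (-(pi/2)) (pi/2))"
    then have z: "z \<in> path_image A" by (simp add: A_def)
    have nz: "z \<noteq> 0" using imA[OF z] R by auto
    have eq0: "G z - H z / z = (f z - S z) * P z * (K z / z)"
      using f[of z] subV z nz by (auto simp: G_def H_def field_simps)
    then have eq: "norm (G z - H z / z) = norm (f z - S z) * N powr Re z * (2 * Re z / R\<^sup>2)"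
      unfolding eq0 norm_mult normP normK[OF imA(1)[OF z]] using imA(2)[OF z] by simp
    show "norm (G z - H z / z) \<le> 2 * C / R\<^sup>2"
    \<comment> \<open>At the two end points \<open>tail\<close> gives nothing, but the kernel
      vanishes there.\<close>
    proof (cases "Re z = 0")
      case True
      then show ?thesis unfolding eq using C by simp
    next
      case False
      then have x: "Re z > 0" using imA[OF z] by simp
      have "norm (f z - S z) * N powr Re z * (2 * Re z / R\<^sup>2)
          \<le> C * N powr -Re z / Re z * N powr Re z * (2 * Re z / R\<^sup>2)"
        by (intro mult_right_mono tail x) (use x in auto)
      also have "\<dots> = 2 * C / R\<^sup>2"
        using x N by (simp add: powr_minus field_simps)
      finally show ?thesis unfolding eq .
    qed
  qed (use R C GA in \<open>auto simp: A_def\<close>)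
  have bound2: "norm (contour_integral A' D + S 0 * \<i> * pi) \<le> 2 * C / R\<^sup>2 * (1 + R / N) * R * (3*pi/2 - pi/2)"
  proof (rule has_contour_integral_bound_part_circlepath[where z = 0 and s = "pi/2" and t = "3*pi/2" and f = "\<lambda>z. H z / z"])
    fix z assume "z \<in> path_image (part_circlepath 0 R (pi/2) (3*pi/2))"
    then have z: "z \<in> path_image A'" by (simp add: A'_def)
    have nz: "z \<noteq> 0" using imA'[OF z] R by auto
    have eq0: "H z / z = S z * P z * (K z / z)" by (simp add: H_def)
    then have eq: "norm (H z / z) = norm (S z) * N powr Re z * (2 * -Re z / R\<^sup>2)"
      unfolding eq0 norm_mult normP normK[OF imA'(1)[OF z]] using imA'(2)[OF z] by simp
    show "norm (H z / z) \<le> 2 * C / R\<^sup>2 * (1 + R / N)"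
    proof (cases "Re z = 0")
      case True
      then show ?thesis unfolding eq using C R N by simp
    next
      case False
      then have x: "Re z < 0" using imA'[OF z] by simp
      have "norm (S z) * N powr Re z * (2 * -Re z / R\<^sup>2)
          \<le> C * (N powr -Re z * (1 / -Re z + 1 / N)) * N powr Re z * (2 * -Re z / R\<^sup>2)"
        by (intro mult_right_mono head x) (use x in \<open>auto intro: divide_nonpos_nonneg\<close>)
      also have "\<dots> = 2 * C / R\<^sup>2 * (1 + -Re z / N)"
        proof -
        have "N powr Re z \<noteq> 0" using N by simp
        then show ?thesis using x N R by (simp add: powr_minus divide_simps) (simp add: algebra_simps)
      qed
      also have "\<dots> \<le> 2 * C / R\<^sup>2 * (1 + R / N)"
        using abs_Re_le_cmod[of z] imA'(1)[OF z] C N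
        by (intro mult_left_mono add_left_mono divide_right_mono) auto
      finally show ?thesis unfolding eq .
    qed
  qed (use R C N HA' in \<open>auto simp: A'_def\<close>)
  have Gle: "norm (G z) \<le> M * N powr Re z" if "-\<eta> \<le> Re z" "Re z \<le> 0" "\<bar>Im z\<bar> \<le> R" for z
    unfolding G_def norm_mult[of _ "P z"] normP
    using M[OF that] by (intro mult_right_mono) (auto simp: K_def)
  have Gle1: "norm (G z) \<le> M" if "-\<eta> \<le> Re z" "Re z \<le> 0" "\<bar>Im z\<bar> \<le> R" for z
  proof -
    have "N powr Re z \<le> N powr 0" using that N by (intro powr_mono) auto
    then have "M * N powr Re z \<le> M * 1" using M0 N by (intro mult_left_mono) auto
    then show ?thesis using Gle[OF that] by simp
  qed
  have b1: "norm (contour_integral B1 G) \<le> M * norm ((\<i> * R - \<eta>) - \<i> * R)"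
    unfolding B1_def
    by (rule contour_integral_bound_linepath) (use M0 G_int[OF valid(3) subV(2)] imB1 Gle1 in \<open>auto simp: B1_def\<close>)
  have b3: "norm (contour_integral B3 G) \<le> M * norm (- \<i> * R - (- \<i> * R - \<eta>))"
    unfolding B3_def
    by (rule contour_integral_bound_linepath) (use M0 G_int[OF valid(5) subV(4)] imB3 Gle1 in \<open>auto simp: B3_def\<close>)
  have b2: "norm (contour_integral B2 G) \<le> (M * N powr -\<eta>) * norm ((- \<i> * R - \<eta>) - (\<i> * R - \<eta>))"
    unfolding B2_def
  proof (rule contour_integral_bound_linepath)
    fix z assume "z \<in> closed_segment (\<i> * R - \<eta>) (- \<i> * R - \<eta>)"
    then have "z \<in> path_image B2" by (simp add: B2_def)
    then show "norm (G z) \<le> M * N powr -\<eta>" using imB2 Gle[of z] \<eta> by auto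
  qed (use M0 G_int[OF valid(4) subV(3)] in \<open>auto simp: B2_def\<close>)
  have n2: "norm ((- \<i> * R - \<eta>) - (\<i> * R - \<eta>)) = 2 * R"
  proof -
    have "(- \<i> * R - \<eta>) - (\<i> * R - \<eta>) = - (2 * \<i> * R)" by simp
    then show ?thesis using R by (simp only: norm_minus_cancel norm_mult) simp
  qed
  have bound3: "norm (contour_integral B G) \<le> 2 * \<eta> * M + 2 * R * M * N powr -\<eta>"
    using b1 b2[unfolded n2] b3 \<eta> unfolding intB
    by (intro order_trans[OF norm_triangle_ineq] order_trans[OF add_right_mono[OF norm_triangle_ineq]])
       (simp add: algebra_simps)
  have tri: "norm (- a - b + c) \<le> norm a + norm b + norm c" for a b c :: complex
    using norm_triangle_ineq[of "- a - b" c] norm_triangle_ineq4[of "- a" b] by simp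
  \<comment> \<open>The two polar parts add up to 2 pi i S 0; the remaining integrals cancel by
    Cauchy's theorem for \<open>A +++ B\<close> and \<open>A +++ A'\<close>.\<close>
  have "2 * pi * \<i> * S 0 = - (contour_integral A G - (contour_integral A D + S 0 * \<i> * pi))
      - contour_integral B G + (contour_integral A' D + S 0 * \<i> * pi)"
  proof -
    have "contour_integral B G = - contour_integral A G" "contour_integral A' D = - contour_integral A D"
      using intAB intD by (simp_all add: eq_neg_iff_add_eq_0 add.commute)
    then show ?thesis by (simp add: algebra_simps)
  qed
  then have "norm (2 * pi * \<i> * S 0) \<le> norm (contour_integral A G - (contour_integral A D + S 0 * \<i> * pi))
      + norm (contour_integral B G) + norm (contour_integral A' D + S 0 * \<i> * pi)"
    by (simp only: tri)
  also have "norm (2 * pi * \<i> * S 0) = 2 * pi * norm (S 0)" by (simp add: norm_mult)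
  finally have "2 * pi * norm (S 0) \<le> 2 * C / R\<^sup>2 * R * pi + (2 * \<eta> * M + 2 * R * M * N powr -\<eta>)
      + 2 * C / R\<^sup>2 * (1 + R / N) * R * pi"
    using bound1 bound2 bound3 by simp
  also have "\<dots> = 2 * pi * (C * (2 / R + 1 / N)) + (2 * \<eta> * M + 2 * R * M * N powr -\<eta>)"
    using R N by (simp add: field_simps power2_eq_square)
  \<comment> \<open>A factor pi is given away here so that 2 pi can be divided out of the whole
    bound.\<close>
  also have "2 * \<eta> * M + 2 * R * M * N powr -\<eta> \<le> pi * (2 * \<eta> * M + 2 * R * M * N powr -\<eta>)"
    using mult_right_mono[of 1 pi "2 * \<eta> * M + 2 * R * M * N powr -\<eta>"] pi_ge_two M0 R \<eta> by simp
  also have "2 * pi * (C * (2 / R + 1 / N)) + pi * (2 * \<eta> * M + 2 * R * M * N powr -\<eta>)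
      = 2 * pi * (C * (2 / R + 1 / N) + \<eta> * M + R * M * N powr -\<eta>)"
    by (simp add: algebra_simps)
  finally show ?thesis by (simp add: mult_le_cancel_left_pos)
qed

text \<open>With \<open>F 1 = 0\<close> the quotient \<open>F (1 + z) / z\<close> is holomorphic across \<open>0\<close>, so Cauchy's theorem on a convex set suffices
  and no winding number of the composite contour has to be computed.\<close>

lemma newman_zero:
  fixes a :: "nat \<Rightarrow> complex"
  assumes bound: "\<And>n. norm (a n) \<le> C"
    and U: "open U" "{s. Re s \<ge> 1} \<subseteq> U" and F: "F holomorphic_on U"
    and sums: "\<And>s. Re s > 1 \<Longrightarrow> (\<lambda>n. a n * of_nat n powr -s) sums F s"
    and F1: "F 1 = 0"
  shows "(\<lambda>n. a n / of_nat n) sums 0"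
proof -
  define S where "S N z = (\<Sum>n=1..N. a n * of_nat n powr (-1 - z))" for N z
  have C: "C \<ge> 0" using bound[of 0] norm_ge_zero order_trans by blast
  have S_hol: "S N holomorphic_on UNIV" for N
    unfolding S_def by (intro holomorphic_intros) auto
  have sum0: "(\<Sum>n\<le>N. g n) = g 0 + (\<Sum>n=1..N. g n)" for g :: "nat \<Rightarrow> complex" and N
    by (simp add: atMost_atLeast0 sum.atLeast_Suc_atMost)
  define f where "f z = F (1 + z)" for z
  have tail: "norm (f z - S N z) \<le> C * real N powr -Re z / Re z" if z: "Re z > 0" and N: "N \<ge> 1" for z N
  proof -
    have "(\<lambda>M. \<Sum>n\<le>M. a n * of_nat n powr -(1 + z)) \<longlonglongrightarrow> f z"
      using sums[of "1 + z"] z unfolding sums_def_le f_def by simp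
    then have lim: "(\<lambda>M. norm ((\<Sum>n\<le>M. a n * of_nat n powr (-1 - z)) - S N z)) \<longlonglongrightarrow> norm (f z - S N z)"
      by (intro tendsto_intros) (simp add: algebra_simps)
    have "norm ((\<Sum>n\<le>M. a n * of_nat n powr (-1 - z)) - S N z) \<le> C * real N powr -Re z / Re z" if M: "M \<ge> N" for M
    proof -
      have "(\<Sum>n\<le>M. a n * of_nat n powr (-1 - z)) - S N z = (\<Sum>n\<in>{N<..M}. a n * of_nat n powr (-1 - z))"
      proof -
        have "{1..M} = {1..N} \<union> {N<..M}" using M N by auto
        then have "(\<Sum>n=1..M. a n * of_nat n powr (-1 - z)) = S N z + (\<Sum>n\<in>{N<..M}. a n * of_nat n powr (-1 - z))"
          unfolding S_def by (subst sum.union_disjoint[symmetric]) auto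
        then show ?thesis unfolding sum0 by simp
      qed
      also have "norm \<dots> \<le> (\<Sum>n\<in>{N<..M}. C * real n powr (-1 - Re z))"
        by (intro sum_norm_le) (simp add: norm_mult norm_of_nat_powr mult_right_mono bound)
      also have "\<dots> \<le> C * ((real N powr -Re z - real M powr -Re z) / Re z)"
        unfolding sum_distrib_left[symmetric] using sum_powr_tail_le[OF z N M] C by (intro mult_left_mono) auto
      also have "\<dots> \<le> C * (real N powr -Re z / Re z)"
        using z C by (intro mult_left_mono divide_right_mono) auto
      finally show ?thesis by simp
    qed
    then show ?thesis by (intro LIMSEQ_le_const2[OF lim]) auto
  qed
  have head: "norm (S N z) \<le> C * (real N powr -Re z * (1 / -Re z + 1 / real N))"
    if z: "Re z < 0" and N: "N \<ge> 1" for z N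
  proof -
    have [simp]: "- Re z - 1 = -1 - Re z" by simp
    have "norm (S N z) \<le> (\<Sum>n=1..N. C * real n powr (-Re z - 1))"
      unfolding S_def by (intro sum_norm_le) (simp add: norm_mult norm_of_nat_powr mult_right_mono bound add.commute)
    also have "\<dots> \<le> C * (real N powr -Re z * (1 / -Re z + 1 / real N))"
      unfolding sum_distrib_left[symmetric] using sum_powr_le[of "-Re z" N] z N C by (intro mult_left_mono) auto
    finally show ?thesis .
  qed
  have "(\<lambda>N. S N 0) \<longlonglongrightarrow> 0"
  proof (rule LIMSEQ_I)
    fix e :: real assume e: "e > 0"
    \<comment> \<open>Order of choices: \<open>R\<close> makes the arcs contribute at most e/4; then
      compactness yields the width l of a strip and the bound M, which depend on R; then \<eta>
      makes the horizontal sides contribute at most e/4; what is left tends to 0 with N.\<close>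
    define R where "R = 8 * C / e + 1"
    have R: "R > 0" using C e by (simp add: R_def add_nonneg_pos)
    have CR: "C * (2 / R) \<le> e / 4"
    proof -
      have "8 * C \<le> e * R" using e by (simp add: R_def algebra_simps)
      then show ?thesis using R by (simp add: field_simps)
    qed
    \<comment> \<open>This vertical segment on Re s = 1 is compact, so one width l works at all
      heights that occur.\<close>
    define K where "K = cbox (Complex 1 (-(R + 1))) (Complex 1 (R + 1))"
    have "K \<subseteq> U" using U(2) by (auto simp: K_def in_cbox_complex_iff)
    moreover have "compact K" by (simp add: K_def)
    ultimately obtain l where l: "l > 0" "(\<Union>x\<in>K. ball x l) \<subseteq> U"
      using compact_subset_open_imp_ball_epsilon_subset[OF _ U(1)] by metis
    define V where "V = {z. -l < Re z} \<inter> ({z. Im z < R + 1} \<inter> {z. -(R + 1) < Im z})"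
    have V: "open V" "convex V"
      unfolding V_def by (intro open_Int convex_Int open_halfspace_Re_gt open_halfspace_Im_gt open_halfspace_Im_lt
        convex_halfspace_Re_gt convex_halfspace_Im_gt convex_halfspace_Im_lt)+
    have VU: "1 + z \<in> U" if z: "z \<in> V" for z
    proof (cases "Re z \<ge> 0")
      case True
      then show ?thesis using U(2) by auto
    next
      case False
      have "Complex 1 (Im z) \<in> K" using z by (auto simp: K_def V_def in_cbox_complex_iff)
      moreover have "Complex 1 (Im z) - (1 + z) = of_real (-Re z)" by (simp add: complex_eq_iff)
      then have "1 + z \<in> ball (Complex 1 (Im z)) l"
        using False z by (simp only: mem_ball dist_norm norm_of_real) (simp add: V_def)
      ultimately show ?thesis using l(2) by blast
    qed
    have f_hol: "f holomorphic_on V"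
    proof -
      have "(F \<circ> (\<lambda>z. 1 + z)) holomorphic_on V"
        by (rule holomorphic_on_compose_gen[OF _ F]) (use VU in \<open>auto intro!: holomorphic_intros\<close>)
      then show ?thesis by (simp add: f_def[abs_def] o_def)
    qed
    have f0: "f 0 = 0" by (simp add: f_def F1)
    define q where "q z = (if z = 0 then deriv f 0 else (f z - f 0) / (z - 0))" for z
    have q: "q holomorphic_on V" unfolding q_def by (rule pole_lemma_open[OF f_hol V(1)])
    have fq: "f z = z * q z" for z by (simp add: q_def f0)
    define X where "X = cbox (Complex (-l/2) (-R)) (Complex 0 R)"
    have XV: "X \<subseteq> V" using l(1) by (auto simp: X_def V_def in_cbox_complex_iff)
    have "continuous_on X (\<lambda>z. q z * (1 + z\<^sup>2 / (of_real R)\<^sup>2))"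
      by (intro continuous_intros holomorphic_on_imp_continuous_on[OF holomorphic_on_subset[OF q XV]]) (use R in auto)
    then have "bounded ((\<lambda>z. q z * (1 + z\<^sup>2 / (of_real R)\<^sup>2)) ` X)"
      by (intro compact_imp_bounded compact_continuous_image) (auto simp: X_def)
    then obtain M where M: "M > 0" "\<And>z. z \<in> X \<Longrightarrow> norm (q z * (1 + z\<^sup>2 / (of_real R)\<^sup>2)) \<le> M"
      unfolding bounded_pos by auto
    define \<eta> where "\<eta> = min (l / 2) (e / (4 * M))"
    have \<eta>: "\<eta> > 0" "\<eta> \<le> l / 2" "\<eta> * M \<le> e / 4"
      using l(1) e M(1) by (auto simp: \<eta>_def min_def field_simps)
    have est: "norm (S N 0) \<le> C * (2 / R + 1 / real N) + \<eta> * M + R * M * real N powr -\<eta>" if N: "N \<ge> 1" for N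
    proof (rule newman_estimate[where V = V and q = q and f = f])
      show "z \<in> V" if "-\<eta> \<le> Re z" "\<bar>Im z\<bar> \<le> R" for z
        using that \<eta> l(1) by (auto simp: V_def)
      show "norm (q z * (1 + z\<^sup>2 / (of_real R)\<^sup>2)) \<le> M" if "-\<eta> \<le> Re z" "Re z \<le> 0" "\<bar>Im z\<bar> \<le> R" for z
        using that \<eta> by (intro M(2)) (auto simp: X_def in_cbox_complex_iff)
    qed (use R \<eta> N C V q fq S_hol tail head in auto)
    have "(\<lambda>N. real N powr -\<eta>) \<longlonglongrightarrow> 0"
      using \<eta>(1) by (intro tendsto_neg_powr filterlim_real_sequentially) auto
    moreover have "(\<lambda>N. 1 / real N) \<longlonglongrightarrow> 0" by (rule lim_const_over_n)
    ultimately have "(\<lambda>N. C * (2 / R + 1 / real N) + \<eta> * M + R * M * real N powr -\<eta>) \<longlonglongrightarrow> C * (2 / R + 0) + \<eta> * M + R * M * 0"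
      by (intro tendsto_intros)
    then have "\<forall>\<^sub>F N in sequentially. C * (2 / R + 1 / real N) + \<eta> * M + R * M * real N powr -\<eta> < e"
      by (rule order_tendstoD) (use CR \<eta> e in auto)
    then obtain N0 where N0: "\<And>N. N \<ge> N0 \<Longrightarrow> C * (2 / R + 1 / real N) + \<eta> * M + R * M * real N powr -\<eta> < e"
      by (auto simp: eventually_sequentially)
    show "\<exists>no. \<forall>n\<ge>no. norm (S n 0 - 0) < e"
      using est N0 by (intro exI[of _ "max N0 1"]) (force intro: le_less_trans)
  qed
  moreover have "a n * of_nat n powr (-1) = a n / of_nat n" for n
    by (cases "n = 0") (auto simp: powr_minus divide_inverse)
  ultimately show ?thesis
    unfolding sums_def_le sum0 by (simp add: S_def)
qed

text \<open>Since 1 powr -s = 1, lowering the coefficient at n = 1 by F 1 lowers the whole function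
  by the constant F 1, which reduces to \<open>newman_zero\<close>.\<close>

theorem newman:
  fixes a :: "nat \<Rightarrow> complex"
  assumes bound: "\<And>n. norm (a n) \<le> C"
    and U: "open U" "{s. Re s \<ge> 1} \<subseteq> U" and F: "F holomorphic_on U"
    and sums: "\<And>s. Re s > 1 \<Longrightarrow> (\<lambda>n. a n * of_nat n powr -s) sums F s"
  shows "(\<lambda>n. a n / of_nat n) sums F 1"
proof -
  define d where "d n = (if n = 1 then F 1 else 0)" for n :: nat
  have d: "(\<lambda>n. d n * g n) sums (F 1 * g 1)" for g
    using sums_single[of 1 "\<lambda>n. F 1 * g n"] by (simp add: d_def if_distrib[of "\<lambda>x. x * _"] cong: if_cong)
  have "(\<lambda>n. (a n - d n) / of_nat n) sums 0"
  proof (rule newman_zero[where F = "\<lambda>s. F s - F 1" and U = U and C = "C + norm (F 1)"])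
    show "norm (a n - d n) \<le> C + norm (F 1)" for n
      using norm_triangle_ineq4[of "a n" "d n"] bound[of n] by (auto simp: d_def split: if_splits intro: order_trans)
    show "(\<lambda>n. (a n - d n) * of_nat n powr -s) sums (F s - F 1)" if "Re s > 1" for s
      using sums_diff[OF sums[OF that] d[of "\<lambda>n. of_nat n powr -s"]] by (simp add: algebra_simps)
  qed (use U F in \<open>auto intro!: holomorphic_intros\<close>)
  from sums_add[OF this d[of "\<lambda>n. 1 / of_nat n"]] show ?thesis
    by (simp add: diff_divide_distrib)
qed

subsection \<open>The zeta function up to the line Re s = 1\<close>

text \<open>The majorant is required only for large n: the bounds on \<open>powr_defect\<close> used
  later fail at n = 0, where its value is 1.\<close>

lemma holomorphic_suminf:
  fixes f :: "nat \<Rightarrow> complex \<Rightarrow> complex"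
  assumes S: "open S" and f: "\<And>n. f n holomorphic_on S"
    and bound: "\<And>x. x \<in> S \<Longrightarrow> \<exists>d h. d > 0 \<and> summable h \<and> (\<forall>n. 0 \<le> h n) \<and> (\<forall>\<^sub>F n in sequentially. \<forall>y\<in>ball x d \<inter> S. norm (f n y) \<le> h n)"
  shows "(\<lambda>z. \<Sum>n. f n z) holomorphic_on S"
    and "\<And>x. x \<in> S \<Longrightarrow> (\<lambda>n. f n x) sums (\<Sum>n. f n x)"
    and "\<And>x. x \<in> S \<Longrightarrow> (\<lambda>n. deriv (f n) x) sums deriv (\<lambda>z. \<Sum>n. f n z) x"
proof -
  have "\<exists>d h. 0 < d \<and> summable h \<and> range h \<subseteq> \<real>\<^sub>\<ge>\<^sub>0 \<and> (\<forall>\<^sub>F n in sequentially. \<forall>y\<in>ball x d \<inter> S. cmod (f n y) \<le> cmod (h n))"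
    if x: "x \<in> S" for x
  proof -
    obtain d h where "d > 0" "summable h" "\<forall>n. 0 \<le> h n" "\<forall>\<^sub>F n in sequentially. \<forall>y\<in>ball x d \<inter> S. norm (f n y) \<le> h n"
      using bound[OF x] by blast
    then show ?thesis
      by (intro exI[of _ d] exI[of _ "\<lambda>n. of_real (h n)"]) (auto simp: summable_of_real_iff)
  qed
  from series_and_derivative_comparison_complex[OF S holomorphic_derivI[OF f S] this]
  obtain g g' where g: "\<forall>x\<in>S. (\<lambda>n. f n x) sums g x \<and> (\<lambda>n. deriv (f n) x) sums g' x \<and> (g has_field_derivative g' x) (at x)"
    by blast
  have eq: "g x = (\<Sum>n. f n x)" if "x \<in> S" for x
    using sums_unique[of "\<lambda>n. f n x" "g x"] g that by auto
  have der: "((\<lambda>z. \<Sum>n. f n z) has_field_derivative g' x) (at x)" if "x \<in> S" for x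
    by (rule has_field_derivative_transform_within_open[where f = g and S = S]) (use g eq that S in auto)
  show "(\<lambda>z. \<Sum>n. f n z) holomorphic_on S"
    unfolding holomorphic_on_open[OF S] using der by auto
  show "(\<lambda>n. f n x) sums (\<Sum>n. f n x)" if "x \<in> S" for x
    using g eq[OF that] that by auto
  show "(\<lambda>n. deriv (f n) x) sums deriv (\<lambda>z. \<Sum>n. f n z) x" if "x \<in> S" for x
    using g DERIV_imp_deriv[OF der[OF that]] that by auto
qed

section \<open>Second-order differences of powers\<close>

lemma norm_powr_segment_le:
  fixes w :: complex
  assumes "n \<ge> 1" "Re c \<le> 0" "w \<in> closed_segment (of_nat n) (of_nat n + 1)"
  shows "norm (w powr c) \<le> real n powr Re c"
proof -
  obtain u where u: "0 \<le> u" "u \<le> 1" "w = (1 - u) *\<^sub>R of_nat n + u *\<^sub>R (of_nat n + 1)"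
    using assms(3) unfolding in_segment by blast
  have w: "w = of_real (real n + u)"
    by (simp add: u(3) scaleR_conv_of_real algebra_simps)
  have "norm (w powr c) = (real n + u) powr Re c"
    unfolding w using u by (subst norm_powr_real_powr) auto
  also have "\<dots> \<le> real n powr Re c"
    using u assms by (intro powr_mono2') auto
  finally show ?thesis .
qed

lemma segment_not_nonpos:
  fixes w :: complex
  assumes "n \<ge> 1" "w \<in> closed_segment (of_nat n) (of_nat n + 1)"
  shows "w \<notin> \<real>\<^sub>\<le>\<^sub>0"
proof -
  obtain u where u: "0 \<le> u" "u \<le> 1" "w = (1 - u) *\<^sub>R of_nat n + u *\<^sub>R (of_nat n + 1)"
    using assms(2) unfolding in_segment by blast
  have "Re w = real n + u" by (simp add: u(3) algebra_simps)
  then have "Re w > 0" using assms(1) u(1) by simp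
  then show ?thesis using complex_nonpos_Reals_iff by force
qed

text \<open>This is \<open>s\<close> times the difference between \<open>n powr (-s - 1)\<close> and its integral over \<open>[n, n + 1]\<close>; multiplying by \<open>s\<close>
  avoids a removable singularity at \<open>s = 0\<close>.\<close>

definition powr_defect :: "nat \<Rightarrow> complex \<Rightarrow> complex" where
  "powr_defect n s = s * of_nat n powr (-s - 1) - of_nat n powr -s + of_nat (Suc n) powr -s"

lemma powr_defect_holomorphic [holomorphic_intros]:
  "f holomorphic_on S \<Longrightarrow> (\<lambda>s. powr_defect n (f s)) holomorphic_on S"
  unfolding powr_defect_def by (intro holomorphic_intros)

text \<open>The mean value bound is used twice. The function \<open>G\<close> has
  \<open>powr_defect n s\<close> as its increment over [n, n + 1], and its derivative vanishes at n;
  bounding that derivative by a further derivative gains the second power of n.\<close>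

lemma norm_powr_defect_le:
  assumes n: "n \<ge> 1" and s: "Re s \<ge> -1"
  shows "norm (powr_defect n s) \<le> norm s * norm (s + 1) * real n powr (-Re s - 2)"
proof -
  define X where "X = closed_segment (of_nat n) (of_nat n + 1 :: complex)"
  have X: "convex X" "of_nat n \<in> X" "of_nat n + 1 \<in> X" by (auto simp: X_def)
  have nX: "w \<notin> \<real>\<^sub>\<le>\<^sub>0" if "w \<in> X" for w using segment_not_nonpos[OF n] that by (simp add: X_def)
  have e: "- s - 1 - 1 = - s - 2" by simp
  have 1: "norm (w powr (-s - 1) - of_nat n powr (-s - 1)) \<le> norm (s + 1) * real n powr (-Re s - 2)" if w: "w \<in> X" for w
  proof -
    have "norm (w powr (-s - 1) - of_nat n powr (-s - 1)) \<le> (norm (s + 1) * real n powr (-Re s - 2)) * norm (w - of_nat n)"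
    proof (rule field_differentiable_bound[OF X(1)])
      show "((\<lambda>w. w powr (-s - 1)) has_field_derivative (-s - 1) * z powr (-s - 2)) (at z within X)" if "z \<in> X" for z
        using DERIV_subset[OF has_field_derivative_powr[OF nX[OF that], of "-s - 1"]] unfolding e by simp
      show "norm ((-s - 1) * z powr (-s - 2)) \<le> norm (s + 1) * real n powr (-Re s - 2)" if "z \<in> X" for z
      proof -
        have "- s - 1 = - (s + 1)" by simp
        then have "norm (- s - 1) = norm (s + 1)" by (simp only: norm_minus_cancel)
        moreover have "norm (z powr (-s - 2)) \<le> real n powr (-Re s - 2)"
          using norm_powr_segment_le[OF n, of "-s - 2" z] that s by (simp add: X_def)
        ultimately show ?thesis unfolding norm_mult by (intro mult_mono) auto
      qed
    qed (use w X in auto)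
    moreover have "norm (w - of_nat n) \<le> 1"
      using segment_bound(1)[of w "of_nat n" "of_nat n + 1"] w by (simp add: X_def norm_minus_commute)
    then have "(norm (s + 1) * real n powr (-Re s - 2)) * norm (w - of_nat n) \<le> (norm (s + 1) * real n powr (-Re s - 2)) * 1"
      by (intro mult_left_mono) auto
    ultimately show ?thesis by simp
  qed
  define G where "G w = w powr -s + s * of_nat n powr (-s - 1) * w" for w
  have "norm (G (of_nat n + 1) - G (of_nat n)) \<le> (norm s * (norm (s + 1) * real n powr (-Re s - 2))) * norm ((of_nat n + 1) - of_nat n :: complex)"
  proof (rule field_differentiable_bound[OF X(1)])
    show "(G has_field_derivative -s * z powr (-s - 1) + s * of_nat n powr (-s - 1) * 1) (at z within X)" if "z \<in> X" for z
      unfolding G_def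
      by (intro derivative_intros) (use DERIV_subset[OF has_field_derivative_powr[OF nX[OF that], of "-s"]] in auto)
    show "norm (-s * z powr (-s - 1) + s * of_nat n powr (-s - 1) * 1) \<le> norm s * (norm (s + 1) * real n powr (-Re s - 2))" if "z \<in> X" for z
    proof -
      have "-s * z powr (-s - 1) + s * of_nat n powr (-s - 1) * 1 = -s * (z powr (-s - 1) - of_nat n powr (-s - 1))"
        by (simp add: algebra_simps)
      then show ?thesis using 1[OF that] by (simp add: norm_mult mult_left_mono)
    qed
  qed (use X in auto)
  moreover have "G (of_nat n + 1) - G (of_nat n) = powr_defect n s"
    by (simp add: G_def powr_defect_def algebra_simps)
  ultimately show ?thesis by (simp add: mult.assoc)
qed

section \<open>Dirichlet series in the half-plane Re s > 1\<close>

definition zeta :: "complex \<Rightarrow> complex" where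
  "zeta s = (\<Sum>n. of_nat n powr -s)"

lemma zeta_series:
  shows zeta_holomorphic: "zeta holomorphic_on {s. Re s > 1}"
    and sums_zeta: "Re s > 1 \<Longrightarrow> (\<lambda>n. of_nat n powr -s) sums zeta s"
    and sums_deriv_zeta: "Re s > 1 \<Longrightarrow> (\<lambda>n. of_real (ln (real n)) * of_nat n powr -s) sums (- deriv zeta s)"
proof -
  have op: "open {s. Re s > 1}" by (rule open_halfspace_Re_gt)
  have hol: "(\<lambda>s. of_nat n powr -s) holomorphic_on {s. Re s > 1}" for n by (intro holomorphic_intros)
  have bd: "\<exists>d h. d > 0 \<and> summable h \<and> (\<forall>n. 0 \<le> h n) \<and>
      (\<forall>\<^sub>F n in sequentially. \<forall>y\<in>ball x d \<inter> {s. Re s > 1}. norm (of_nat n powr -y :: complex) \<le> h n)"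
    if x: "x \<in> {s. Re s > 1}" for x
  proof -
    define d where "d = (Re x - 1) / 2"
    have d: "d > 0" "Re x - d > 1" using x by (auto simp: d_def field_simps)
    have "norm (of_nat n powr -y :: complex) \<le> real n powr -(Re x - d)" if n: "n \<ge> 1" and y: "y \<in> ball x d" for n y
    proof -
      have "\<bar>Re (x - y)\<bar> < d" using abs_Re_le_cmod[of "x - y"] y by (simp add: dist_norm)
      then show ?thesis using n unfolding norm_of_nat_powr by (intro powr_mono) auto
    qed
    then show ?thesis using d
      by (intro exI[of _ d] exI[of _ "\<lambda>n. real n powr -(Re x - d)"])
         (auto simp: summable_real_powr_iff eventually_sequentially intro!: exI[of _ 1])
  qed
  note * = holomorphic_suminf[OF op hol bd, folded zeta_def]
  show "zeta holomorphic_on {s. Re s > 1}" using *(1) unfolding zeta_def .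
  show "(\<lambda>n. of_nat n powr -s) sums zeta s" if "Re s > 1" using *(2) that unfolding zeta_def by simp
  have "deriv (\<lambda>s. of_nat n powr -s) s = - (of_real (ln (real n)) * of_nat n powr -s)" for n and s :: complex
  proof (cases "n = 0")
    case False
    then have "((\<lambda>s. of_nat n powr -s) has_field_derivative - (of_real (ln (real n)) * of_nat n powr -s)) (at s)"
      using DERIV_chain2[OF has_field_derivative_powr_right DERIV_minus[OF DERIV_ident], of "of_nat n" s]
      by (simp add: Ln_of_nat)
    then show ?thesis by (rule DERIV_imp_deriv)
  qed auto
  then show "(\<lambda>n. of_real (ln (real n)) * of_nat n powr -s) sums (- deriv zeta s)" if "Re s > 1"
    using sums_minus[OF *(3)[of s]] that unfolding zeta_def[abs_def] by simp
qed

definition mangoldt_series :: "complex \<Rightarrow> complex" where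
  "mangoldt_series s = (\<Sum>n. mangoldt n * of_nat n powr -s)"

text \<open>From mangoldt n \<le> ln n \<le> n^k / k, where k is half of the margin Re s -
  1.\<close>

lemma summable_norm_mangoldt:
  assumes s: "Re s > 1"
  shows "summable (\<lambda>n. norm (mangoldt n * of_nat n powr -s :: complex))"
proof (rule summable_comparison_test_ev)
  define k where "k = (Re s - 1) / 2"
  have k: "k > 0" "k - Re s < -1" using s by (auto simp: k_def field_simps)
  show "summable (\<lambda>n. 1 / k * real n powr (k - Re s))"
    using k by (intro summable_mult) (simp add: summable_real_powr_iff)
  have "norm (norm (mangoldt n * of_nat n powr -s :: complex)) \<le> 1 / k * real n powr (k - Re s)" if n: "n \<ge> 1" for n
  proof -
    have "mangoldt n \<le> real n powr k / k"
      using mangoldt_le[of n] ln_powr_bound[of "real n" k] n k by simp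
    then have "mangoldt n * real n powr -Re s \<le> real n powr k / k * real n powr -Re s"
      by (intro mult_right_mono) auto
    also have "\<dots> = 1 / k * real n powr (k - Re s)"
      by (simp add: powr_diff powr_minus divide_simps)
    finally show ?thesis by (simp add: norm_mult norm_of_nat_powr norm_mangoldt abs_mult)
  qed
  then show "\<forall>\<^sub>F n in sequentially. norm (norm (mangoldt n * of_nat n powr -s :: complex)) \<le> 1 / k * real n powr (k - Re s)"
    by (auto simp: eventually_sequentially)
qed

lemma summable_norm_zeta:
  "Re s > 1 \<Longrightarrow> summable (\<lambda>n. norm (of_nat n powr -s :: complex))"
  by (simp add: norm_of_nat_powr summable_real_powr_iff)

lemma sums_mangoldt:
  "Re s > 1 \<Longrightarrow> (\<lambda>n. mangoldt n * of_nat n powr -s) sums mangoldt_series s"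
  unfolding mangoldt_series_def using summable_sums[OF summable_norm_cancel[OF summable_norm_mangoldt]] .

text \<open>Dirichlet convolution: the sum of \<open>mangoldt d\<close> over the divisors d of n is
  ln n, the coefficient of \<open>- deriv zeta\<close>. Absolute convergence permits regrouping the
  double series over (d, m) by n = d m.\<close>

lemma mangoldt_series_times_zeta:
  assumes s: "Re s > 1"
  shows "mangoldt_series s * zeta s = - deriv zeta s"
proof -
  define f where "f n = (mangoldt n * of_nat n powr -s :: complex)" for n
  define g where "g n = (of_nat n powr -s :: complex)" for n
  have hf: "(f has_sum mangoldt_series s) UNIV"
    unfolding f_def by (intro norm_summable_imp_has_sum summable_norm_mangoldt sums_mangoldt s)
  have hg: "(g has_sum zeta s) UNIV"
    unfolding g_def by (intro norm_summable_imp_has_sum summable_norm_zeta sums_zeta s)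
  have nf: "(\<lambda>n. norm (f n)) summable_on UNIV"
    unfolding f_def using summable_norm_mangoldt[OF s] by (subst summable_on_UNIV_nonneg_real_iff) auto
  have ng: "(\<lambda>n. norm (g n)) summable_on UNIV"
    unfolding g_def using summable_norm_zeta[OF s] by (subst summable_on_UNIV_nonneg_real_iff) auto
  define h where "h = (\<lambda>(d, m). f d * g m)"
  have "(\<lambda>x. norm (h x)) summable_on (UNIV \<times> UNIV)"
    unfolding Infinite_Sum.abs_summable_on_Sigma_iff h_def
    using nf ng by (auto simp: norm_mult infsum_cmult_right' abs_mult intro: summable_on_cmult_right summable_on_cmult_left)
  then have "h summable_on (UNIV \<times> UNIV)" by (rule Infinite_Sum.abs_summable_summable)
  then have "(h has_sum (mangoldt_series s * zeta s)) (UNIV \<times> UNIV)"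
    using hf hg by (intro has_sum_SigmaI[where g = "\<lambda>d. f d * zeta s"]) (auto simp: h_def intro: has_sum_cmult_right has_sum_cmult_left)
  \<comment> \<open>Pairs with a zero entry contribute 0; they must go, because only positive pairs
    correspond to a number n \<ge> 1 with a divisor d.\<close>
  then have "(h has_sum (mangoldt_series s * zeta s)) ({1..} \<times> {1..})"
  proof (rule has_sum_cong_neutral[THEN iffD1, rotated -1])
    fix x :: "nat \<times> nat" assume "x \<in> UNIV \<times> UNIV - {1..} \<times> ({1..} :: nat set)"
    then have "fst x = 0 \<or> snd x = 0" by (cases x) auto
    then show "h x = 0" by (auto simp: h_def f_def g_def split: prod.splits)
  qed auto
  also have "?this \<longleftrightarrow> ((\<lambda>(n, d). mangoldt d * of_nat n powr -s) has_sum (mangoldt_series s * zeta s)) (Sigma {1..} (\<lambda>n. {d. d dvd n}))"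
  proof -
    have bij: "bij_betw (\<lambda>(n, d). (d, n div d)) (Sigma {1..} (\<lambda>n. {d. d dvd n})) ({1..} \<times> ({1..} :: nat set))"
      by (rule bij_betwI[where g = "\<lambda>(d, m). (d * m, d)"]) (auto simp: dvd_div_eq_0_iff Suc_le_eq intro: Nat.gr0I)
    have "(h has_sum (mangoldt_series s * zeta s)) ({1..} \<times> {1..}) \<longleftrightarrow>
        ((\<lambda>x. h ((\<lambda>(n, d). (d, n div d)) x)) has_sum (mangoldt_series s * zeta s)) (Sigma {1..} (\<lambda>n. {d. d dvd n}))"
      by (rule has_sum_reindex_bij_betw[OF bij, symmetric])
    also have "\<dots> \<longleftrightarrow> ((\<lambda>(n, d). mangoldt d * of_nat n powr -s) has_sum (mangoldt_series s * zeta s)) (Sigma {1..} (\<lambda>n. {d. d dvd n}))"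
    proof (rule has_sum_cong)
      fix x :: "nat \<times> nat" assume "x \<in> Sigma {1..} (\<lambda>n. {d. d dvd n})"
      then obtain n d where x: "x = (n, d)" "n \<ge> 1" "d dvd n" by auto
      have "of_nat d powr -s * of_nat (n div d) powr -s = (of_nat n powr -s :: complex)"
        using x(3) by (subst powr_times_real[symmetric]) (auto simp flip: of_nat_mult)
      then show "h ((\<lambda>(n, d). (d, n div d)) x) = (case x of (n, d) \<Rightarrow> mangoldt d * of_nat n powr -s)"
        by (simp add: x(1) h_def f_def g_def)
    qed
    finally show ?thesis .
  qed
  finally have "((\<lambda>n. \<Sum>d | d dvd n. mangoldt d * of_nat n powr -s) has_sum (mangoldt_series s * zeta s)) {1..}"
    by (rule has_sum_SigmaD) (auto intro!: has_sum_finite)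
  then have "((\<lambda>n. of_real (ln (real n)) * of_nat n powr -s) has_sum (mangoldt_series s * zeta s)) {1..}"
    by (rule has_sum_cong[THEN iffD1, rotated]) (simp add: mangoldt_sum flip: sum_distrib_right)
  then have "((\<lambda>n. of_real (ln (real n)) * of_nat n powr -s) has_sum (mangoldt_series s * zeta s)) UNIV"
    by (rule has_sum_cong_neutral[THEN iffD1, rotated -1]) (auto simp: not_le)
  then have "(\<lambda>n. of_real (ln (real n)) * of_nat n powr -s) sums (mangoldt_series s * zeta s)"
    by (rule has_sum_imp_sums)
  then show ?thesis using sums_deriv_zeta[OF s] sums_unique2 by blast
qed

section \<open>Continuation of (s - 1) zeta(s) to Re s > 0\<close>

text \<open>The function \<open>(s - 1) * zeta s\<close>, with a series that converges for \<open>Re s > 0\<close>. Since \<open>0 powr s = 0\<close> for all \<open>s\<close>,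
  the term for \<open>n = 0\<close> is \<open>1\<close>.\<close>

definition zeta_reg :: "complex \<Rightarrow> complex" where
  "zeta_reg s = (\<Sum>n. powr_defect n (s - 1))"

lemma of_nat_powr_tendsto_0:
  assumes "Re s < 0"
  shows "(\<lambda>n. of_nat n powr s :: complex) \<longlonglongrightarrow> 0"
proof (rule tendsto_norm_zero_cancel)
  show "(\<lambda>n. norm (of_nat n powr s :: complex)) \<longlonglongrightarrow> 0"
    unfolding norm_of_nat_powr using assms by (intro tendsto_neg_powr filterlim_real_sequentially) auto
qed

text \<open>Serves two series: with e > 0 small for \<open>zeta_reg\<close>, and with e > 1 for the
  series weighted by psi(n) - n, where the coefficients cost one power of n.\<close>

lemma powr_defect_locally_bounded:
  assumes e: "0 \<le> e" "e < Re x"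
  obtains d K where "d > 0" "K \<ge> 0"
    "\<And>n y. n \<ge> 1 \<Longrightarrow> y \<in> ball x d \<Longrightarrow> norm (powr_defect n (y - 1)) \<le> K * real n powr (-1 - e)"
proof -
  define d where "d = Re x - e"
  define K where "K = (norm x + d + 1) * (norm x + d)"
  have d: "d > 0" using e by (simp add: d_def)
  have "norm (powr_defect n (y - 1)) \<le> K * real n powr (-1 - e)" if n: "n \<ge> 1" and y: "y \<in> ball x d" for n y
  proof -
    have "norm (x - y) < d" using y by (simp add: dist_norm)
    then have re: "Re y \<ge> e" and ny: "norm y \<le> norm x + d"
      using abs_Re_le_cmod[of "x - y"] norm_triangle_ineq4[of x "x - y"] by (simp_all add: d_def)
    have "norm (powr_defect n (y - 1)) \<le> norm (y - 1) * norm y * real n powr (-1 - Re y)"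
      using norm_powr_defect_le[OF n, of "y - 1"] re e by (simp add: algebra_simps)
    also have "\<dots> \<le> K * real n powr (-1 - e)"
      unfolding K_def using re ny n d norm_triangle_ineq4[of y 1] by (intro mult_mono powr_mono) auto
    finally show ?thesis .
  qed
  moreover have "K \<ge> 0" using d by (simp add: K_def)
  ultimately show thesis using d by (intro that) auto
qed

lemma zeta_reg_holomorphic: "zeta_reg holomorphic_on {s. Re s > 0}"
proof -
  have op: "open {s. Re s > 0}" by (rule open_halfspace_Re_gt)
  have hol: "(\<lambda>s. powr_defect n (s - 1)) holomorphic_on {s. Re s > 0}" for n by (intro holomorphic_intros)
  have bd: "\<exists>d h. d > 0 \<and> summable h \<and> (\<forall>n. 0 \<le> h n) \<and>
      (\<forall>\<^sub>F n in sequentially. \<forall>y\<in>ball x d \<inter> {s. Re s > 0}. norm (powr_defect n (y - 1)) \<le> h n)"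
    if x: "x \<in> {s. Re s > 0}" for x
  proof -
    define e where "e = Re x / 2"
    have e: "0 < e" "e < Re x" using x by (auto simp: e_def)
    obtain d K where dK: "d > 0" "K \<ge> 0"
      "\<And>n y. n \<ge> 1 \<Longrightarrow> y \<in> ball x d \<Longrightarrow> norm (powr_defect n (y - 1)) \<le> K * real n powr (-1 - e)"
      by (rule powr_defect_locally_bounded[of e x]) (use e in auto)
    have "summable (\<lambda>n. K * real n powr (-1 - e))"
      using e by (intro summable_mult) (simp add: summable_real_powr_iff)
    then show ?thesis using dK
      by (intro exI[of _ d] exI[of _ "\<lambda>n. K * real n powr (-1 - e)"]) (auto simp: eventually_sequentially intro!: exI[of _ 1])
  qed
  show ?thesis using holomorphic_suminf(1)[OF op hol bd] unfolding zeta_reg_def .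
qed

lemma zeta_reg_1: "zeta_reg 1 = 1"
proof -
  have "powr_defect n 0 = (if n = 0 then 1 else 0)" for n
    by (simp add: powr_defect_def del: of_nat_Suc)
  then have "(\<lambda>n. powr_defect n (1 - 1)) sums 1"
    using sums_single[of 0 "\<lambda>_. 1 :: complex"] by simp
  then show ?thesis unfolding zeta_reg_def by (rule sums_unique[symmetric])
qed

text \<open>The differences contained in \<open>powr_defect\<close> telescope to 0, because
  \<open>0 powr (1 - s)\<close> is 0 and \<open>n powr (1 - s)\<close> tends to 0.\<close>

lemma zeta_reg_eq:
  assumes s: "Re s > 1"
  shows "zeta_reg s = (s - 1) * zeta s"
proof -
  have "(\<lambda>n. of_nat n powr (1 - s) :: complex) \<longlonglongrightarrow> 0"
    using s by (intro of_nat_powr_tendsto_0) simp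
  from telescope_sums[OF this]
  have "(\<lambda>n. of_nat (Suc n) powr (1 - s) - of_nat n powr (1 - s)) sums (0 :: complex)" by simp
  from sums_add[OF sums_mult[OF sums_zeta[OF s], of "s - 1"] this]
  have "(\<lambda>n. powr_defect n (s - 1)) sums ((s - 1) * zeta s)"
    by (simp add: powr_defect_def algebra_simps)
  then show ?thesis unfolding zeta_reg_def by (rule sums_unique[symmetric])
qed

text \<open>This is the logarithmic derivative multiplied through by \<open>zeta_reg\<close>, so
  that it can be used before \<open>zeta_reg\<close> is known to have no zeros.\<close>

lemma zeta_reg_deriv_eq:
  assumes s: "Re s > 1"
  shows "mangoldt_series s * zeta_reg s = zeta_reg s / (s - 1) - deriv zeta_reg s"
proof -
  have op: "open {s. Re s > 1}" by (rule open_halfspace_Re_gt)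
  have s1: "s \<noteq> 1" using s by auto
  have "((\<lambda>s. (s - 1) * zeta s) has_field_derivative 1 * zeta s + deriv zeta s * (s - 1)) (at s)"
    using holomorphic_derivI[OF zeta_holomorphic op, of s] s by (intro DERIV_mult) (auto intro!: derivative_eq_intros)
  then have "(zeta_reg has_field_derivative 1 * zeta s + deriv zeta s * (s - 1)) (at s)"
    by (rule has_field_derivative_transform_within_open[OF _ op]) (use s zeta_reg_eq in auto)
  then have d: "deriv zeta_reg s = 1 * zeta s + deriv zeta s * (s - 1)" by (rule DERIV_imp_deriv)
  have "deriv zeta s = - (mangoldt_series s * zeta s)" using mangoldt_series_times_zeta[OF s] by simp
  then show ?thesis unfolding d zeta_reg_eq[OF s] using s1 by (simp add: field_simps)
qed

text \<open>The number n is the order of vanishing at z0: with f = (z - z0)^n g and g nonzero near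
  z0, the quotient is n + (z - z0) g'/g. The point w excludes that f vanishes identically on the
  connected set S.\<close>

lemma logderiv_tendsto_order:
  assumes f: "f holomorphic_on S" and S: "open S" "connected S" and z0: "z0 \<in> S"
    and nz: "w \<in> S" "f w \<noteq> 0"
  obtains n :: nat where "((\<lambda>z. (z - z0) * deriv f z / f z) \<longlongrightarrow> of_nat n) (at z0)"
    "\<forall>\<^sub>F z in at z0. f z \<noteq> 0" "f z0 = 0 \<Longrightarrow> n > 0"
proof (cases "f z0 = 0")
  case False
  have cont: "isCont f z0" and dcont: "isCont (deriv f) z0"
    using holomorphic_on_imp_continuous_on[OF f] holomorphic_on_imp_continuous_on[OF holomorphic_deriv[OF f S(1)]] S z0
    by (auto simp: continuous_on_eq_continuous_at)
  have "((\<lambda>z. (z - z0) * deriv f z / f z) \<longlongrightarrow> (z0 - z0) * deriv f z0 / f z0) (at z0)"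
    using cont dcont False by (intro tendsto_intros) (auto simp: isCont_def)
  moreover have "\<forall>\<^sub>F z in at z0. f z \<noteq> 0"
    using cont False unfolding isCont_def by (rule tendsto_imp_eventually_ne)
  ultimately show ?thesis using that[of 0] False by simp
next
  case True
  have "\<not> f constant_on S" using True nz z0 unfolding constant_on_def by metis
  then obtain g r n where g: "0 < n" "0 < r" "ball z0 r \<subseteq> S" "g holomorphic_on ball z0 r"
    "\<And>w. w \<in> ball z0 r \<Longrightarrow> f w = (w - z0) ^ n * g w" "\<And>w. w \<in> ball z0 r \<Longrightarrow> g w \<noteq> 0"
    by (rule holomorphic_factor_zero_nonconstant[OF f S z0 True]) (rule that)
  have eq: "(z - z0) * deriv f z / f z = of_nat n + (z - z0) * deriv g z / g z"
    if z: "z \<in> ball z0 r" "z \<noteq> z0" for z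
  proof -
    have "((\<lambda>w. (w - z0) ^ n * g w) has_field_derivative
        (of_nat n * (z - z0) ^ (n - 1)) * g z + deriv g z * (z - z0) ^ n) (at z)"
      using holomorphic_derivI[OF g(4) open_ball z(1)]
      by (intro DERIV_mult) (auto intro!: derivative_eq_intros)
    then have "(f has_field_derivative
        (of_nat n * (z - z0) ^ (n - 1)) * g z + deriv g z * (z - z0) ^ n) (at z)"
      by (rule has_field_derivative_transform_within_open[OF _ open_ball z(1)]) (use g(5) in auto)
    then have d: "deriv f z = (of_nat n * (z - z0) ^ (n - 1)) * g z + deriv g z * (z - z0) ^ n"
      by (rule DERIV_imp_deriv)
    have "(z - z0) * (z - z0) ^ (n - 1) = (z - z0) ^ n" using g(1) by (cases n) auto
    then have "(z - z0) * deriv f z = (z - z0) ^ n * (of_nat n * g z + (z - z0) * deriv g z)"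
      unfolding d by (simp add: algebra_simps)
    then show ?thesis using g(5,6)[OF z(1)] z(2) by (simp add: divide_simps)
  qed
  have ev: "\<forall>\<^sub>F z in at z0. z \<in> ball z0 r \<and> z \<noteq> z0"
    using g(2) by (auto simp: eventually_at intro!: exI[of _ r] simp: dist_commute)
  have cg: "isCont g z0" "isCont (deriv g) z0"
    using holomorphic_on_imp_continuous_on[OF g(4)] holomorphic_on_imp_continuous_on[OF holomorphic_deriv[OF g(4) open_ball]] g(2)
    by (auto simp: continuous_on_eq_continuous_at)
  have "((\<lambda>z. of_nat n + (z - z0) * deriv g z / g z) \<longlongrightarrow> of_nat n + (z0 - z0) * deriv g z0 / g z0) (at z0)"
    using cg g(2) g(6)[of z0] by (intro tendsto_intros) (auto simp: isCont_def)
  then have "((\<lambda>z. (z - z0) * deriv f z / f z) \<longlongrightarrow> of_nat n + (z0 - z0) * deriv g z0 / g z0) (at z0)"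
    by (rule Lim_transform_eventually) (use ev eq in \<open>auto elim!: eventually_mono\<close>)
  moreover have "\<forall>\<^sub>F z in at z0. f z \<noteq> 0"
    using ev by eventually_elim (use g(5,6) in auto)
  ultimately show ?thesis using that[of n] g(1) by simp
qed

text \<open>Near s, \<open>mangoldt_series\<close> is 1/(z - 1) minus the logarithmic derivative of
  \<open>zeta_reg\<close>: the first part counts only at s = 1, the second yields the order n of a
  zero. The point s is approached from the right, where the series converges.\<close>

lemma mangoldt_series_limit:
  assumes s: "Re s \<ge> 1"
  obtains n :: nat where
    "((\<lambda>h. of_real h * mangoldt_series (s + of_real h)) \<longlongrightarrow> (if s = 1 then 1 else 0) - of_nat n) (at_right 0)"
    "zeta_reg s = 0 \<Longrightarrow> n > 0"
proof -
  have op: "open {s. Re s > 0}" by (rule open_halfspace_Re_gt)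
  have con: "connected {s. Re s > 0}" by (intro convex_connected convex_halfspace_Re_gt)
  obtain n where n: "((\<lambda>z. (z - s) * deriv zeta_reg z / zeta_reg z) \<longlongrightarrow> of_nat n) (at s)"
    "\<forall>\<^sub>F z in at s. zeta_reg z \<noteq> 0" "zeta_reg s = 0 \<Longrightarrow> n > 0"
    using logderiv_tendsto_order[OF zeta_reg_holomorphic op con, of s 1] s zeta_reg_1 by auto
  have lim: "filterlim (\<lambda>h. s + of_real h) (at s) (at_right 0)"
    unfolding filterlim_at by (auto intro!: tendsto_eq_intros simp: eventually_at_filter)
  have 1: "((\<lambda>h. of_real h * deriv zeta_reg (s + of_real h) / zeta_reg (s + of_real h)) \<longlongrightarrow> of_nat n) (at_right 0)"
    using filterlim_compose[OF n(1) lim] by simp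
  have 2: "((\<lambda>h. of_real h / (s + of_real h - 1)) \<longlongrightarrow> (if s = 1 then 1 else 0)) (at_right (0::real))"
  proof (cases "s = 1")
    case True
    have "\<forall>\<^sub>F h in at_right (0::real). 1 = of_real h / (s + of_real h - 1)"
      by (auto simp: eventually_at_filter True)
    then show ?thesis using True by (auto intro: Lim_transform_eventually[OF tendsto_const])
  next
    case False
    have "((\<lambda>h. of_real h / (s + of_real h - 1)) \<longlongrightarrow> of_real 0 / (s + of_real 0 - 1)) (at_right (0::real))"
      using False by (intro tendsto_intros) auto
    then show ?thesis using False by simp
  qed
  have "((\<lambda>h. of_real h / (s + of_real h - 1) - of_real h * deriv zeta_reg (s + of_real h) / zeta_reg (s + of_real h))
      \<longlongrightarrow> (if s = 1 then 1 else 0) - of_nat n) (at_right 0)"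
    by (intro tendsto_diff 1 2)
  moreover have "\<forall>\<^sub>F h in at_right 0. of_real h / (s + of_real h - 1) - of_real h * deriv zeta_reg (s + of_real h) / zeta_reg (s + of_real h)
      = of_real h * mangoldt_series (s + of_real h)"
  proof -
    have "\<forall>\<^sub>F h in at_right 0. zeta_reg (s + of_real h) \<noteq> 0"
      using eventually_compose_filterlim[OF n(2) lim] .
    moreover have "\<forall>\<^sub>F h in at_right (0::real). h > 0" by (simp add: eventually_at_filter)
    ultimately show ?thesis
    proof eventually_elim
      case (elim h)
      have *: "mangoldt_series (s + of_real h) = 1 / (s + of_real h - 1) - deriv zeta_reg (s + of_real h) / zeta_reg (s + of_real h)"
        using zeta_reg_deriv_eq[of "s + of_real h"] elim s by (simp add: field_simps)
      show ?case unfolding * by (simp add: right_diff_distrib)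
    qed
  qed
  ultimately have "((\<lambda>h. of_real h * mangoldt_series (s + of_real h)) \<longlongrightarrow> (if s = 1 then 1 else 0) - of_nat n) (at_right 0)"
    by (rule Lim_transform_eventually)
  then show thesis by (rule that) (rule n(3))
qed

lemma norm_mangoldt_series_le:
  assumes "Re s > 1" "Re z \<ge> Re s"
  shows "norm (mangoldt_series z) \<le> (\<Sum>n. norm (mangoldt n * of_nat n powr -s :: complex))"
  unfolding mangoldt_series_def
proof (rule norm_suminf_le[OF _ summable_norm_mangoldt[OF assms(1)]])
  show "norm (mangoldt n * of_nat n powr -z :: complex) \<le> norm (mangoldt n * of_nat n powr -s :: complex)" for n
  proof (cases "n = 0")
    case False
    then show ?thesis unfolding norm_mult norm_of_nat_powr using assms
      by (intro mult_left_mono powr_mono) (auto simp: mangoldt_nonneg)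
  qed simp
qed

text \<open>Mertens's inequality 3 + 4 cos x + cos 2x = 2 (1 + cos x)^2 \<ge> 0, applied to every
  term with x = t ln n.\<close>

lemma Re_mangoldt_3_4_1:
  assumes "\<sigma> > 1"
  shows "3 * Re (mangoldt_series (of_real \<sigma>)) + 4 * Re (mangoldt_series (Complex \<sigma> t)) + Re (mangoldt_series (Complex \<sigma> (2 * t))) \<ge> 0"
proof -
  have re: "Re (mangoldt n * of_nat n powr -Complex \<sigma> u) = mangoldt n * real n powr -\<sigma> * cos (u * ln (real n))" for n u
  proof (cases "n = 0")
    case False
    have "of_nat n powr -Complex \<sigma> u = exp (- Complex \<sigma> u * of_real (ln (real n)))"
      using False by (simp add: powr_def Ln_of_nat)
    then have "Re (of_nat n powr -Complex \<sigma> u) = exp (-\<sigma> * ln (real n)) * cos (u * ln (real n))"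
      by (simp add: Re_exp)
    then show ?thesis using False by (simp add: powr_def Re_divide_of_real mangoldt_def)
  qed simp
  have sums: "(\<lambda>n. mangoldt n * real n powr -\<sigma> * cos (u * ln (real n))) sums Re (mangoldt_series (Complex \<sigma> u))" for u
    using sums_Re[OF sums_mangoldt[of "Complex \<sigma> u"]] assms unfolding re by simp
  have S: "(\<lambda>n. 3 * (mangoldt n * real n powr -\<sigma> * cos (0 * ln (real n))) + 4 * (mangoldt n * real n powr -\<sigma> * cos (t * ln (real n)))
      + mangoldt n * real n powr -\<sigma> * cos ((2 * t) * ln (real n)))
     sums (3 * Re (mangoldt_series (Complex \<sigma> 0)) + 4 * Re (mangoldt_series (Complex \<sigma> t)) + Re (mangoldt_series (Complex \<sigma> (2 * t))))"
    by (intro sums_add sums_mult sums)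
  have P: "3 * (mangoldt n * real n powr -\<sigma> * cos (0 * ln (real n))) + 4 * (mangoldt n * real n powr -\<sigma> * cos (t * ln (real n)))
      + mangoldt n * real n powr -\<sigma> * cos ((2 * t) * ln (real n)) \<ge> 0" for n
  proof -
    define \<theta> where "\<theta> = t * ln (real n)"
    have "3 + 4 * cos \<theta> + cos (2 * \<theta>) = 2 * (1 + cos \<theta>)\<^sup>2"
      unfolding cos_double_cos by (simp add: power2_eq_square algebra_simps)
    then have "mangoldt n * real n powr -\<sigma> * (3 + 4 * cos \<theta> + cos (2 * \<theta>)) \<ge> 0"
      by (simp add: mangoldt_nonneg)
    then show ?thesis by (simp add: \<theta>_def algebra_simps)
  qed
  from sums_le[OF P sums_zero S]
  have "0 \<le> 3 * Re (mangoldt_series (Complex \<sigma> 0)) + 4 * Re (mangoldt_series (Complex \<sigma> t)) + Re (mangoldt_series (Complex \<sigma> (2 * t)))"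
    .
  then show ?thesis by (simp add: complex_of_real_def)
qed

text \<open>To the right of the line \<open>mangoldt_series\<close> is bounded near s, so the order
  is 0. On the line, with s = 1 + it and t nonzero, let n0, n, n2 be the orders at 1, s and 1 + 2it;
  the 3-4-1 inequality in the limit reads 3 (1 - n0) - 4 n - n2 \<ge> 0, which forces n = 0.\<close>

lemma zeta_reg_nonzero:
  assumes s: "Re s \<ge> 1"
  shows "zeta_reg s \<noteq> 0"
proof
  assume z: "zeta_reg s = 0"
  then have s1: "s \<noteq> 1" using zeta_reg_1 by auto
  obtain n where n: "((\<lambda>h. of_real h * mangoldt_series (s + of_real h)) \<longlongrightarrow> (if s = 1 then 1 else 0) - of_nat n) (at_right 0)" "n > 0"
    by (rule mangoldt_series_limit[OF s]) (use z in auto)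
  show False
  proof (cases "Re s > 1")
    case True
    define K where "K = (\<Sum>n. norm (mangoldt n * of_nat n powr -s :: complex))"
    have ev: "\<forall>\<^sub>F h in at_right 0. norm (of_real h * mangoldt_series (s + of_real h)) \<le> h * K"
    proof -
      have "\<forall>\<^sub>F h in at_right (0::real). h > 0" by (simp add: eventually_at_filter)
      then show ?thesis
      proof eventually_elim
        case (elim h)
        then show ?case using norm_mangoldt_series_le[OF True, of "s + of_real h"]
          by (simp add: norm_mult K_def mult_left_mono)
      qed
    qed
    have "((\<lambda>h. h * K) \<longlongrightarrow> 0) (at_right 0)" by (auto intro!: tendsto_eq_intros)
    from Lim_null_comparison[OF ev this]
    have "((\<lambda>h. of_real h * mangoldt_series (s + of_real h)) \<longlongrightarrow> 0) (at_right 0)" .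
    from tendsto_unique[OF _ n(1) this] show False using n(2) s1 by simp
  next
    case False
    then have re: "Re s = 1" using s by simp
    define t where "t = Im s"
    have t: "t \<noteq> 0" using s1 re by (auto simp: t_def complex_eq_iff)
    obtain n0 where n0: "((\<lambda>h. of_real h * mangoldt_series (1 + of_real h)) \<longlongrightarrow> (if (1::complex) = 1 then 1 else 0) - of_nat n0) (at_right 0)"
      by (rule mangoldt_series_limit[of 1]) auto
    obtain n2 where n2: "((\<lambda>h. of_real h * mangoldt_series (Complex 1 (2 * t) + of_real h)) \<longlongrightarrow> (if Complex 1 (2 * t) = 1 then 1 else 0) - of_nat n2) (at_right 0)"
      by (rule mangoldt_series_limit[of "Complex 1 (2 * t)"]) auto
    have "((\<lambda>h. 3 * Re (of_real h * mangoldt_series (1 + of_real h)) + 4 * Re (of_real h * mangoldt_series (s + of_real h))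
        + Re (of_real h * mangoldt_series (Complex 1 (2 * t) + of_real h))) \<longlongrightarrow>
        3 * Re ((if (1::complex) = 1 then 1 else 0) - of_nat n0) + 4 * Re ((if s = 1 then 1 else 0) - of_nat n)
        + Re ((if Complex 1 (2 * t) = 1 then 1 else 0) - of_nat n2)) (at_right 0)"
      by (intro tendsto_intros n0 n2 n(1))
    moreover have "\<forall>\<^sub>F h in at_right 0. 3 * Re (of_real h * mangoldt_series (1 + of_real h)) + 4 * Re (of_real h * mangoldt_series (s + of_real h))
        + Re (of_real h * mangoldt_series (Complex 1 (2 * t) + of_real h)) \<ge> 0"
    proof -
      have "\<forall>\<^sub>F h in at_right (0::real). h > 0" by (simp add: eventually_at_filter)
      then show ?thesis
      proof eventually_elim
        case (elim h)
        have eqs: "1 + of_real h = (of_real (1 + h) :: complex)" "s + of_real h = Complex (1 + h) t" "Complex 1 (2 * t) + of_real h = Complex (1 + h) (2 * t)"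
          using re by (auto simp: complex_eq_iff t_def)
        have "h * (3 * Re (mangoldt_series (of_real (1 + h))) + 4 * Re (mangoldt_series (Complex (1 + h) t)) + Re (mangoldt_series (Complex (1 + h) (2 * t)))) \<ge> 0"
          using Re_mangoldt_3_4_1[of "1 + h" t] elim by (intro mult_nonneg_nonneg) auto
        then show ?case unfolding eqs by (simp add: algebra_simps)
      qed
    qed
    ultimately have "0 \<le> 3 * Re ((if (1::complex) = 1 then 1 else 0) - of_nat n0) + 4 * Re ((if s = 1 then 1 else 0) - of_nat n)
        + Re ((if Complex 1 (2 * t) = 1 then 1 else 0) - of_nat n2)"
      by (rule tendsto_lowerbound) simp
    moreover have "Complex 1 (2 * t) \<noteq> 1" using t by (auto simp: complex_eq_iff)
    ultimately have "0 \<le> 3 - 3 * real n0 - 4 * real n - real n2" using s1 by simp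
    then show False using n(2) by simp
  qed
qed

subsection \<open>The prime number theorem\<close>

definition psi :: "nat \<Rightarrow> real" where
  "psi n = (\<Sum>k\<le>n. mangoldt k)"

lemma psi_0 [simp]: "psi 0 = 0"
  by (simp add: psi_def)

lemma psi_Suc: "psi (Suc n) = psi n + mangoldt (Suc n)"
  by (simp add: psi_def)

lemma psi_mono: "m \<le> n \<Longrightarrow> psi m \<le> psi n"
  unfolding psi_def by (intro sum_mono2) (auto simp: mangoldt_nonneg)

lemma psi_nonneg: "psi n \<ge> 0"
  unfolding psi_def by (intro sum_nonneg) (auto simp: mangoldt_nonneg)

text \<open>Legendre's formula. Summing up to m instead of n only adds zeros, and lets the formulas
  for n and 2n be subtracted under one sum.\<close>

lemma ln_fact_eq_sum_mangoldt:
  assumes "n \<le> m"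
  shows "ln (fact n) = (\<Sum>d=1..m. mangoldt d * real (n div d))"
  using assms
proof (induction n)
  case (Suc n)
  have "ln (fact (Suc n) :: real) = ln (real (Suc n)) + ln (fact n)"
    by (simp add: ln_mult del: of_nat_Suc)
  also have "ln (real (Suc n)) = (\<Sum>d | d dvd Suc n. mangoldt d)"
    by (subst mangoldt_sum) auto
  also have "\<dots> = (\<Sum>d=1..m. mangoldt d * (if d dvd Suc n then 1 else 0))"
  proof (rule sum.mono_neutral_cong_left)
    have "1 \<le> d \<and> d \<le> m" if "d dvd Suc n" for d
      using dvd_imp_le[OF that] Suc.prems that by (cases d) auto
    then show "{d. d dvd Suc n} \<subseteq> {1..m}" by auto
  qed auto
  also have "ln (fact n) = (\<Sum>d=1..m. mangoldt d * real (n div d))"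
    using Suc by simp
  also have "(\<Sum>d=1..m. mangoldt d * (if d dvd Suc n then 1 else 0)) + (\<Sum>d=1..m. mangoldt d * real (n div d))
      = (\<Sum>d=1..m. mangoldt d * real (Suc n div d))"
    unfolding sum.distrib[symmetric]
  proof (rule sum.cong[OF refl])
    fix d assume "d \<in> {1..m}"
    have "Suc n div d = n div d + (if d dvd Suc n then 1 else 0)"
      by (simp add: div_Suc dvd_eq_mod_eq_0)
    then show "mangoldt d * (if d dvd Suc n then 1 else 0) + mangoldt d * real (n div d) = mangoldt d * real (Suc n div d)"
      by (simp add: algebra_simps)
  qed
  finally show ?case .
qed simp

text \<open>Chebyshev's argument: \<open>2 * n div d - 2 * (n div d)\<close> is never negative and
  equals 1 for n < d \<le> 2n, so the difference is at most the logarithm of the central binomial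
  coefficient.\<close>

lemma psi_double_le: "psi (2 * n) \<le> psi n + 2 * real n * ln 2"
proof -
  have "psi (2 * n) - psi n = (\<Sum>d\<in>{n<..2*n}. mangoldt d)"
  proof -
    have "{..2*n} = {..n} \<union> {n<..2*n}" by auto
    then have "psi (2 * n) = psi n + (\<Sum>d\<in>{n<..2*n}. mangoldt d)"
      unfolding psi_def by (subst sum.union_disjoint[symmetric]) auto
    then show ?thesis by simp
  qed
  also have "\<dots> \<le> (\<Sum>d=1..2*n. mangoldt d * (real (2 * n div d) - 2 * real (n div d)))"
  proof -
    have ge: "real (2 * n div d) - 2 * real (n div d) \<ge> 0" for d
    proof -
      have "2 * (n div d) \<le> (2 * n) div d"
        by (cases "d = 0") (auto simp: less_eq_div_iff_mult_less_eq mult.assoc)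
      then show ?thesis by linarith
    qed
    have eq: "real (2 * n div d) - 2 * real (n div d) = 1" if "d \<in> {n<..2*n}" for d
    proof -
      have "(2 * n) div d = 1" using that by (intro div_nat_eqI) auto
      then show ?thesis using that by simp
    qed
    have "(\<Sum>d\<in>{n<..2*n}. mangoldt d) = (\<Sum>d\<in>{n<..2*n}. mangoldt d * (real (2 * n div d) - 2 * real (n div d)))"
      using eq by (intro sum.cong) auto
    also have "\<dots> \<le> (\<Sum>d=1..2*n. mangoldt d * (real (2 * n div d) - 2 * real (n div d)))"
      by (intro sum_mono2 mult_nonneg_nonneg mangoldt_nonneg ge) auto
    finally show ?thesis .
  qed
  also have "\<dots> = ln (fact (2 * n)) - 2 * ln (fact n)"
    using ln_fact_eq_sum_mangoldt[of "2 * n" "2 * n"] ln_fact_eq_sum_mangoldt[of n "2 * n"]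
    by (simp add: algebra_simps sum_subtractf sum_distrib_left)
  also have "\<dots> = ln (real (2 * n choose n))"
  proof -
    have "(fact (2 * n) :: real) = real (2 * n choose n) * (fact n * fact n)"
      using binomial_fact[of n "2 * n", where 'a = real] by (simp add: mult_2 field_simps)
    then show ?thesis by (simp add: ln_mult)
  qed
  also have "\<dots> \<le> ln (2 ^ (2 * n))"
  proof -
    have "real (2 * n choose n) \<le> real (2 ^ (2 * n))"
      using binomial_le_pow2[of "2 * n" n] by (simp only: of_nat_le_iff)
    moreover have "0 < real (2 * n choose n)" by simp
    ultimately show ?thesis by (simp only: of_nat_power of_nat_numeral ln_mono)
  qed
  also have "\<dots> = 2 * real n * ln 2" by (simp add: ln_realpow)
  finally show ?thesis by simp
qed

text \<open>Induction by halving. With n = 2k or n = 2k + 1, doubling gives psi(2k) \<le> 6k; the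
  room up to 8k absorbs the term at 2k + 1, which is at most 2k.\<close>

lemma psi_le: "psi n \<le> 4 * real n"
proof (induction n rule: less_induct)
  case (less n)
  show ?case
  proof (cases "n \<le> 1")
    case True
    then have "n = 0 \<or> n = 1" by auto
    then show ?thesis by (auto simp: psi_def)
  next
    case False
    define k where "k = n div 2"
    have ln2: "ln (2::real) \<le> 1" using ln_le_minus_one[of "2::real"] by simp
    have k: "k < n" "k \<ge> 1" using False by (auto simp: k_def)
    have "psi (2 * k) \<le> 4 * real k + 2 * real k * ln 2"
      using psi_double_le[of k] less.IH[OF k(1)] by simp
    also have "2 * real k * ln 2 \<le> 2 * real k * 1" using ln2 by (intro mult_left_mono) auto
    finally have *: "psi (2 * k) \<le> 6 * real k" by simp
    show ?thesis
    proof (cases "even n")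
      case True
      then have "n = 2 * k" by (simp add: k_def)
      then show ?thesis using * by simp
    next
      case False
      then have n: "n = Suc (2 * k)" by (simp add: k_def)
      have "mangoldt n \<le> ln (real n)" using n by (intro mangoldt_le) simp
      also have "\<dots> \<le> real n - 1" using n by (intro ln_le_minus_one) simp
      finally show ?thesis using * k unfolding n psi_Suc by simp
    qed
  qed
qed

section \<open>Convergence of the sum of (psi(n) - n)/n^2\<close>

lemma psi_partial_summation:
  fixes s :: complex
  shows "(\<Sum>n<N. of_real (psi n - real n) * (of_nat n powr -s - of_nat (Suc n) powr -s)) + of_real (psi N - real N) * of_nat N powr -s
    = (\<Sum>n\<le>N. mangoldt n * of_nat n powr -s) - (\<Sum>n\<le>N. of_nat n powr -s)"
proof (induction N)
  case (Suc N)
  have "of_real (mangoldt (Suc N)) = (mangoldt (Suc N) :: complex)" by simp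
  then show ?case using Suc unfolding sum.lessThan_Suc sum.atMost_Suc psi_Suc
    by (simp add: algebra_simps del: of_real_mangoldt)
qed simp

lemma psi_difference_sums:
  assumes s: "Re s > 1"
  shows "(\<lambda>n. of_real (psi n - real n) * (of_nat n powr -s - of_nat (Suc n) powr -s)) sums (mangoldt_series s - zeta s)"
proof -
  have "(\<lambda>N. of_real (psi N - real N) * of_nat N powr -s :: complex) \<longlonglongrightarrow> 0"
  proof (rule Lim_null_comparison)
    have "norm (of_real (psi N - real N) * of_nat N powr -s :: complex) \<le> 5 * real N powr (1 - Re s)" for N
    proof (cases "N = 0")
      case False
      have "\<bar>psi N - real N\<bar> \<le> 5 * real N" using psi_le[of N] psi_nonneg[of N] by (simp add: abs_le_iff)
      then have "\<bar>psi N - real N\<bar> * real N powr -Re s \<le> 5 * real N * real N powr -Re s"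
        by (intro mult_right_mono) auto
      also have "\<dots> = 5 * real N powr (1 - Re s)"
        using False by (simp add: powr_diff powr_minus divide_simps)
      finally show ?thesis by (simp only: norm_mult norm_of_nat_powr norm_of_real) simp
    qed simp
    then show "\<forall>\<^sub>F N in sequentially. norm (of_real (psi N - real N) * of_nat N powr -s :: complex) \<le> 5 * real N powr (1 - Re s)"
      by simp
    have "(\<lambda>N. real N powr (1 - Re s)) \<longlonglongrightarrow> 0"
      using s by (intro tendsto_neg_powr filterlim_real_sequentially) auto
    then show "(\<lambda>N. 5 * real N powr (1 - Re s)) \<longlonglongrightarrow> 0"
      by (rule tendsto_mult_right_zero)
  qed
  note 1 = this
  have 2: "(\<lambda>N. (\<Sum>n\<le>N. mangoldt n * of_nat n powr -s) - (\<Sum>n\<le>N. of_nat n powr -s)) \<longlonglongrightarrow> mangoldt_series s - zeta s"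
    using sums_mangoldt[OF s] sums_zeta[OF s] unfolding sums_def_le by (intro tendsto_diff)
  from tendsto_diff[OF 2 1] have "(\<lambda>N. (\<Sum>n\<le>N. mangoldt n * of_nat n powr -s) - (\<Sum>n\<le>N. of_nat n powr -s) - of_real (psi N - real N) * of_nat N powr -s)
      \<longlonglongrightarrow> mangoldt_series s - zeta s - 0"
    .
  then show ?thesis
    unfolding sums_def psi_partial_summation[symmetric] by simp
qed

lemma abs_psi_diff_le: "\<bar>psi n - real n\<bar> \<le> 5 * real n"
  using psi_le[of n] psi_nonneg[of n] by (simp add: abs_le_iff)

text \<open>The coefficients are O(n) and the defects O(n^(-Re s - 2)), so the series reaches beyond
  the line Re s = 1.\<close>

lemma psi_defect_holomorphic:
  shows "(\<lambda>s. \<Sum>n. of_real (psi n - real n) * powr_defect n s) holomorphic_on {s. Re s > 0}"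
    and "Re s > 0 \<Longrightarrow> (\<lambda>n. of_real (psi n - real n) * powr_defect n s) sums (\<Sum>n. of_real (psi n - real n) * powr_defect n s)"
proof -
  have op: "open {s. Re s > 0}" by (rule open_halfspace_Re_gt)
  have hol: "(\<lambda>s. of_real (psi n - real n) * powr_defect n s) holomorphic_on {s. Re s > 0}" for n by (intro holomorphic_intros)
  have bd: "\<exists>d h. d > 0 \<and> summable h \<and> (\<forall>n. 0 \<le> h n) \<and>
      (\<forall>\<^sub>F n in sequentially. \<forall>y\<in>ball x d \<inter> {s. Re s > 0}. norm (of_real (psi n - real n) * powr_defect n y) \<le> h n)"
    if x: "x \<in> {s. Re s > 0}" for x
  proof -
    define e where "e = 1 + Re x / 2"
    have e: "1 < e" "e < Re (x + 1)" using x by (auto simp: e_def)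
    obtain d K where dK: "d > 0" "K \<ge> 0"
      "\<And>n y. n \<ge> 1 \<Longrightarrow> y \<in> ball (x + 1) d \<Longrightarrow> norm (powr_defect n (y - 1)) \<le> K * real n powr (-1 - e)"
      by (rule powr_defect_locally_bounded[of e "x + 1"]) (use e in auto)
    have "norm (of_real (psi n - real n) * powr_defect n y) \<le> 5 * K * real n powr (-e)" if "n \<ge> 1" "y \<in> ball x d" for n y
    proof -
      have "norm (powr_defect n y) \<le> K * real n powr (-1 - e)"
        using dK(3)[of n "y + 1"] that by (simp add: dist_norm)
      then have "\<bar>psi n - real n\<bar> * norm (powr_defect n y) \<le> (5 * real n) * (K * real n powr (-1 - e))"
        using abs_psi_diff_le[of n] by (intro mult_mono) auto
      also have "\<dots> = 5 * K * (real n * real n powr (-1 - e))" by simp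
      also have "real n * real n powr (-1 - e) = real n powr (-e)"
        using that powr_mult_base[of "real n" "-1 - e"] by simp
      finally show ?thesis by (simp only: norm_mult norm_of_real)
    qed
    moreover have "summable (\<lambda>n. 5 * K * real n powr (-e))"
      using e by (intro summable_mult) (simp add: summable_real_powr_iff)
    ultimately show ?thesis using dK(1,2)
      by (intro exI[of _ d] exI[of _ "\<lambda>n. 5 * K * real n powr (-e)"]) (auto simp: eventually_sequentially intro!: exI[of _ 1])
  qed
  note * = holomorphic_suminf(1,2)[OF op hol bd]
  show "(\<lambda>s. \<Sum>n. of_real (psi n - real n) * powr_defect n s) holomorphic_on {s. Re s > 0}" using *(1) .
  show "(\<lambda>n. of_real (psi n - real n) * powr_defect n s) sums (\<Sum>n. of_real (psi n - real n) * powr_defect n s)"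
    if "Re s > 0" using *(2) that by simp
qed

text \<open>By definition s n^(-s-1) is n^(-s) - (n+1)^(-s) plus \<open>powr_defect n s\<close>, so
  s F(s) is \<open>mangoldt_series s - zeta s\<close>, by partial summation, plus the holomorphic
  series \<open>E\<close>. The poles at 1 cancel and leave -zeta_reg'/zeta_reg - \<open>Q\<close>,
  where \<open>Q\<close> is the difference quotient of \<open>zeta_reg\<close> at 1.\<close>

lemma psi_series_continuation:
  obtains U F where "open U" "{s. Re s \<ge> 1} \<subseteq> U" "F holomorphic_on U"
    "\<And>s. Re s > 1 \<Longrightarrow> (\<lambda>n. of_real ((psi n - real n) / real n) * of_nat n powr -s) sums F s"
proof -
  define H0 where "H0 = {s. Re s > 0}"
  define U where "U = {s \<in> H0. zeta_reg s \<noteq> 0}"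
  have op: "open H0" unfolding H0_def by (rule open_halfspace_Re_gt)
  note zhol = zeta_reg_holomorphic[folded H0_def]
  have "U = H0 \<inter> zeta_reg -` (- {0})" by (auto simp: U_def)
  then have opU: "open U"
    using continuous_open_preimage[OF holomorphic_on_imp_continuous_on[OF zhol] op, of "- {0}"] by (simp add: open_Compl)
  have sub: "{s. Re s \<ge> 1} \<subseteq> U" using zeta_reg_nonzero by (auto simp: U_def H0_def)
  have UH: "U \<subseteq> H0" by (auto simp: U_def)
  define Q where "Q s = (if s = 1 then deriv zeta_reg 1 else (zeta_reg s - zeta_reg 1) / (s - 1))" for s
  have Q: "Q holomorphic_on H0" unfolding Q_def by (rule pole_lemma_open[OF zhol op])
  define E where "E s = (\<Sum>n. of_real (psi n - real n) * powr_defect n s)" for s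
  have E: "E holomorphic_on H0" unfolding E_def[abs_def] H0_def by (rule psi_defect_holomorphic)
  define F where "F s = (- (deriv zeta_reg s / zeta_reg s) - Q s + E s) / s" for s
  have F: "F holomorphic_on U"
    unfolding F_def
    by (intro holomorphic_intros holomorphic_on_subset[OF Q UH] holomorphic_on_subset[OF E UH] holomorphic_on_subset[OF zhol UH]
        holomorphic_on_subset[OF holomorphic_deriv[OF zhol op] UH]) (auto simp: U_def H0_def)
  have "(\<lambda>n. of_real ((psi n - real n) / real n) * of_nat n powr -s) sums F s" if s: "Re s > 1" for s
  proof -
    have nz: "s \<noteq> 0" "s \<noteq> 1" "zeta_reg s \<noteq> 0" using s zeta_reg_nonzero[of s] by auto
    have "mangoldt_series s - zeta s = - (deriv zeta_reg s / zeta_reg s) - Q s"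
    proof -
      have "mangoldt_series s = (zeta_reg s / (s - 1) - deriv zeta_reg s) / zeta_reg s"
        using zeta_reg_deriv_eq[OF s] nz by (simp add: eq_divide_eq)
      also have "\<dots> = 1 / (s - 1) - deriv zeta_reg s / zeta_reg s"
        using nz by (simp add: diff_divide_distrib)
      finally have 1: "mangoldt_series s = 1 / (s - 1) - deriv zeta_reg s / zeta_reg s" .
      have 2: "zeta s = zeta_reg s / (s - 1)" using zeta_reg_eq[OF s] nz by simp
      show ?thesis unfolding 1 2 using nz by (simp add: Q_def zeta_reg_1 diff_divide_distrib)
    qed
    then have "(\<lambda>n. of_real (psi n - real n) * (of_nat n powr -s - of_nat (Suc n) powr -s)) sums (- (deriv zeta_reg s / zeta_reg s) - Q s)"
      using psi_difference_sums[OF s] by simp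
    moreover have "(\<lambda>n. of_real (psi n - real n) * powr_defect n s) sums E s"
      unfolding E_def using s by (intro psi_defect_holomorphic) auto
    ultimately have "(\<lambda>n. (of_real (psi n - real n) * (of_nat n powr -s - of_nat (Suc n) powr -s)
        + of_real (psi n - real n) * powr_defect n s) / s) sums F s"
      unfolding F_def by (intro sums_divide sums_add)
    moreover have "(of_real (psi n - real n) * (of_nat n powr -s - of_nat (Suc n) powr -s)
        + of_real (psi n - real n) * powr_defect n s) / s = of_real ((psi n - real n) / real n) * of_nat n powr -s" for n
    proof -
      have "(of_real (psi n - real n) * (of_nat n powr -s - of_nat (Suc n) powr -s)
        + of_real (psi n - real n) * powr_defect n s) / s = of_real (psi n - real n) * of_nat n powr (-s - 1)"
        using nz unfolding powr_defect_def by (simp add: field_simps)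
      also have "\<dots> = of_real ((psi n - real n) / real n) * of_nat n powr -s"
        by (cases "n = 0") (auto simp: powr_diff)
      finally show ?thesis .
    qed
    ultimately show ?thesis by simp
  qed
  then show thesis using that[OF opU sub F] by simp
qed

lemma summable_psi_diff: "summable (\<lambda>n. (psi n - real n) / (real n)\<^sup>2)"
proof -
  obtain U F where UF: "open U" "{s. Re s \<ge> 1} \<subseteq> U" "F holomorphic_on U"
    "\<And>s. Re s > 1 \<Longrightarrow> (\<lambda>n. of_real ((psi n - real n) / real n) * of_nat n powr -s) sums F s"
    by (rule psi_series_continuation) (rule that)
  have "norm (of_real ((psi n - real n) / real n) :: complex) \<le> 5" for n
  proof (cases "n = 0")
    case False
    then show ?thesis unfolding norm_of_real abs_divide
      using abs_psi_diff_le[of n] by (simp add: divide_le_eq)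
  qed simp
  from newman[OF this UF]
  have "summable (\<lambda>n. of_real ((psi n - real n) / real n) / of_nat n :: complex)"
    by (rule sums_summable)
  then have "summable (\<lambda>n. of_real ((psi n - real n) / real n / real n) :: complex)" by simp
  then have "summable (\<lambda>n. (psi n - real n) / real n / real n)" by (simp only: summable_of_real_iff)
  then show ?thesis by (simp add: power2_eq_square)
qed

text \<open>If psi(N) > (1 + 2 \<eta>) N, monotonicity keeps psi(k) - k \<ge> \<eta> N on a block of
  about \<eta> N integers k after N, so a late block of the convergent series is not small. If
  psi(N) < (1 - 2 \<eta>) N, the block before N does the same with opposite sign.\<close>

theorem psi_asymptotics: "(\<lambda>n. psi n / real n) \<longlonglongrightarrow> 1"
proof (rule LIMSEQ_I)
  fix r :: real assume r: "r > 0"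
  define \<eta> where "\<eta> = min (r / 3) (1 / 3)"
  have \<eta>: "\<eta> > 0" "2 * \<eta> < r" "\<eta> < 1 / 2" using r by (auto simp: \<eta>_def min_def)
  \<comment> \<open>A lower bound for either block: at least \<eta> N terms, each at least \<eta> N
    / ((1 + \<eta>) N)^2.\<close>
  define e where "e = \<eta>\<^sup>2 / (1 + \<eta>)\<^sup>2"
  have e: "e > 0" using \<eta> by (simp add: e_def)
  obtain N0 where N0: "\<And>m n. m \<ge> N0 \<Longrightarrow> norm (\<Sum>k=m..<n. (psi k - real k) / (real k)\<^sup>2) < e"
    using summable_psi_diff[unfolded summable_Cauchy, rule_format, OF e] by auto
  have "\<bar>psi N / real N - 1\<bar> < r" if N: "N \<ge> 2 * N0 + 1" for N
  proof -
    define L where "L = nat \<lceil>\<eta> * real N\<rceil>"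
    have Np: "real N > 0" using N by simp
    have "\<lceil>\<eta> * real N\<rceil> > 0" using Np \<eta>(1) by simp
    then have L: "\<eta> * real N \<le> real L" "real L < \<eta> * real N + 1"
      unfolding L_def by linarith+
    have 1: "psi N \<le> (1 + 2 * \<eta>) * real N"
    proof (rule ccontr)
      assume "\<not> ?thesis"
      then have gt: "psi N > (1 + 2 * \<eta>) * real N" by simp
      have "e \<le> real L * (\<eta> / ((1 + \<eta>)\<^sup>2 * real N))"
      proof -
        have "e = \<eta> * real N * (\<eta> / ((1 + \<eta>)\<^sup>2 * real N))"
          using Np by (simp add: e_def power2_eq_square)
        also have "\<dots> \<le> real L * (\<eta> / ((1 + \<eta>)\<^sup>2 * real N))"
          using L \<eta> Np by (intro mult_right_mono) auto
        finally show ?thesis .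
      qed
      also have "\<dots> = (\<Sum>k=N..<N+L. \<eta> / ((1 + \<eta>)\<^sup>2 * real N))" by simp
      also have "\<dots> \<le> (\<Sum>k=N..<N+L. (psi k - real k) / (real k)\<^sup>2)"
      proof (rule sum_mono)
        fix k assume k: "k \<in> {N..<N+L}"
        then have "k + 1 \<le> N + L" by auto
        then have "real k + 1 \<le> real N + real L" by linarith
        then have kle: "real k \<le> (1 + \<eta>) * real N" using L(2) by (simp add: algebra_simps)
        have kp: "real k > 0" using k Np by auto
        have \<eta>N: "\<eta> * real N \<ge> 0" using \<eta> by simp
        have "psi N \<le> psi k" using k by (intro psi_mono) auto
        then have num: "psi k - real k \<ge> \<eta> * real N" using gt kle by (simp add: algebra_simps)
        have "\<eta> / ((1 + \<eta>)\<^sup>2 * real N) = \<eta> * real N / ((1 + \<eta>) * real N)\<^sup>2"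
          using Np by (simp add: power2_eq_square)
        also have "\<dots> \<le> (psi k - real k) / (real k)\<^sup>2"
          using num kle kp \<eta>N \<eta> Np by (intro frac_le power_mono order_trans[OF \<eta>N num]) auto
        finally show "\<eta> / ((1 + \<eta>)\<^sup>2 * real N) \<le> (psi k - real k) / (real k)\<^sup>2" .
      qed
      also have "\<dots> \<le> norm (\<Sum>k=N..<N+L. (psi k - real k) / (real k)\<^sup>2)" by simp
      also have "\<dots> < e" using N by (intro N0) auto
      finally show False by simp
    qed
    have 2: "psi N \<ge> (1 - 2 * \<eta>) * real N"
    proof (rule ccontr)
      assume "\<not> ?thesis"
      then have lt: "psi N < (1 - 2 * \<eta>) * real N" by simp
      have "\<eta> * real N \<le> 1 / 2 * real N" using \<eta>(3) Np by (intro mult_right_mono) auto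
      then have LN: "real L < real N / 2 + 1" using L(2) by simp
      \<comment> \<open>The block to the left must still lie beyond \<open>N0\<close>; as it covers
        about half of [0, N] at most, N \<ge> 2 N0 + 1 suffices.\<close>
      have low: "N + 1 - L \<ge> N0" using LN N by linarith
      have LN': "L \<le> N" using LN N by linarith
      have "e \<le> \<eta>\<^sup>2"
      proof -
        have "\<eta>\<^sup>2 / (1 + \<eta>)\<^sup>2 \<le> \<eta>\<^sup>2 / 1"
          using \<eta> by (intro divide_left_mono one_le_power) auto
        then show ?thesis by (simp add: e_def)
      qed
      also have "\<dots> \<le> real L * (\<eta> / real N)"
      proof -
        have "\<eta>\<^sup>2 = \<eta> * real N * (\<eta> / real N)" using Np by (simp add: power2_eq_square)
        also have "\<dots> \<le> real L * (\<eta> / real N)" using L \<eta> Np by (intro mult_right_mono) auto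
        finally show ?thesis .
      qed
      also have "\<dots> = (\<Sum>k=N+1-L..<N+1. \<eta> / real N)" using LN' by simp
      also have "\<dots> \<le> (\<Sum>k=N+1-L..<N+1. (real k - psi k) / (real k)\<^sup>2)"
      proof (rule sum_mono)
        fix k assume k: "k \<in> {N+1-L..<N+1}"
        then have "N + 1 \<le> k + L" by auto
        then have "real N + 1 \<le> real k + real L" by linarith
        then have kge: "real k \<ge> (1 - \<eta>) * real N" using L(2) by (simp add: algebra_simps)
        have "(1 - \<eta>) * real N > 0" using \<eta> Np by simp
        then have kp: "real k > 0" using kge by linarith
        have \<eta>N: "\<eta> * real N \<ge> 0" using \<eta> by simp
        have kN: "real k \<le> real N" using k by auto
        have "psi k \<le> psi N" using k by (intro psi_mono) auto
        then have num: "real k - psi k \<ge> \<eta> * real N" using lt kge by (simp add: algebra_simps)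
        have "\<eta> / real N = \<eta> * real N / (real N)\<^sup>2" using Np by (simp add: power2_eq_square)
        also have "\<dots> \<le> (real k - psi k) / (real k)\<^sup>2"
          using num kN kp \<eta>N \<eta> Np by (intro frac_le power_mono order_trans[OF \<eta>N num]) auto
        finally show "\<eta> / real N \<le> (real k - psi k) / (real k)\<^sup>2" .
      qed
      also have "\<dots> = - (\<Sum>k=N+1-L..<N+1. (psi k - real k) / (real k)\<^sup>2)"
      proof -
        have "(real k - psi k) / (real k)\<^sup>2 = - ((psi k - real k) / (real k)\<^sup>2)" for k
          by (simp add: diff_divide_distrib)
        then show ?thesis by (simp only: sum_negf)
      qed
      also have "\<dots> \<le> norm (\<Sum>k=N+1-L..<N+1. (psi k - real k) / (real k)\<^sup>2)" by simp
      also have "\<dots> < e" using low by (intro N0) auto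
      finally show False by simp
    qed
    have "\<bar>psi N / real N - 1\<bar> \<le> 2 * \<eta>"
      using 1 2 Np by (simp add: abs_le_iff field_simps)
    then show ?thesis using \<eta>(2) by simp
  qed
  then show "\<exists>no. \<forall>n\<ge>no. norm (psi n / real n - 1) < r" by (intro exI[of _ "2 * N0 + 1"]) simp
qed

section \<open>From psi to the counting function of the primes\<close>

definition prime_count :: "real \<Rightarrow> nat" where
  "prime_count x = card {p. prime p \<and> real p \<le> x}"

lemma finite_nat_le_real: "finite {n. P n \<and> real n \<le> x}"
proof (rule finite_subset)
  show "{n. P n \<and> real n \<le> x} \<subseteq> {..nat \<lfloor>x\<rfloor>}" by (auto simp: le_nat_floor)
qed simp

lemma card_nat_le_real:
  assumes "x \<ge> 0" "S \<subseteq> {n. 0 < n \<and> real n \<le> x}"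
  shows "real (card S) \<le> x"
proof -
  have "S \<subseteq> {1..nat \<lfloor>x\<rfloor>}" using assms(2) by (auto simp: le_nat_floor)
  then have "card S \<le> nat \<lfloor>x\<rfloor>" using card_mono[of "{1..nat \<lfloor>x\<rfloor>}" S] by simp
  then show ?thesis using assms(1) by linarith
qed

lemma sum_mangoldt_prime_powers_le:
  assumes p: "prime p" "p \<le> n"
  shows "(\<Sum>k | k \<le> n \<and> primepow k \<and> aprimedivisor k = p. mangoldt k) \<le> ln (real n)"
proof -
  define J where "J = nat \<lfloor>ln (real n) / ln (real p)\<rfloor>"
  have p1: "real p > 1" using p prime_gt_1_nat[of p] by simp
  have lnp: "ln (real p) > 0" using p1 by simp
  have n0: "ln (real n) \<ge> 0" using p p1 by simp
  have sub: "{k. k \<le> n \<and> primepow k \<and> aprimedivisor k = p} \<subseteq> (\<lambda>j. p ^ j) ` {1..J}"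
  proof
    fix k assume "k \<in> {k. k \<le> n \<and> primepow k \<and> aprimedivisor k = p}"
    then have k: "k \<le> n" "primepow k" "aprimedivisor k = p" by auto
    define j where "j = multiplicity p k"
    have kj: "k = p ^ j" using primepow_decompose[OF k(2)] k(3) by (simp add: j_def)
    have "j \<noteq> 0" using k(2) kj by (intro notI) simp
    moreover have "real j * ln (real p) \<le> ln (real n)"
    proof -
      have "ln (real k) \<le> ln (real n)" using k(1) kj p1 by (simp add: ln_mono)
      then show ?thesis using p1 by (simp add: kj ln_realpow)
    qed
    then have "real j \<le> ln (real n) / ln (real p)" using lnp by (simp add: field_simps)
    then have "j \<le> J" unfolding J_def by (rule le_nat_floor)
    ultimately show "k \<in> (\<lambda>j. p ^ j) ` {1..J}" using kj by auto
  qed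
  have "(\<Sum>k | k \<le> n \<and> primepow k \<and> aprimedivisor k = p. mangoldt k)
      = real (card {k. k \<le> n \<and> primepow k \<and> aprimedivisor k = p}) * ln (real p)"
    by (simp add: mangoldt_def)
  also have "card {k. k \<le> n \<and> primepow k \<and> aprimedivisor k = p} \<le> J"
    using card_mono[OF _ sub] card_image_le[of "{1..J}" "\<lambda>j. p ^ j"] by simp
  then have "real (card {k. k \<le> n \<and> primepow k \<and> aprimedivisor k = p}) * ln (real p) \<le> real J * ln (real p)"
    using lnp by simp
  also have "real J \<le> ln (real n) / ln (real p)" unfolding J_def using n0 lnp by simp
  then have "real J * ln (real p) \<le> ln (real n)" using lnp by (simp add: field_simps)
  finally show ?thesis by simp
qed

lemma psi_le_prime_count: "psi n \<le> real (prime_count (real n)) * ln (real n)"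
proof -
  define S where "S = {k. k \<le> n \<and> primepow k}"
  have "psi n = (\<Sum>k\<in>S. mangoldt k)"
    unfolding psi_def S_def by (intro sum.mono_neutral_right) (auto simp: mangoldt_def)
  also have "\<dots> = (\<Sum>p | prime p \<and> real p \<le> real n. \<Sum>k | k \<in> S \<and> aprimedivisor k = p. mangoldt k)"
  proof (rule sum.group[symmetric])
    have "prime (aprimedivisor k) \<and> aprimedivisor k \<le> n" if "k \<in> S" for k
    proof -
      have k: "k \<le> n" "primepow k" using that by (auto simp: S_def)
      have "k > 1" using primepow_gt_Suc_0[OF k(2)] by simp
      then show ?thesis using aprimedivisor_nat(1)[of k] aprimedivisor_le_nat[of k] k(1) by auto
    qed
    then show "aprimedivisor ` S \<subseteq> {p. prime p \<and> real p \<le> real n}" by auto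
  qed (auto simp: S_def)
  also have "\<dots> \<le> (\<Sum>p | prime p \<and> real p \<le> real n. ln (real n))"
    using sum_mangoldt_prime_powers_le[of _ n] by (intro sum_mono) (simp add: S_def)
  also have "\<dots> = real (prime_count (real n)) * ln (real n)"
    by (simp add: prime_count_def)
  finally show ?thesis .
qed

lemma sum_ln_primes_le_psi: "(\<Sum>p | prime p \<and> a < real p \<and> real p \<le> x. ln (real p)) \<le> psi (nat \<lfloor>x\<rfloor>)"
proof -
  have "(\<Sum>p | prime p \<and> a < real p \<and> real p \<le> x. ln (real p)) = (\<Sum>p | prime p \<and> a < real p \<and> real p \<le> x. mangoldt p)"
    by (intro sum.cong) auto
  also have "\<dots> \<le> psi (nat \<lfloor>x\<rfloor>)"
    unfolding psi_def by (intro sum_mono2) (auto simp: mangoldt_nonneg le_nat_floor)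
  finally show ?thesis .
qed

text \<open>Primes up to the free cut y are counted trivially; every later one contributes at least
  ln y to psi.\<close>

lemma prime_count_le:
  assumes y: "y > 1"
  shows "real (prime_count x) \<le> y + psi (nat \<lfloor>x\<rfloor>) / ln y"
proof -
  have lny: "ln y > 0" using y by simp
  define A where "A = {p. prime p \<and> real p \<le> y}"
  define B where "B = {p. prime p \<and> y < real p \<and> real p \<le> x}"
  have fin: "finite A" "finite B" unfolding A_def B_def
    using finite_nat_le_real[of prime y] finite_nat_le_real[of "\<lambda>p. prime p \<and> y < real p" x] by (simp_all add: conj_assoc)
  have "prime_count x \<le> card (A \<union> B)"
    unfolding prime_count_def using fin by (intro card_mono) (auto simp: A_def B_def)
  also have "\<dots> \<le> card A + card B" by (rule card_Un_le)
  finally have "real (prime_count x) \<le> real (card A) + real (card B)" by linarith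
  moreover have "real (card A) \<le> y"
    using y by (intro card_nat_le_real) (auto simp: A_def prime_gt_0_nat)
  moreover have "real (card B) * ln y \<le> psi (nat \<lfloor>x\<rfloor>)"
  proof -
    have "real (card B) * ln y = (\<Sum>p\<in>B. ln y)" by simp
    also have "\<dots> \<le> (\<Sum>p\<in>B. ln (real p))" using y by (intro sum_mono) (auto simp: B_def)
    also have "\<dots> \<le> psi (nat \<lfloor>x\<rfloor>)" unfolding B_def by (rule sum_ln_primes_le_psi)
    finally show ?thesis .
  qed
  then have "real (card B) \<le> psi (nat \<lfloor>x\<rfloor>) / ln y" using lny by (simp add: field_simps)
  ultimately show ?thesis by linarith
qed

theorem prime_number_theorem:
  "((\<lambda>x. real (prime_count x) / (x / ln x)) \<longlongrightarrow> 1) at_top"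
proof -
  define P where "P x = psi (nat \<lfloor>x\<rfloor>) / x" for x :: real
  have "((\<lambda>x. psi (nat \<lfloor>x\<rfloor>) / real (nat \<lfloor>x\<rfloor>)) \<longlongrightarrow> 1) at_top"
    by (rule filterlim_compose[OF psi_asymptotics filterlim_floor_sequentially[THEN filterlim_compose[OF filterlim_nat_sequentially]]])
  moreover have "((\<lambda>x. real_of_int \<lfloor>x\<rfloor> / x) \<longlongrightarrow> 1) at_top" by real_asymp
  ultimately have "((\<lambda>x. psi (nat \<lfloor>x\<rfloor>) / real (nat \<lfloor>x\<rfloor>) * (real_of_int \<lfloor>x\<rfloor> / x)) \<longlongrightarrow> 1 * 1) at_top"
    by (rule tendsto_mult)
  moreover have "\<forall>\<^sub>F x in at_top. psi (nat \<lfloor>x\<rfloor>) / real (nat \<lfloor>x\<rfloor>) * (real_of_int \<lfloor>x\<rfloor> / x) = P x"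
    using eventually_ge_at_top[of 1]
  proof eventually_elim
    case (elim x)
    then have "\<lfloor>x\<rfloor> \<noteq> 0" "0 \<le> \<lfloor>x\<rfloor>" by linarith+
    then have "real (nat \<lfloor>x\<rfloor>) = real_of_int \<lfloor>x\<rfloor>" "real_of_int \<lfloor>x\<rfloor> \<noteq> 0" by simp_all
    then show ?case by (simp add: P_def)
  qed
  ultimately have P: "(P \<longlongrightarrow> 1) at_top" by (simp add: filterlim_cong)
  \<comment> \<open>This cut is o(x / ln x), yet its logarithm is asymptotic to ln x, so neither
    part of the split loses anything in the limit.\<close>
  define l where "l x = x / (ln x)\<^sup>2" for x :: real
  have lim1: "((\<lambda>x::real. 1 / ln x) \<longlongrightarrow> 0) at_top" by real_asymp
  have lim2: "((\<lambda>x. ln x / ln (l x)) \<longlongrightarrow> 1) at_top" unfolding l_def by real_asymp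
  from tendsto_add[OF lim1 tendsto_mult[OF P lim2]]
  have upper: "((\<lambda>x. 1 / ln x + P x * (ln x / ln (l x))) \<longlongrightarrow> 1) at_top" by simp
  have ev: "\<forall>\<^sub>F x in at_top. x > 1 \<and> l x > 1"
    unfolding l_def by (intro eventually_conj eventually_gt_at_top) real_asymp
  have "\<forall>\<^sub>F x in at_top. real (prime_count x) / (x / ln x) \<le> 1 / ln x + P x * (ln x / ln (l x))"
    using ev
  proof eventually_elim
    case (elim x)
    then have x: "x > 1" "ln x > 0" by auto
    have "real (prime_count x) / (x / ln x) \<le> (l x + psi (nat \<lfloor>x\<rfloor>) / ln (l x)) / (x / ln x)"
      using prime_count_le[of "l x" x] elim x by (intro divide_right_mono) auto
    also have "\<dots> = 1 / ln x + P x * (ln x / ln (l x))"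
    proof -
      have "l x / (x / ln x) = 1 / ln x" using x by (simp add: l_def power2_eq_square)
      then show ?thesis unfolding add_divide_distrib by (simp add: P_def)
    qed
    finally show ?case .
  qed
  moreover have "\<forall>\<^sub>F x in at_top. P x \<le> real (prime_count x) / (x / ln x)"
    using ev
  proof eventually_elim
    case (elim x)
    then have x: "x > 1" "ln x > 0" by auto
    define n where "n = nat \<lfloor>x\<rfloor>"
    have n: "real n \<le> x" "n \<ge> 1" using x unfolding n_def by linarith+
    have "prime_count (real n) \<le> prime_count x"
      unfolding prime_count_def using n by (intro card_mono finite_nat_le_real) auto
    then have "real (prime_count (real n)) * ln (real n) \<le> real (prime_count x) * ln x"
      using n x by (intro mult_mono) auto
    then have "psi n \<le> real (prime_count x) * ln x" using psi_le_prime_count[of n] by linarith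
    then show ?case using x by (simp add: P_def n_def divide_right_mono)
  qed
  ultimately show ?thesis
    by (intro tendsto_sandwich[OF _ _ P upper])
qed

text \<open>On each dyadic interval (t, 2t] Chebyshev's bound psi(2t) \<le> 8t gives at most 8 / ln
  u, since there p ln p \<ge> t ln u.\<close>

lemma sum_prime_recip_dyadic_le:
  assumes u: "u \<ge> 2"
  shows "(\<Sum>p | prime p \<and> u < real p \<and> real p \<le> 2 ^ L * u. 1 / real p) \<le> real L * (8 / ln u)"
proof (induction L)
  case 0
  have "{p. prime p \<and> u < real p \<and> real p \<le> 2 ^ 0 * u} = {}" by auto
  then show ?case by (simp only: sum.empty)
next
  case (Suc L)
  define t where "t = 2 ^ L * u"
  have "u * 1 \<le> u * 2 ^ L" using u by (intro mult_left_mono) auto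
  then have t: "t \<ge> u" "t > 0" using u by (auto simp: t_def mult.commute)
  have lnu: "ln u > 0" using u by simp
  define A where "A = {p. prime p \<and> u < real p \<and> real p \<le> 2 ^ L * u}"
  define B where "B = {p. prime p \<and> t < real p \<and> real p \<le> 2 * t}"
  have fin: "finite A" "finite B" unfolding A_def B_def
    using finite_nat_le_real[of "\<lambda>p. prime p \<and> u < real p"] finite_nat_le_real[of "\<lambda>p. prime p \<and> t < real p"] by (simp_all add: conj_assoc)
  have "{p. prime p \<and> u < real p \<and> real p \<le> 2 ^ Suc L * u} = A \<union> B"
    using t by (auto simp: A_def B_def t_def)
  moreover have "A \<inter> B = {}" by (auto simp: A_def B_def t_def)
  ultimately have "(\<Sum>p | prime p \<and> u < real p \<and> real p \<le> 2 ^ Suc L * u. 1 / real p) = (\<Sum>p\<in>A. 1 / real p) + (\<Sum>p\<in>B. 1 / real p)"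
    using fin by (simp add: sum.union_disjoint)
  also have "(\<Sum>p\<in>B. 1 / real p) \<le> (\<Sum>p\<in>B. ln (real p) / (t * ln u))"
  proof (rule sum_mono)
    fix p assume p: "p \<in> B"
    then have pt: "real p > t" by (simp add: B_def)
    have "t * ln u \<le> real p * ln (real p)" using pt t u by (intro mult_mono) auto
    then show "1 / real p \<le> ln (real p) / (t * ln u)"
      using pt t lnu by (simp add: field_simps)
  qed
  also have "\<dots> = (\<Sum>p\<in>B. ln (real p)) / (t * ln u)" by (simp add: sum_divide_distrib)
  also have "\<dots> \<le> (8 * t) / (t * ln u)"
  proof (rule divide_right_mono)
    have "(\<Sum>p\<in>B. ln (real p)) \<le> psi (nat \<lfloor>2 * t\<rfloor>)" unfolding B_def by (rule sum_ln_primes_le_psi)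
    also have "\<dots> \<le> 4 * real (nat \<lfloor>2 * t\<rfloor>)" by (rule psi_le)
    also have "\<dots> \<le> 8 * t" using t by linarith
    finally show "(\<Sum>p\<in>B. ln (real p)) \<le> 8 * t" .
  qed (use t lnu in auto)
  also have "\<dots> = 8 / ln u" using t by simp
  finally show ?case using Suc.IH by (simp add: A_def algebra_simps add_divide_distrib)
qed

text \<open>Used with u = Y and v = w z, a power of ln n up to a constant: the primes between Y and
  n then have a reciprocal sum of order ln ln n / ln n.\<close>

lemma sum_prime_recip_le:
  assumes u: "u \<ge> 2" and v: "v \<ge> 1"
  shows "(\<Sum>p | prime p \<and> u < real p \<and> real p \<le> v * u. 1 / real p) \<le> (log 2 v + 1) * (8 / ln u)"
proof -
  define L where "L = nat \<lceil>log 2 v\<rceil>"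
  have l0: "log 2 v \<ge> 0" using v by simp
  have L: "log 2 v \<le> real L" "real L \<le> log 2 v + 1" using l0 unfolding L_def by linarith+
  have "v = 2 powr log 2 v" using v by simp
  also have "\<dots> \<le> 2 powr real L" using L by (intro powr_mono) auto
  finally have "v \<le> 2 ^ L" by (simp add: powr_realpow)
  then have vL: "v * u \<le> 2 ^ L * u" using u by (intro mult_right_mono) auto
  have "(\<Sum>p | prime p \<and> u < real p \<and> real p \<le> v * u. 1 / real p) \<le> (\<Sum>p | prime p \<and> u < real p \<and> real p \<le> 2 ^ L * u. 1 / real p)"
    using finite_nat_le_real[of "\<lambda>p. prime p \<and> u < real p" "2 ^ L * u"] vL by (intro sum_mono2) (auto simp: conj_assoc)
  also have "\<dots> \<le> real L * (8 / ln u)" by (rule sum_prime_recip_dyadic_le[OF u])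
  also have "\<dots> \<le> (log 2 v + 1) * (8 / ln u)" using L u by (intro mult_right_mono) auto
  finally show ?thesis .
qed

subsection \<open>Lower bound\<close>

text \<open>Stated for any index set, because the induction for the lower bound removes an arbitrary
  index.\<close>

definition complement_on :: "'i set \<Rightarrow> ('i \<Rightarrow> nat set) \<Rightarrow> bool" where
  "complement_on I A \<longleftrightarrow> (\<forall>i\<in>I. A i \<subseteq> {0<..}) \<and> (\<forall>n>0. \<exists>a. (\<forall>i\<in>I. a i \<in> A i) \<and> n = (\<Prod>i\<in>I. a i))"

lemma mult_complement_iff: "mult_complement h A \<longleftrightarrow> complement_on {1..h} A"
  by (simp add: mult_complement_def complement_on_def)

lemma prime_count_tendsto_scaled:
  assumes M: "M > 0"
  shows "((\<lambda>x. real (prime_count (x / M)) / (x / ln x)) \<longlongrightarrow> 1 / M) at_top"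
proof -
  have "filterlim (\<lambda>x. x / M) at_top at_top"
    using M by real_asymp
  from filterlim_compose[OF prime_number_theorem this]
  have 1: "((\<lambda>x. real (prime_count (x / M)) / (x / M / ln (x / M))) \<longlongrightarrow> 1) at_top" .
  have 2: "((\<lambda>x. (x / M / ln (x / M)) / (x / ln x)) \<longlongrightarrow> 1 / M) at_top"
    using M by real_asymp (simp add: inverse_eq_divide)
  have "\<forall>\<^sub>F x in at_top. x / M / ln (x / M) \<noteq> 0"
    using eventually_gt_at_top[of "max 0 M"]
  proof eventually_elim
    case (elim x)
    then have "x / M > 1" using M by simp
    then show ?case using elim M by simp
  qed
  then have "\<forall>\<^sub>F x in at_top. real (prime_count (x / M)) / (x / M / ln (x / M)) * ((x / M / ln (x / M)) / (x / ln x)) = real (prime_count (x / M)) / (x / ln x)"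
    by eventually_elim simp
  from Lim_transform_eventually[OF tendsto_mult[OF 1 2] this] show ?thesis by simp
qed

text \<open>In a representation of p * m j, some factor is divisible by p; were it p itself in
  component j, the other factors would represent m j. This factor determines p, the only prime above
  M that divides it, so different p give different elements.\<close>

lemma sum_counting_ge:
  assumes I: "finite I" and A: "complement_on I A"
    and m: "\<And>j. j \<in> I \<Longrightarrow> 0 < m j \<and> m j \<le> M \<and> \<not> (\<exists>a. (\<forall>i\<in>I - {j}. a i \<in> A i) \<and> m j = (\<Prod>i\<in>I - {j}. a i))"
    and x: "x \<ge> 0" and M: "M > 0"
  shows "real (prime_count x) + real (prime_count (x / real M)) - real M \<le> real (\<Sum>i\<in>I. counting (A i) x)"
proof -
  \<comment> \<open>Pairs are counted, so a number lying in several components counts once for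
    each.\<close>
  define T where "T = Sigma I (\<lambda>i. {a \<in> A i. real a \<le> x})"
  define P1 where "P1 = {p::nat. prime p \<and> real p \<le> x}"
  define P2 where "P2 = {p::nat. (prime p \<and> M < p) \<and> real p \<le> x / real M}"
  have fin: "finite P1" "finite P2" unfolding P1_def P2_def by (rule finite_nat_le_real)+
  have finT: "finite T" unfolding T_def
    using I finite_nat_le_real[of "\<lambda>a. a \<in> A _"] by (intro finite_SigmaI) auto
  have cardT: "card T = (\<Sum>i\<in>I. counting (A i) x)"
    unfolding T_def counting_def using I finite_nat_le_real[of "\<lambda>a. a \<in> A _"] by (intro card_SigmaI) auto
  have "\<exists>j. j \<in> I \<and> p \<in> A j" if pp: "prime p" for p :: nat
  proof -
    obtain a where a: "\<forall>i\<in>I. a i \<in> A i" "p = (\<Prod>i\<in>I. a i)"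
      using A prime_gt_0_nat[OF pp] unfolding complement_on_def by metis
    then obtain i where i: "i \<in> I" "p dvd a i"
      using prime_dvd_prod_iff[OF I pp, of a] by auto
    have "a i dvd p" using a(2) I i(1) by (simp add: dvd_prodI)
    then have "a i = p" using i(2) by (simp add: dvd_antisym)
    then show ?thesis using a(1) i(1) by auto
  qed
  then obtain j where j: "\<And>p. prime p \<Longrightarrow> j p \<in> I \<and> p \<in> A (j p)" by metis
  have "\<exists>e. e \<in> T \<and> e \<noteq> (j p, p) \<and> p dvd snd e \<and> snd e dvd p * m (j p)" if p: "p \<in> P2" for p
  proof -
    have pp: "prime p" "M < p" and px: "real p * real M \<le> x" using p M by (auto simp: P2_def field_simps)
    note mj = m[of "j p"] j[OF pp(1)]
    have "p * m (j p) > 0" using mj prime_gt_0_nat[OF pp(1)] by simp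
    then obtain a where a: "\<forall>i\<in>I. a i \<in> A i" "p * m (j p) = (\<Prod>i\<in>I. a i)"
      using A unfolding complement_on_def by metis
    have "p dvd (\<Prod>i\<in>I. a i)" using a(2) by (metis dvd_triv_left)
    then obtain i where i: "i \<in> I" "p dvd a i"
      using prime_dvd_prod_iff[OF I pp(1), of a] by auto
    have dvd: "a i dvd p * m (j p)" using a(2) I i(1) by (simp add: dvd_prodI)
    then have "a i \<le> p * m (j p)" using \<open>p * m (j p) > 0\<close> by (rule dvd_imp_le)
    also have "\<dots> \<le> p * M" using mj by simp
    finally have "real (a i) \<le> real p * real M" by (simp flip: of_nat_mult)
    then have "(i, a i) \<in> T" using a(1) i(1) px by (simp add: T_def)
    moreover have "(i, a i) \<noteq> (j p, p)"
    proof
      assume "(i, a i) = (j p, p)"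
      then have eq: "i = j p" "a (j p) = p" by auto
      have "p * m (j p) = p * (\<Prod>i\<in>I - {j p}. a i)"
        using a(2) I eq i(1) by (simp add: prod.remove)
      then have "m (j p) = (\<Prod>i\<in>I - {j p}. a i)" using prime_gt_0_nat[OF pp(1)] by simp
      then show False using mj a(1) by blast
    qed
    ultimately show ?thesis using i(2) dvd by (intro exI[of _ "(i, a i)"]) auto
  qed
  then obtain e where e: "\<And>p. p \<in> P2 \<Longrightarrow> e p \<in> T \<and> e p \<noteq> (j p, p) \<and> p dvd snd (e p) \<and> snd (e p) dvd p * m (j p)" by metis
  have inj2: "inj_on e P2"
  proof (rule inj_onI)
    fix p q assume pq: "p \<in> P2" "q \<in> P2" "e p = e q"
    have pp: "prime p" "prime q" "M < q" using pq by (auto simp: P2_def)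
    have "q dvd snd (e p)" using e[OF pq(2)] pq(3) by simp
    also have "\<dots> dvd p * m (j p)" using e[OF pq(1)] by simp
    finally have "q dvd p \<or> q dvd m (j p)" using pp by (simp add: prime_dvd_mult_iff)
    moreover have "\<not> q dvd m (j p)"
      using dvd_imp_le[of q "m (j p)"] m[of "j p"] j[OF pp(1)] pp(3) by auto
    ultimately show "p = q" using pp primes_dvd_imp_eq by blast
  qed
  have inj1: "inj_on (\<lambda>p. (j p, p)) P1" by (auto intro: inj_onI)
  have disj: "(\<lambda>p. (j p, p)) ` P1 \<inter> e ` P2 = {}"
  proof (rule ccontr)
    assume "\<not> ?thesis"
    then obtain t where "t \<in> (\<lambda>p. (j p, p)) ` P1" "t \<in> e ` P2" by blast
    then obtain q p where qp: "q \<in> P1" "p \<in> P2" "e p = (j q, q)" by fastforce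
    have "p dvd q" using e[OF qp(2)] qp(3) by auto
    then have "p = q" using qp(1,2) primes_dvd_imp_eq[of p q] by (auto simp: P1_def P2_def)
    then show False using e[OF qp(2)] qp(3) by simp
  qed
  have "card P1 + card P2 = card ((\<lambda>p. (j p, p)) ` P1 \<union> e ` P2)"
    using fin disj card_image[OF inj1] card_image[OF inj2] by (simp add: card_Un_disjoint)
  also have "\<dots> \<le> card T"
  proof (rule card_mono[OF finT])
    have "(\<lambda>p. (j p, p)) ` P1 \<subseteq> T" using j by (auto simp: T_def P1_def)
    moreover have "e ` P2 \<subseteq> T" using e by blast
    ultimately show "(\<lambda>p. (j p, p)) ` P1 \<union> e ` P2 \<subseteq> T" by simp
  qed
  finally have le: "card P1 + card P2 \<le> card T" .
  \<comment> \<open>The loss of M accounts for the primes up to M, which \<open>P2\<close> leaves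
    out.\<close>
  have "prime_count (x / real M) \<le> card (P2 \<union> {1..M})"
    unfolding prime_count_def using fin by (intro card_mono) (auto simp: P2_def Suc_le_eq prime_gt_0_nat)
  also have "\<dots> \<le> card P2 + M" using card_Un_le[of P2 "{1..M}"] by simp
  finally have "prime_count (x / real M) \<le> card P2 + M" .
  moreover have "prime_count x = card P1" by (simp add: prime_count_def P1_def)
  ultimately show ?thesis using le unfolding cardT by linarith
qed

text \<open>The index i may vary with x, as for a maximum; the fixed \<delta> is what makes the
  inequality for the lower limit strict.\<close>

theorem complement_on_counting_lower:
  assumes "finite I" "complement_on I A" "I \<noteq> {}"
  shows "\<exists>\<delta>>0. \<forall>\<^sub>F x in at_top. \<exists>i\<in>I. real (counting (A i) x) / (x / ln x) \<ge> 1 / real (card I) + \<delta>"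
  using assms
proof (induction I rule: finite_psubset_induct)
  case (psubset I)
  have c: "card I > 0" using psubset by (simp add: card_gt_0_iff)
  show ?case
  proof (cases "\<exists>j\<in>I. complement_on (I - {j}) A")
    case True
    then obtain j where j: "j \<in> I" "complement_on (I - {j}) A" by blast
    \<comment> \<open>The empty product represents only 1, so the induction never reaches the empty
      index set.\<close>
    have ne: "I - {j} \<noteq> {}"
    proof
      assume e: "I - {j} = {}"
      have "\<forall>n>0. n = (1::nat)" using j(2) unfolding complement_on_def e by simp
      then have "(2::nat) = 1" by (meson zero_less_numeral)
      then show False by simp
    qed
    obtain \<delta> where \<delta>: "\<delta> > 0" "\<forall>\<^sub>F x in at_top. \<exists>i\<in>I - {j}. real (counting (A i) x) / (x / ln x) \<ge> 1 / real (card (I - {j})) + \<delta>"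
      using psubset.IH[of "I - {j}"] j ne by blast
    have "card (I - {j}) > 0" using ne psubset.hyps by (simp add: card_gt_0_iff)
    moreover have "card (I - {j}) \<le> card I" using psubset.hyps by (intro card_mono) auto
    ultimately have le: "1 / real (card I) \<le> 1 / real (card (I - {j}))" by (simp add: frac_le)
    from \<delta>(2) have "\<forall>\<^sub>F x in at_top. \<exists>i\<in>I. real (counting (A i) x) / (x / ln x) \<ge> 1 / real (card I) + \<delta>"
    proof eventually_elim
      case (elim x)
      then obtain i where "i \<in> I - {j}" "real (counting (A i) x) / (x / ln x) \<ge> 1 / real (card (I - {j})) + \<delta>" by blast
      then show ?case using le by (intro bexI[of _ i]) auto
    qed
    with \<delta>(1) show ?thesis by blast
  next
    case False
    have "\<exists>m>0. \<not> (\<exists>a. (\<forall>i\<in>I - {j}. a i \<in> A i) \<and> m = (\<Prod>i\<in>I - {j}. a i))" if "j \<in> I" for j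
    proof -
      have n2: "\<forall>i\<in>I - {j}. A i \<subseteq> {0<..}" using psubset.prems(1) by (simp add: complement_on_def)
      have "\<not> complement_on (I - {j}) A" using False that by simp
      then have "\<not> (\<forall>n>0. \<exists>a. (\<forall>i\<in>I - {j}. a i \<in> A i) \<and> n = (\<Prod>i\<in>I - {j}. a i))"
        using n2 unfolding complement_on_def by argo
      then show ?thesis by (simp only: not_all not_imp)
    qed
    then obtain m where m: "\<And>j. j \<in> I \<Longrightarrow> 0 < m j \<and> \<not> (\<exists>a. (\<forall>i\<in>I - {j}. a i \<in> A i) \<and> m j = (\<Prod>i\<in>I - {j}. a i))"
      by metis
    define M where "M = Suc (\<Sum>j\<in>I. m j)"
    have mM: "m j \<le> M" if "j \<in> I" for j
      using member_le_sum[of j I m] that psubset.hyps by (simp add: M_def)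
    have M: "M > 0" by (simp add: M_def)
    define f where "f x = real (prime_count x) / (x / ln x) + real (prime_count (x / real M)) / (x / ln x) - real M / (x / ln x)" for x
    have "((\<lambda>x. real M / (x / ln x)) \<longlongrightarrow> 0) at_top" by real_asymp
    then have "(f \<longlongrightarrow> 1 + 1 / real M - 0) at_top"
      unfolding f_def using M by (intro tendsto_intros prime_number_theorem prime_count_tendsto_scaled) auto
    \<comment> \<open>Half of the gain 1/M is given up to leave the limit; the rest, shared among
      the components, is \<delta>.\<close>
    then have "\<forall>\<^sub>F x in at_top. f x > 1 + 1 / (2 * real M)"
      by (rule order_tendstoD) (use M in \<open>simp add: field_simps\<close>)
    then have "\<forall>\<^sub>F x in at_top. \<exists>i\<in>I. real (counting (A i) x) / (x / ln x) \<ge> 1 / real (card I) + 1 / (2 * real M * real (card I))"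
      using eventually_gt_at_top[of 1]
    proof eventually_elim
      case (elim x)
      then have x: "x / ln x > 0" by simp
      show ?case
      proof (rule ccontr)
        assume "\<not> ?thesis"
        then have "real (counting (A i) x) / (x / ln x) \<le> 1 / real (card I) + 1 / (2 * real M * real (card I))" if "i \<in> I" for i
          using that by (meson not_le less_imp_le)
        then have "(\<Sum>i\<in>I. real (counting (A i) x) / (x / ln x)) \<le> (\<Sum>i\<in>I. 1 / real (card I) + 1 / (2 * real M * real (card I)))"
          by (intro sum_mono)
        also have "\<dots> = 1 + 1 / (2 * real M)" using c M by (simp add: field_simps)
        finally have "(\<Sum>i\<in>I. real (counting (A i) x) / (x / ln x)) < f x" using elim by simp
        moreover have "f x \<le> (\<Sum>i\<in>I. real (counting (A i) x) / (x / ln x))"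
        proof -
          have "f x = (real (prime_count x) + real (prime_count (x / real M)) - real M) / (x / ln x)"
            unfolding f_def by (simp only: add_divide_distrib diff_divide_distrib)
          also have "\<dots> \<le> real (\<Sum>i\<in>I. counting (A i) x) / (x / ln x)"
            using m mM x elim M psubset.hyps psubset.prems(1)
            by (intro divide_right_mono sum_counting_ge[where m = m]) auto
          finally show ?thesis by (simp only: of_nat_sum sum_divide_distrib)
        qed
        ultimately show False by simp
      qed
    qed
    then show ?thesis using M c by (intro exI[of _ "1 / (2 * real M * real (card I))"]) auto
  qed
qed

lemma max_counting_liminf_gt:
  assumes h: "h \<ge> 1" and A: "mult_complement h A"
  shows "max_counting_liminf h A > ereal (1 / real h)"
proof -
  obtain \<delta> where \<delta>: "\<delta> > 0" "\<forall>\<^sub>F x in at_top. \<exists>i\<in>{1..h}. real (counting (A i) x) / (x / ln x) \<ge> 1 / real h + \<delta>"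
    using complement_on_counting_lower[of "{1..h}" A] A h by (auto simp: mult_complement_iff)
  have "\<forall>\<^sub>F x in at_top. ereal (1 / real h + \<delta>) \<le> ereal (real (MAX i\<in>{1..h}. counting (A i) x) / (x / ln x))"
    using \<delta>(2) eventually_gt_at_top[of 1]
  proof eventually_elim
    case (elim x)
    then obtain i where i: "i \<in> {1..h}" "real (counting (A i) x) / (x / ln x) \<ge> 1 / real h + \<delta>" by blast
    have "counting (A i) x \<le> (MAX i\<in>{1..h}. counting (A i) x)" using i by (intro Max_ge) auto
    then have "real (counting (A i) x) / (x / ln x) \<le> real (MAX i\<in>{1..h}. counting (A i) x) / (x / ln x)"
      using elim by (intro divide_right_mono) auto
    then show ?case using i(2) by simp
  qed
  then have "ereal (1 / real h + \<delta>) \<le> max_counting_liminf h A"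
    unfolding max_counting_liminf_def by (rule Liminf_bounded)
  moreover have "ereal (1 / real h) < ereal (1 / real h + \<delta>)" using \<delta>(1) by simp
  ultimately show ?thesis by (rule less_le_trans[rotated])
qed

subsection \<open>Upper bound\<close>

text \<open>The elements are dealt out in turn, by their number modulo
  \<open>card I\<close>.\<close>

lemma balanced_partition:
  assumes S: "finite S" and I: "finite I" "I \<noteq> {}"
  obtains c where "\<And>s. s \<in> S \<Longrightarrow> c s \<in> I" "\<And>i. i \<in> I \<Longrightarrow> real (card {s \<in> S. c s = i}) \<le> real (card S) / real (card I) + 1"
proof -
  define N h where "N = card S" and "h = card I"
  have h: "h > 0" using I by (simp add: h_def card_gt_0_iff)
  obtain f where f: "bij_betw f S {0..<N}" using ex_bij_betw_finite_nat[OF S] by (auto simp: N_def)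
  obtain g where g: "bij_betw g {0..<h} I" using ex_bij_betw_nat_finite[OF I(1)] by (auto simp: h_def)
  define c where "c s = g (f s mod h)" for s
  have "c s \<in> I" for s using bij_betwE[OF g] h by (simp add: c_def)
  moreover have "real (card {s \<in> S. c s = i}) \<le> real N / real h + 1" if i: "i \<in> I" for i
  proof -
    obtain r where r: "r < h" "g r = i" using g i by (auto simp: bij_betw_def)
    have eq: "f s mod h = r" if "c s = i" for s
      using bij_betw_imp_inj_on[OF g] that r h unfolding c_def by (auto dest!: inj_onD)
    have "card {s \<in> S. c s = i} \<le> card {0..N div h}"
    proof (rule card_inj_on_le[of "\<lambda>s. f s div h"])
      show "inj_on (\<lambda>s. f s div h) {s \<in> S. c s = i}"
      proof (rule inj_onI)
        fix s t assume st: "s \<in> {s \<in> S. c s = i}" "t \<in> {s \<in> S. c s = i}" "f s div h = f t div h"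
        then have "f s mod h = f t mod h" using eq by simp
        then have "f s = f t" using st(3) by (metis div_mult_mod_eq)
        then show "s = t" using bij_betw_imp_inj_on[OF f] st by (auto dest: inj_onD)
      qed
      show "(\<lambda>s. f s div h) ` {s \<in> S. c s = i} \<subseteq> {0..N div h}"
      proof clarsimp
        fix s assume "s \<in> S"
        then have "f s < N" using bij_betwE[OF f] by auto
        then show "f s div h \<le> N div h" by (intro div_le_mono) simp
      qed
    qed simp
    then have "real (card {s \<in> S. c s = i}) \<le> real (N div h) + 1" by simp
    also have "real (N div h) \<le> real N / real h" by (rule of_nat_div_le_of_nat)
    finally show ?thesis by simp
  qed
  ultimately show thesis unfolding N_def h_def by (rule that)
qed

text \<open>Let m be the largest divisor below z. For a prime q dividing n/m, the divisor q m is at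
  least z by maximality, hence above Y, so q > Y/z. Two such primes would have a product above n, so
  n/m is a single prime, and as a divisor \<ge> z it exceeds Y.\<close>

lemma divisor_or_prime_cofactor:
  fixes z Y :: real
  assumes z: "z > 1" and Y: "Y / z \<ge> z" "(Y / z)\<^sup>2 \<ge> real n" and n: "real n \<ge> z"
    and no: "\<And>d. d dvd n \<Longrightarrow> z \<le> real d \<Longrightarrow> real d > Y"
  obtains p m where "prime p" "n = p * m" "real p > Y" "real m < z"
proof -
  have n0: "n > 0" using n z by (intro Nat.gr0I) auto
  define D where "D = {d. d dvd n \<and> real d < z}"
  have D: "finite D" "1 \<in> D" using n0 z by (auto simp: D_def)
  define m where "m = Max D"
  have "m \<in> D" unfolding m_def using D by (intro Max_in) auto
  then have m: "m dvd n" "real m < z" by (auto simp: D_def)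
  have mmax: "d \<le> m" if "d dvd n" "real d < z" for d
    unfolding m_def using D that by (intro Max_ge) (auto simp: D_def)
  have m0: "m > 0" using m(1) n0 by (auto intro!: Nat.gr0I)
  obtain r where r: "n = m * r" using m(1) by (auto simp: dvd_def)
  have r1: "r \<noteq> 1" using r m(2) n by (intro notI) simp
  have r0: "r > 0" using r n0 by (auto intro!: Nat.gr0I)
  have big: "real q > Y / z" if q: "prime q" "q dvd r" for q
  proof -
    have dvd: "q * m dvd n" using q(2) unfolding r by (simp add: mult.commute)
    have "q * m > 1 * m" using prime_gt_1_nat[OF q(1)] m0 by (intro mult_strict_right_mono) auto
    then have "\<not> real (q * m) < z" using mmax[OF dvd] by auto
    then have "Y < real (q * m)" using no[OF dvd] by simp
    also have "\<dots> = real q * real m" by simp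
    also have "\<dots> \<le> real q * z" using m(2) by (intro mult_left_mono) auto
    finally show ?thesis using z by (simp add: field_simps)
  qed
  obtain q where q: "prime q" "q dvd r" using prime_factor_nat[OF r1] by blast
  obtain t where t: "r = q * t" using q(2) by (auto simp: dvd_def)
  have "t = 1"
  proof (rule ccontr)
    assume "t \<noteq> 1"
    then obtain q' where q': "prime q'" "q' dvd t" using prime_factor_nat by blast
    have Yz: "Y / z > 0" using Y(1) z by linarith
    have "real n \<le> (Y / z) * (Y / z)" using Y(2) by (simp add: power2_eq_square)
    also have "\<dots> < real q * real q'"
      using big[OF q] big[OF q'(1)] q'(2) Yz by (intro mult_strict_mono) (auto simp: t)
    also have "\<dots> \<le> real n"
    proof -
      have "q * q' dvd n" using q'(2) unfolding r t by (intro dvd_mult mult_dvd_mono) auto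
      then have "q * q' \<le> n" using n0 by (rule dvd_imp_le)
      then show ?thesis by (simp flip: of_nat_mult)
    qed
    finally show False by simp
  qed
  then have nq: "n = q * m" using r t by simp
  have "real q \<ge> z" using big[OF q] Y(1) by linarith
  then have "real q > Y" using no[of q] nq by simp
  then show thesis using that q(1) nq m(2) by blast
qed

lemma sum_recip_le: "n \<ge> 1 \<Longrightarrow> (\<Sum>a=1..n. 1 / real a) \<le> 1 + ln (real n)"
proof (induction n rule: dec_induct)
  case (step n)
  have n: "real n > 0" using step by simp
  have "ln (real n / (real n + 1)) \<le> real n / (real n + 1) - 1"
    using n by (intro ln_le_minus_one) auto
  also have "\<dots> = - (1 / (real n + 1))" using n by (simp add: field_simps)
  finally have "1 / (real n + 1) \<le> ln (real n + 1) - ln (real n)" using n by (simp add: ln_div)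
  then show ?case using step.IH by (simp add: add.commute)
qed simp

text \<open>In a stage \<open>(w, B, T)\<close>, every \<open>m \<le> w\<close> and every \<open>j\<close> have a representation whose factor \<open>a j\<close> leaves a cofactor of
  size at least \<open>T (a j)\<close>. This bounds \<open>p * a j\<close> by \<open>p * m / T (a j)\<close> when a later stage multiplies \<open>a j\<close> by a
  prime \<open>p\<close>, and \<open>stage_cost\<close> is the resulting proportion of new elements; the factor \<open>1\<close> costs nothing.\<close>

definition staged :: "'i set \<Rightarrow> nat \<Rightarrow> ('i \<Rightarrow> nat set) \<Rightarrow> (nat \<Rightarrow> real) \<Rightarrow> bool" where
  "staged I w B T \<longleftrightarrow> w \<ge> 1 \<and> (\<forall>i\<in>I. B i \<subseteq> {1..w} \<and> 1 \<in> B i) \<and> (\<forall>a. T a \<ge> 1) \<and> T 1 = 1 \<and>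
     (\<forall>m\<in>{1..w}. \<forall>j\<in>I. \<exists>a. (\<forall>i\<in>I. a i \<in> B i) \<and> m = (\<Prod>i\<in>I. a i) \<and> real (a j) * T (a j) \<le> real m)"

definition stage_cost :: "nat \<Rightarrow> (nat \<Rightarrow> real) \<Rightarrow> real" where
  "stage_cost w T = (\<Sum>a=2..w. 1 / (real a * T a))"

text \<open>A superset of the multiples that \<open>next_stage\<close> adds. Including a = 1 gives
  the primes above Y weight 1 as well, needed when such a prime stands at the index j with a small
  cofactor.\<close>

definition lifted_primes :: "nat \<Rightarrow> real \<Rightarrow> nat \<Rightarrow> nat set" where
  "lifted_primes w Y n = {p * a | p a. prime p \<and> Y < real p \<and> real p \<le> real n \<and> a \<in> {1..w}}"

text \<open>The multiples \<open>p * a\<close> of large primes get the trivial weight \<open>1\<close>: the sum of their reciprocals is negligible.\<close>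

definition next_weight :: "nat \<Rightarrow> (nat \<Rightarrow> real) \<Rightarrow> real \<Rightarrow> real \<Rightarrow> nat \<Rightarrow> nat \<Rightarrow> real" where
  "next_weight w T z Y n a = (if a \<le> w then T a else if a \<in> lifted_primes w Y n then 1 else z)"

text \<open>The multiples p * a go to every component, with a not restricted to \<open>B i\<close>
  and p not to the primes of i; the bound by \<open>stage_cost\<close> allows for this
  excess.\<close>

definition next_stage :: "nat \<Rightarrow> ('i \<Rightarrow> nat set) \<Rightarrow> (nat \<Rightarrow> real) \<Rightarrow> real \<Rightarrow> real \<Rightarrow> nat \<Rightarrow> (nat \<Rightarrow> 'i) \<Rightarrow> 'i \<Rightarrow> nat set" where
  "next_stage w B T y Y n c i = B i \<union> {m. w < m \<and> real m \<le> y}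
     \<union> {p \<in> {p. (prime p \<and> y < real p) \<and> real p \<le> real n}. c p = i}
     \<union> {p * a | p a. prime p \<and> Y < real p \<and> a \<in> {2..w} \<and> real p * (real a * T a) \<le> real n}"

lemma prod_fun_upd_const:
  assumes "finite I" "i \<in> I"
  shows "(\<Prod>k\<in>I. ((\<lambda>_. 1)(i := n)) k) = (n :: nat)"
  using assms by (simp add: fun_upd_def del: One_nat_def)

lemma prod_fun_upd2_const:
  assumes "finite I" "i \<in> I" "j \<in> I" "i \<noteq> j"
  shows "(\<Prod>k\<in>I. ((\<lambda>_. 1)(i := m, j := n)) k) = (m * n :: nat)"
proof -
  have "(\<Prod>k\<in>I. ((\<lambda>_. 1)(i := m, j := n)) k) = n * (\<Prod>k\<in>I - {j}. ((\<lambda>_. 1)(i := m, j := n)) k)"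
    using assms by (simp add: prod.remove[of I j])
  also have "(\<Prod>k\<in>I - {j}. ((\<lambda>_. 1)(i := m, j := n)) k) = (\<Prod>k\<in>I - {j}. ((\<lambda>_. 1)(i := m)) k)"
    by (intro prod.cong) auto
  also have "\<dots> = m" using assms by (intro prod_fun_upd_const) auto
  finally show ?thesis by (simp only: mult.commute)
qed

text \<open>The value Y = y/w is what the divisor case needs: if y < m \<le> n and m = d e with z
  \<le> d \<le> Y, then w < e \<le> n/z = y and w < d \<le> y, so both factors are new integers
  contained in every component. Otherwise m is a prime p > Y times some b < z, and p dominates every
  weight that has to be paid for.\<close>

lemma staged_next_stage:
  fixes y z Y :: real
  assumes I: "finite I" "card I \<ge> 2" and st: "staged I w B T"
    and z: "z > 1" "z > real w" and yz: "y = real n / z" and Yw: "Y = y / real w"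
    and Y: "Y / z \<ge> z" "(Y / z)\<^sup>2 \<ge> real n" "Y \<ge> real w" and TY: "\<And>a. a \<in> {1..w} \<Longrightarrow> T a \<le> Y"
    and c: "\<And>p. prime p \<Longrightarrow> y < real p \<Longrightarrow> real p \<le> real n \<Longrightarrow> c p \<in> I"
  shows "staged I n (next_stage w B T y Y n c) (next_weight w T z Y n)"
    and "i \<in> I \<Longrightarrow> next_stage w B T y Y n c i \<inter> {1..w} = B i"
    and "w < n"
proof -
  define B' where "B' = next_stage w B T y Y n c"
  define T' where "T' = next_weight w T z Y n"
  have w: "w \<ge> 1" and B: "\<And>i. i \<in> I \<Longrightarrow> B i \<subseteq> {1..w}" "\<And>i. i \<in> I \<Longrightarrow> 1 \<in> B i"
    and T: "\<And>a. T a \<ge> 1" "T 1 = 1"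
    and rep: "\<And>m j. m \<in> {1..w} \<Longrightarrow> j \<in> I \<Longrightarrow> \<exists>a. (\<forall>i\<in>I. a i \<in> B i) \<and> m = (\<Prod>i\<in>I. a i) \<and> real (a j) * T (a j) \<le> real m"
    using st unfolding staged_def by auto
  \<comment> \<open>With two indices available, a single nontrivial factor can be put away from j,
    leaving 1 there, with weight 1.\<close>
  have other: "\<exists>i\<in>I. i \<noteq> j" if "j \<in> I" for j
  proof (rule ccontr)
    assume "\<not> ?thesis"
    then have "I \<subseteq> {j}" by auto
    then have "card I \<le> 1" using card_mono[of "{j}" I] by simp
    then show False using I(2) by simp
  qed
  have Yz: "Y \<ge> z * z" using Y(1) z by (simp add: field_simps)
  have zz: "z * z \<ge> z" using z by simp
  then have zY: "z \<le> Y" using Yz by linarith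
  have Y0: "Y > 0" using zY z by linarith
  have yY: "y = Y * real w" using Yw w by simp
  have Yy: "Y \<le> y"
  proof -
    have "Y * 1 \<le> Y * real w" using w Y0 by (intro mult_left_mono) auto
    then show ?thesis using yY by simp
  qed
  have ny: "real n = y * z" using yz z by simp
  have yn: "y \<le> real n"
  proof -
    have "y * 1 \<le> y * z" using z Y0 Yy by (intro mult_left_mono) auto
    then show ?thesis using ny by simp
  qed
  have wy: "real w < y" using z(2) zY Yy by linarith
  have wn: "w < n" using wy yn by linarith
  have T'w: "T' a = T a" if "a \<le> w" for a using that by (simp add: T'_def next_weight_def)
  have T'z: "T' a \<le> z" if "a > w" for a using that z by (simp add: T'_def next_weight_def)
  have T'R: "T' (p * a) = 1" if "prime p" "Y < real p" "real p \<le> real n" "a \<in> {1..w}" "p * a > w" for p a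
  proof -
    have "p * a \<in> lifted_primes w Y n" using that unfolding lifted_primes_def by blast
    then show ?thesis using that by (simp add: T'_def next_weight_def)
  qed
  have B'B: "a \<in> B' i" if "a \<in> B i" for a i using that by (simp add: B'_def next_stage_def)
  have B'mid: "m \<in> B' i" if "w < m" "real m \<le> y" for m i using that by (simp add: B'_def next_stage_def)
  have B'1: "1 \<in> B' i" if "i \<in> I" for i using B(2)[OF that] by (rule B'B)
  have B'p: "p \<in> B' (c p)" if "prime p" "y < real p" "real p \<le> real n" for p
    using that by (simp add: B'_def next_stage_def)
  have B'C: "p * a \<in> B' i" if "prime p" "Y < real p" "a \<in> {2..w}" "real p * (real a * T a) \<le> real n" for p a i
    using that unfolding B'_def next_stage_def by blast
  have sub: "B' i \<subseteq> {1..n} \<and> B' i \<inter> {1..w} = B i" if i: "i \<in> I" for i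
  proof -
    have cB: "a \<in> {1..n} \<and> (a \<le> w \<longrightarrow> a \<in> B i)" if a: "a \<in> B' i" for a
    proof -
      consider "a \<in> B i" | "w < a" "real a \<le> y" | "prime a" "y < real a" "real a \<le> real n"
        | p b where "a = p * b" "prime p" "Y < real p" "b \<in> {2..w}" "real p * (real b * T b) \<le> real n"
        using a unfolding B'_def next_stage_def by blast
      then show ?thesis
      proof cases
        case 1
        then show ?thesis using B(1)[OF i] wn by force
      next
        case 2
        then have "real a \<le> real n" using yn by linarith
        then show ?thesis using 2 by auto
      next
        case 3
        then have "real w < real a" using wy by linarith
        then show ?thesis using 3 by auto
      next
        case 4
        have "real b * 1 \<le> real b * T b" using T(1) by (intro mult_left_mono) auto
        then have "real p * real b \<le> real p * (real b * T b)" by (intro mult_left_mono) auto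
        then have le: "p * b \<le> n" using 4 by (simp flip: of_nat_mult)
        have wp: "w < p" using 4 Y(3) by linarith
        moreover have "p * 1 \<le> p * b" using 4 by (intro mult_left_mono) auto
        ultimately have "w < p * b" by linarith
        then show ?thesis using le 4(1,4) wp by simp
      qed
    qed
    then have "B' i \<subseteq> {1..n}" "B' i \<inter> {1..w} \<subseteq> B i" by auto
    moreover have "B i \<subseteq> B' i \<inter> {1..w}" using B(1)[OF i] B'B by blast
    ultimately show ?thesis by blast
  qed
  have T'1: "T' 1 = 1" using T'w[of 1] w T(2) by simp
  have "\<exists>a. (\<forall>i\<in>I. a i \<in> B' i) \<and> m = (\<Prod>i\<in>I. a i) \<and> real (a j) * T' (a j) \<le> real m"
    if m: "m \<in> {1..n}" and j: "j \<in> I" for m j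
  proof -
    consider "m \<le> w" | "w < m" "real m \<le> y" | "real m > y" by linarith
    then show ?thesis
    proof cases
      case 1
      then obtain a where a: "\<forall>i\<in>I. a i \<in> B i" "m = (\<Prod>i\<in>I. a i)" "real (a j) * T (a j) \<le> real m"
        using rep[of m j] m j by auto
      have "a j \<le> w" using a(1) B(1) j by force
      then show ?thesis using a B'B T'w by (intro exI[of _ a]) auto
    next
      case 2
      obtain i where i: "i \<in> I" "i \<noteq> j" using other[OF j] by blast
      show ?thesis
        using i j m 2 B'mid B'1 T'1 prod_fun_upd_const[OF I(1) i(1), of m]
        by (intro exI[of _ "(\<lambda>_. 1)(i := m)"]) auto
    next
      case 3
      have mn: "real m \<le> real n" using m by simp
      show ?thesis
      proof (cases "\<exists>d. d dvd m \<and> z \<le> real d \<and> real d \<le> Y")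
        case True
        then obtain d where d: "d dvd m" "z \<le> real d" "real d \<le> Y" by blast
        obtain e where e: "m = d * e" using d(1) by (auto simp: dvd_def)
        obtain i where i: "i \<in> I" "i \<noteq> j" using other[OF j] by blast
        have me: "real m = real d * real e" using e by simp
        have dw: "w < d" using d(2) z(2) by linarith
        have dy: "real d \<le> y" using d(3) Yy by linarith
        have "Y * real w < Y * real e"
        proof -
          have "Y * real w < real d * real e" using 3 yY me by simp
          also have "\<dots> \<le> Y * real e" using d(3) by (intro mult_right_mono) auto
          finally show ?thesis .
        qed
        then have ew: "w < e" using Y0 by simp
        have "z * real e \<le> z * y"
        proof -
          have "z * real e \<le> real d * real e" using d(2) by (intro mult_right_mono) auto
          also have "\<dots> \<le> z * y" using me mn ny by (simp add: mult.commute)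
          finally show ?thesis .
        qed
        then have ey: "real e \<le> y" using z by simp
        \<comment> \<open>At index j stands \<open>e\<close>, of weight at most z, against the
          cofactor d \<ge> z.\<close>
        have "real e * T' e \<le> real e * real d" using T'z[OF ew] d(2) by (intro mult_left_mono) auto
        then have le: "real e * T' e \<le> real m" using me by (simp add: mult.commute)
        show ?thesis
          using i j le B'mid[OF dw dy] B'mid[OF ew ey] B'1 prod_fun_upd2_const[OF I(1) i(1) j i(2), of d e] e
          by (intro exI[of _ "(\<lambda>_. 1)(i := d, j := e)"]) auto
      next
        case False
        have "(Y / z)\<^sup>2 \<ge> real m" using Y(2) mn by linarith
        moreover have "real m \<ge> z" using 3 zY Yy by linarith
        moreover have "real d > Y" if "d dvd m" "z \<le> real d" for d using False that by force
        ultimately obtain p b where pb: "prime p" "m = p * b" "real p > Y" "real b < z"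
          using divisor_or_prime_cofactor[OF z(1) Y(1), of m] by metis
        have b1: "b \<ge> 1" using pb(2) m by (cases b) auto
        have mpb: "real m = real p * real b" using pb(2) by simp
        have pw: "w < p" using pb(3) Y(3) by linarith
        have "real p * 1 \<le> real p * real b" using b1 by (intro mult_left_mono) auto
        then have pn: "real p \<le> real n" using mpb mn by linarith
        obtain k where k: "k \<in> I" "p \<in> B' k"
        proof (cases "real p \<le> y")
          case True
          then show ?thesis using that[OF j] B'mid[OF pw] by simp
        next
          case False
          then show ?thesis using that[of "c p"] c[OF pb(1)] B'p[OF pb(1)] pn by simp
        qed
        have T'p: "T' p = 1" using T'R[OF pb(1,3) pn, of 1] w pw by simp
        show ?thesis
        proof (cases "b \<le> w")
          case False
          then have bw: "w < b" by simp
          have "real b \<le> y" using pb(4) zY Yy by linarith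
          note bB = B'mid[OF bw this]
          show ?thesis
          \<comment> \<open>If p has to stand at j, its weight is 1; if not, j receives b, whose
            weight is at most z < p.\<close>
          proof (cases "j = k")
            case True
            obtain i where i: "i \<in> I" "i \<noteq> j" using other[OF j] by blast
            have "real p * T' p \<le> real m" using T'p mpb \<open>real p * 1 \<le> real p * real b\<close> by simp
            then show ?thesis
              using i j k True bB B'1 prod_fun_upd2_const[OF I(1) i(1) j i(2), of b p] pb(2)
              by (intro exI[of _ "(\<lambda>_. 1)(i := b, j := p)"]) (auto simp: mult.commute)
          next
            case False
            have "T' b \<le> real p" using T'z[OF bw] zY pb(3) by linarith
            then have "real b * T' b \<le> real b * real p" by (intro mult_left_mono) auto
            then have "real b * T' b \<le> real m" using mpb by (simp add: mult.commute)
            then show ?thesis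
              using j k False bB B'1 prod_fun_upd2_const[OF I(1) k(1) j, of p b] pb(2)
              by (intro exI[of _ "(\<lambda>_. 1)(k := p, j := b)"]) auto
          qed
        next
          case True
          then have "b \<in> {1..w}" using b1 by simp
          \<comment> \<open>The old representation is taken relative to k, the index that will
            absorb p, not j: then p times a k times T (a k) is at most p b = m \<le> n, which is the
            condition for p * a k to have been added.\<close>
          from rep[OF this k(1)] obtain a where a: "\<forall>i\<in>I. a i \<in> B i" "b = (\<Prod>i\<in>I. a i)" "real (a k) * T (a k) \<le> real b"
            by blast
          have aw: "a i \<in> {1..w}" if "i \<in> I" for i using a(1) B(1) that by blast
          define a' where "a' = a(k := p * a k)"
          have prod: "m = (\<Prod>i\<in>I. a' i)"
          proof -
            have "(\<Prod>i\<in>I. a' i) = a' k * (\<Prod>i\<in>I - {k}. a' i)" using I(1) k(1) by (rule prod.remove)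
            also have "(\<Prod>i\<in>I - {k}. a' i) = (\<Prod>i\<in>I - {k}. a i)" by (intro prod.cong) (auto simp: a'_def)
            also have "a' k * \<dots> = p * (a k * (\<Prod>i\<in>I - {k}. a i))" by (simp add: a'_def)
            also have "a k * (\<Prod>i\<in>I - {k}. a i) = b" unfolding a(2) using I(1) k(1) by (rule prod.remove[symmetric])
            finally show ?thesis using pb(2) by simp
          qed
          have "p * a k \<in> B' k"
          \<comment> \<open>Only a \<ge> 2 is lifted; for a k = 1 the prime itself is already in the
            component.\<close>
          proof (cases "a k = 1")
            case True
            then show ?thesis using k(2) by simp
          next
            case False
            have "real p * (real (a k) * T (a k)) \<le> real p * real b" using a(3) by (intro mult_left_mono) auto
            then show ?thesis using B'C[OF pb(1,3), of "a k"] aw[OF k(1)] False mpb mn by auto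
          qed
          then have mem: "\<forall>i\<in>I. a' i \<in> B' i" using a(1) B'B by (auto simp: a'_def)
          have "real (a' j) * T' (a' j) \<le> real m"
          \<comment> \<open>The lifted factor has weight 1; at any other index the new cofactor
            contains p > Y \<ge> T (a j).\<close>
          proof (cases "j = k")
            case True
            have "p * 1 \<le> p * a k" using aw[OF k(1)] by (intro mult_left_mono) auto
            then have "p * a k > w" using pw by linarith
            then have 1: "T' (p * a k) = 1" using T'R[OF pb(1,3) pn aw[OF k(1)]] by simp
            have "real (a k) * 1 \<le> real (a k) * T (a k)" using T(1) by (intro mult_left_mono) auto
            then have "real (a k) \<le> real b" using a(3) by linarith
            then have "real p * real (a k) \<le> real p * real b" by (intro mult_left_mono) auto
            then show ?thesis using True 1 mpb by (simp add: a'_def)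
          next
            case False
            have "a j dvd b" unfolding a(2) using I(1) j by (rule dvd_prodI)
            then have "a j \<le> b" using b1 by (intro dvd_imp_le) auto
            have "T (a j) \<le> real p" using TY[OF aw[OF j]] pb(3) by linarith
            then have "real (a j) * T (a j) \<le> real b * real p" using \<open>a j \<le> b\<close> T(1)[of "a j"] by (intro mult_mono) auto
            then show ?thesis using False T'w[of "a j"] aw[OF j] mpb by (simp add: a'_def mult.commute)
          qed
          then show ?thesis using prod mem by blast
        qed
      qed
    qed
  qed
  moreover have "T' a \<ge> 1" for a using T(1) z by (simp add: T'_def next_weight_def)
  ultimately show "staged I n (next_stage w B T y Y n c) (next_weight w T z Y n)"
    unfolding staged_def B'_def[symmetric] T'_def[symmetric]
    using sub B'1 T'1 wn by auto
  show "next_stage w B T y Y n c i \<inter> {1..w} = B i" if "i \<in> I"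
    using sub[OF that] by (simp add: B'_def)
  show "w < n" by (rule wn)
qed

text \<open>Old elements keep their weights. A lifted p * a contributes at most 1/p for each of the
  w values of a, every other new element 1/z of its reciprocal.\<close>

lemma stage_cost_next_le:
  assumes w: "1 \<le> w" "w < n" and z: "z > 0" and T: "\<And>a. T a \<ge> 1" and Y: "Y > 0"
  shows "stage_cost n (next_weight w T z Y n) \<le> stage_cost w T
      + real w * (\<Sum>p | prime p \<and> Y < real p \<and> real p \<le> real n. 1 / real p) + (1 + ln (real n)) / z"
proof -
  define T' where "T' = next_weight w T z Y n"
  define P where "P = {p. prime p \<and> Y < real p \<and> real p \<le> real n}"
  define R where "R = lifted_primes w Y n"
  have finP: "finite P" unfolding P_def
    using finite_nat_le_real[of "\<lambda>p. prime p \<and> Y < real p" "real n"] by (simp add: conj_assoc)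
  have Req: "R = (\<lambda>(p, a). p * a) ` (P \<times> {1..w})"
  proof (rule set_eqI, rule iffI)
    fix k assume "k \<in> R"
    then obtain p a where pa: "k = p * a" "prime p" "Y < real p" "real p \<le> real n" "a \<in> {1..w}"
      unfolding R_def lifted_primes_def by blast
    then have "(p, a) \<in> P \<times> {1..w}" by (simp add: P_def)
    then show "k \<in> (\<lambda>(p, a). p * a) ` (P \<times> {1..w})" using pa(1) by (intro image_eqI[of k _ "(p, a)"]) auto
  next
    fix k assume "k \<in> (\<lambda>(p, a). p * a) ` (P \<times> {1..w})"
    then obtain p a where "k = p * a" "p \<in> P" "a \<in> {1..w}" by auto
    then show "k \<in> R" unfolding R_def lifted_primes_def P_def by blast
  qed
  have finR: "finite R" unfolding Req using finP by simp
  have "{2..n} = {2..w} \<union> {w<..n}" using w by auto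
  then have "stage_cost n T' = (\<Sum>a=2..w. 1 / (real a * T' a)) + (\<Sum>a\<in>{w<..n}. 1 / (real a * T' a))"
    unfolding stage_cost_def by (subst sum.union_disjoint[symmetric]) auto
  also have "(\<Sum>a=2..w. 1 / (real a * T' a)) = stage_cost w T"
    unfolding stage_cost_def by (intro sum.cong) (auto simp: T'_def next_weight_def)
  also have "(\<Sum>a\<in>{w<..n}. 1 / (real a * T' a)) \<le> (\<Sum>a\<in>{w<..n}. (if a \<in> R then 1 / real a else 0) + 1 / real a / z)"
    using z by (intro sum_mono) (auto simp: T'_def next_weight_def R_def)
  also have "\<dots> = (\<Sum>a\<in>{w<..n}. if a \<in> R then 1 / real a else 0) + (\<Sum>a\<in>{w<..n}. 1 / real a) / z"
    by (simp add: sum.distrib sum_divide_distrib)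
  also have "(\<Sum>a\<in>{w<..n}. if a \<in> R then 1 / real a else 0) \<le> real w * (\<Sum>p\<in>P. 1 / real p)"
  proof -
    have "(\<Sum>a\<in>{w<..n}. if a \<in> R then 1 / real a else 0) = (\<Sum>a\<in>{w<..n} \<inter> R. 1 / real a)"
      by (simp add: sum.inter_restrict)
    also have "\<dots> \<le> (\<Sum>a\<in>R. 1 / real a)" using finR by (intro sum_mono2) auto
    also have "\<dots> \<le> sum ((\<lambda>a. 1 / real a) \<circ> (\<lambda>(p, a). p * a)) (P \<times> {1..w})"
      unfolding Req using finP by (intro sum_image_le) auto
    also have "\<dots> \<le> (\<Sum>(p, a)\<in>P \<times> {1..w}. 1 / real p)"
    proof (intro sum_mono)
      fix x assume "x \<in> P \<times> {1..w}"
      then obtain p a where x: "x = (p, a)" "p \<in> P" "a \<ge> 1" by auto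
      have p: "real p > 0" using x(2) Y by (auto simp: P_def)
      then have "real p * 1 \<le> real p * real a" using x(3) by (intro mult_left_mono) auto
      then have "1 / (real p * real a) \<le> 1 / real p" using p by (intro divide_left_mono) auto
      then show "((\<lambda>a. 1 / real a) \<circ> (\<lambda>(p, a). p * a)) x \<le> (case x of (p, a) \<Rightarrow> 1 / real p)" by (simp add: x(1))
    qed
    also have "\<dots> = real w * (\<Sum>p\<in>P. 1 / real p)"
      by (simp add: sum.cartesian_product[symmetric] sum_distrib_left)
    finally show ?thesis .
  qed
  also have "(\<Sum>a\<in>{w<..n}. 1 / real a) / z \<le> (1 + ln (real n)) / z"
  proof (rule divide_right_mono)
    have "(\<Sum>a\<in>{w<..n}. 1 / real a) \<le> (\<Sum>a=1..n. 1 / real a)" by (intro sum_mono2) auto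
    also have "\<dots> \<le> 1 + ln (real n)" using w by (intro sum_recip_le) auto
    finally show "(\<Sum>a\<in>{w<..n}. 1 / real a) \<le> 1 + ln (real n)" .
  qed (use z in auto)
  finally show ?thesis by (simp add: T'_def P_def)
qed

text \<open>For fixed w and T, division by n / ln n turns the sum of prime counts into
  \<open>stage_cost w T\<close> as n grows.\<close>

lemma card_next_stage_le:
  assumes B: "B i \<subseteq> {1..w}" and y: "y \<ge> 0" and T: "\<And>a. T a \<ge> 1"
    and c: "real (card {p \<in> {p. (prime p \<and> y < real p) \<and> real p \<le> real n}. c p = i}) \<le> real (prime_count (real n)) / h + 1"
  shows "real (card (next_stage w B T y Y n c i))
    \<le> real w + y + (\<Sum>a=2..w. real (prime_count (real n / (real a * T a)))) + real (prime_count (real n)) / h + 1"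
proof -
  define S where "S = {p \<in> {p. (prime p \<and> y < real p) \<and> real p \<le> real n}. c p = i}"
  define M where "M = {m. w < m \<and> real m \<le> y}"
  define C where "C = {p * a | p a. prime p \<and> Y < real p \<and> a \<in> {2..w} \<and> real p * (real a * T a) \<le> real n}"
  define D where "D a = {p::nat. prime p \<and> real p \<le> real n / (real a * T a)}" for a
  have finD: "finite (D a)" for a unfolding D_def by (rule finite_nat_le_real)
  have CD: "C \<subseteq> (\<Union>a\<in>{2..w}. (\<lambda>p. p * a) ` D a)"
  proof
    fix k assume "k \<in> C"
    then obtain p a where pa: "k = p * a" "prime p" "a \<in> {2..w}" "real p * (real a * T a) \<le> real n" by (auto simp: C_def)
    have "real a * T a > 0" using pa(3) T[of a] by (intro mult_pos_pos) auto
    then have "p \<in> D a" using pa by (simp add: D_def field_simps)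
    then show "k \<in> (\<Union>a\<in>{2..w}. (\<lambda>p. p * a) ` D a)" using pa by auto
  qed
  have "card C \<le> card (\<Union>a\<in>{2..w}. (\<lambda>p. p * a) ` D a)" using CD finD by (intro card_mono) auto
  also have "\<dots> \<le> (\<Sum>a\<in>{2..w}. card ((\<lambda>p. p * a) ` D a))" by (intro card_UN_le) auto
  also have "\<dots> \<le> (\<Sum>a\<in>{2..w}. prime_count (real n / (real a * T a)))"
    unfolding prime_count_def D_def[symmetric] using finD by (intro sum_mono card_image_le) auto
  finally have "real (card C) \<le> real (\<Sum>a\<in>{2..w}. prime_count (real n / (real a * T a)))" by (simp only: of_nat_le_iff)
  then have cC: "real (card C) \<le> (\<Sum>a=2..w. real (prime_count (real n / (real a * T a))))" by simp
  have cB: "card (B i) \<le> w" using card_mono[OF _ B] by simp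
  have cM: "real (card M) \<le> y" using y by (intro card_nat_le_real) (auto simp: M_def)
  have le: "card (B i \<union> M \<union> S \<union> C) \<le> card (B i) + card M + card S + card C"
    by (intro order_trans[OF card_Un_le] add_mono order_refl)
  have eq: "next_stage w B T y Y n c i = B i \<union> M \<union> S \<union> C"
    unfolding next_stage_def M_def S_def C_def ..
  have "real (card (next_stage w B T y Y n c i)) \<le> real (card (B i)) + real (card M) + real (card S) + real (card C)"
    unfolding eq of_nat_add[symmetric] of_nat_le_iff by (rule le)
  then show ?thesis using cB cM cC c unfolding S_def[symmetric] by linarith
qed

text \<open>The old stage is fixed while n grows, so every requirement is a limit statement: the
  density tends to \<open>stage_cost w T\<close> + 1/h at most, and the added cost tends to 0. The
  strict inequality in \<open>cost\<close> leaves room for both and is inherited.\<close>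

lemma stage_exists:
  assumes I: "finite I" "card I \<ge> 2" and st: "staged I w B T" and cost: "stage_cost w T < \<epsilon>"
  shows "\<forall>\<^sub>F n in sequentially. \<exists>B' T'. staged I n B' T' \<and> w < n \<and> (\<forall>i\<in>I. B' i \<inter> {1..w} = B i) \<and> stage_cost n T' < \<epsilon>
    \<and> (\<forall>i\<in>I. real (card (B' i)) / (real n / ln (real n)) \<le> 1 / real (card I) + \<epsilon>)"
proof -
  have w: "w \<ge> 1" and B: "\<And>i. i \<in> I \<Longrightarrow> B i \<subseteq> {1..w}" and T: "\<And>a. T a \<ge> 1"
    using st unfolding staged_def by auto
  define W where "W = real w"
  have W: "W > 0" using w by (simp add: W_def)
  define K where "K = (\<Sum>a=1..w. T a)"
  have TK: "T a \<le> K" if "a \<in> {1..w}" for a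
    unfolding K_def using that T by (intro member_le_sum) (auto intro: order_trans[OF zero_le_one])
  define z where "z n = (ln (real n))\<^sup>2" for n
  define y where "y n = real n / z n" for n
  define Y where "Y n = y n / W" for n
  define h where "h = real (card I)"
  have h: "h > 0" using I by (simp add: h_def)
  define f where "f x = (W + x / (ln x)\<^sup>2 + (\<Sum>a=2..w. real (prime_count (x / (real a * T a)))) + real (prime_count x) / h + 1) / (x / ln x)" for x :: real
  have l1: "((\<lambda>x. W / (x / ln x)) \<longlongrightarrow> 0) at_top" by real_asymp
  have l2: "((\<lambda>x::real. x / (ln x)\<^sup>2 / (x / ln x)) \<longlongrightarrow> 0) at_top" by real_asymp
  have l3: "((\<lambda>x. \<Sum>a=2..w. real (prime_count (x / (real a * T a))) / (x / ln x)) \<longlongrightarrow> (\<Sum>a=2..w. 1 / (real a * T a))) at_top"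
  proof (intro tendsto_sum prime_count_tendsto_scaled)
    show "0 < real a * T a" if "a \<in> {2..w}" for a using that T[of a] by (intro mult_pos_pos) auto
  qed
  have l4: "((\<lambda>x. real (prime_count x) / (x / ln x) / h) \<longlongrightarrow> 1 / h) at_top"
    using h by (intro tendsto_divide prime_number_theorem tendsto_const) auto
  have l5: "((\<lambda>x::real. 1 / (x / ln x)) \<longlongrightarrow> 0) at_top" by real_asymp
  have feq: "f x = W / (x / ln x) + x / (ln x)\<^sup>2 / (x / ln x) + (\<Sum>a=2..w. real (prime_count (x / (real a * T a))) / (x / ln x))
      + real (prime_count x) / (x / ln x) / h + 1 / (x / ln x)" for x
    unfolding f_def add_divide_distrib sum_divide_distrib by (simp add: mult.commute)
  have "(f \<longlongrightarrow> 0 + 0 + (\<Sum>a=2..w. 1 / (real a * T a)) + 1 / h + 0) at_top"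
    unfolding feq[abs_def] by (intro tendsto_add l1 l2 l3 l4 l5)
  then have "(f \<longlongrightarrow> stage_cost w T + 1 / h) at_top"
    unfolding stage_cost_def by simp
  from filterlim_compose[OF this filterlim_real_sequentially]
  have "(\<lambda>n. f (real n)) \<longlonglongrightarrow> stage_cost w T + 1 / h" .
  then have e1: "\<forall>\<^sub>F n in sequentially. f (real n) < 1 / h + \<epsilon>"
    by (rule order_tendstoD) (use cost in simp)
  \<comment> \<open>The added cost: O(ln ln n / ln n) from lifted primes and O(1 / ln n) from
    integers of weight z.\<close>
  have "(\<lambda>n. W * ((log 2 (W * (ln (real n))\<^sup>2) + 1) * (8 / ln (real n / (ln (real n))\<^sup>2 / W))) + (1 + ln (real n)) / (ln (real n))\<^sup>2) \<longlonglongrightarrow> 0"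
    using W by real_asymp
  then have e2: "\<forall>\<^sub>F n in sequentially. W * ((log 2 (W * z n) + 1) * (8 / ln (Y n))) + (1 + ln (real n)) / z n < \<epsilon> - stage_cost w T"
    unfolding z_def Y_def y_def by (rule order_tendstoD) (use cost in simp)
  have e3: "\<forall>\<^sub>F n in sequentially. z n > 1" unfolding z_def by real_asymp
  have e4: "\<forall>\<^sub>F n in sequentially. z n > W" unfolding z_def by real_asymp
  have e5: "\<forall>\<^sub>F n in sequentially. Y n / z n \<ge> z n" unfolding z_def Y_def y_def using W by real_asymp
  have e6: "\<forall>\<^sub>F n in sequentially. (Y n / z n)\<^sup>2 \<ge> real n" unfolding z_def Y_def y_def using W by real_asymp
  have e7: "\<forall>\<^sub>F n in sequentially. Y n \<ge> W + K + 2" unfolding z_def Y_def y_def using W by real_asymp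
  have K0: "K \<ge> 0" unfolding K_def using T by (intro sum_nonneg) (auto intro: order_trans[OF zero_le_one])
  show ?thesis
    using e1 e2 e3 e4 e5 e6 e7 eventually_gt_at_top[of 1]
  proof eventually_elim
    case (elim n)
    define S where "S = {p::nat. (prime p \<and> y n < real p) \<and> real p \<le> real n}"
    have finS: "finite S" unfolding S_def by (rule finite_nat_le_real)
    have "I \<noteq> {}" using I by auto
    then obtain c where c: "\<And>s. s \<in> S \<Longrightarrow> c s \<in> I" "\<And>i. i \<in> I \<Longrightarrow> real (card {s \<in> S. c s = i}) \<le> real (card S) / real (card I) + 1"
      using balanced_partition[OF finS I(1)] by metis
    define B' where "B' = next_stage w B T (y n) (Y n) n c"
    define T' where "T' = next_weight w T (z n) (Y n) n"
    have Y2: "Y n \<ge> 2" "Y n \<ge> real w" and TY: "\<And>a. a \<in> {1..w} \<Longrightarrow> T a \<le> Y n"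
      using elim TK K0 W by (force simp: W_def)+
    have stg: "staged I n B' T'" "\<And>i. i \<in> I \<Longrightarrow> B' i \<inter> {1..w} = B i" "w < n"
      unfolding B'_def T'_def
      by (rule staged_next_stage[OF I st elim(3) elim(4)[unfolded W_def] y_def[of n] Y_def[of n, unfolded W_def] elim(5) elim(6) Y2(2) TY];
          use c in \<open>auto simp: S_def\<close>)+
    have v1: "W * z n \<ge> 1"
    proof -
      have "1 * 1 \<le> W * z n" using elim(3) w by (intro mult_mono) (auto simp: W_def)
      then show ?thesis by simp
    qed
    have vu: "W * z n * Y n = real n" using W elim(3) by (simp add: Y_def y_def)
    have "(\<Sum>p | prime p \<and> Y n < real p \<and> real p \<le> real n. 1 / real p) \<le> (log 2 (W * z n) + 1) * (8 / ln (Y n))"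
      using sum_prime_recip_le[OF Y2(1) v1] by (simp only: vu)
    then have "W * (\<Sum>p | prime p \<and> Y n < real p \<and> real p \<le> real n. 1 / real p) \<le> W * ((log 2 (W * z n) + 1) * (8 / ln (Y n)))"
      using W by (intro mult_left_mono) auto
    moreover have "stage_cost n T' \<le> stage_cost w T
      + W * (\<Sum>p | prime p \<and> Y n < real p \<and> real p \<le> real n. 1 / real p) + (1 + ln (real n)) / z n"
      unfolding T'_def W_def using w stg(3) elim(3) T Y2 by (intro stage_cost_next_le) auto
    ultimately have cost': "stage_cost n T' < \<epsilon>" using elim(2) by linarith
    have "real (card (B' i)) / (real n / ln (real n)) \<le> 1 / real (card I) + \<epsilon>" if i: "i \<in> I" for i
    proof -
      have "card S \<le> prime_count (real n)"
        unfolding prime_count_def S_def by (intro card_mono finite_nat_le_real) auto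
      then have "real (card S) / h \<le> real (prime_count (real n)) / h" using h by (intro divide_right_mono) auto
      then have "real (card {p \<in> S. c p = i}) \<le> real (prime_count (real n)) / h + 1"
        using c(2)[OF i] unfolding h_def by linarith
      then have "real (card (B' i)) \<le> real w + y n + (\<Sum>a=2..w. real (prime_count (real n / (real a * T a)))) + real (prime_count (real n)) / h + 1"
        unfolding B'_def S_def using B[OF i] T elim(3) by (intro card_next_stage_le) (auto simp: y_def)
      then have "real (card (B' i)) / (real n / ln (real n)) \<le> f (real n)"
        unfolding f_def W_def using elim(8) by (intro divide_right_mono) (auto simp: y_def z_def)
      then show ?thesis using elim(1) by (simp add: h_def)
    qed
    then show ?case using stg cost' by blast
  qed
qed

section \<open>Gluing the stages\<close>

lemma staged_init: "staged I 1 (\<lambda>_. {1}) (\<lambda>_. 1)"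
  by (auto simp: staged_def)

lemma efficient_complement_exists:
  assumes I: "finite I" "card I \<ge> 2" and e: "\<epsilon> > 0"
  obtains A where "complement_on I A"
    "\<And>X. \<exists>n\<ge>X. n > 1 \<and> (\<forall>i\<in>I. real (counting (A i) (real n)) / (real n / ln (real n)) \<le> 1 / real (card I) + \<epsilon>)"
proof -
  define P where "P = (\<lambda>(w, B, T). staged I w B T \<and> stage_cost w T < \<epsilon>)"
  define Q where "Q = (\<lambda>(w, B, T :: nat \<Rightarrow> real) (n, B', T' :: nat \<Rightarrow> real). w < (n::nat) \<and> (\<forall>i\<in>I. B' i \<inter> {1..w} = B i)
    \<and> (\<forall>i\<in>I. real (card (B' i)) / (real n / ln (real n)) \<le> 1 / real (card I) + \<epsilon>))"
  have "\<exists>f. \<forall>n::nat. P (f n) \<and> Q (f n) (f (Suc n))"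
  proof (rule dependent_nat_choice)
    have "P (1, \<lambda>_. {1}, \<lambda>_. 1)" using e by (simp add: P_def staged_init[simplified] stage_cost_def)
    then show "\<exists>x. P x" by blast
    fix x :: "nat \<times> ('a \<Rightarrow> nat set) \<times> (nat \<Rightarrow> real)" and n :: nat
    assume Px: "P x"
    obtain w B T where x: "x = (w, B, T)" by (cases x)
    have "staged I w B T" "stage_cost w T < \<epsilon>" using Px by (auto simp: P_def x)
    from eventually_happens[OF stage_exists[OF I this]] obtain m B' T' where
      "staged I m B' T'" "w < m" "\<forall>i\<in>I. B' i \<inter> {1..w} = B i" "stage_cost m T' < \<epsilon>"
      "\<forall>i\<in>I. real (card (B' i)) / (real m / ln (real m)) \<le> 1 / real (card I) + \<epsilon>" by auto
    then have "P (m, B', T') \<and> Q x (m, B', T')" by (simp add: P_def Q_def x)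
    then show "\<exists>y. P y \<and> Q x y" by blast
  qed
  then obtain f where f: "\<And>n. P (f n)" "\<And>n. Q (f n) (f (Suc n))" by blast
  define w B where "w k = fst (f k)" and "B k = fst (snd (f k))" for k
  have st: "\<exists>T. staged I (w k) (B k) T" for k
    using f(1)[of k] unfolding P_def w_def B_def by (auto simp: case_prod_unfold)
  have step: "w k < w (Suc k)" "\<And>i. i \<in> I \<Longrightarrow> B (Suc k) i \<inter> {1..w k} = B k i"
    "\<And>i. i \<in> I \<Longrightarrow> real (card (B (Suc k) i)) / (real (w (Suc k)) / ln (real (w (Suc k)))) \<le> 1 / real (card I) + \<epsilon>" for k
    using f(2)[of k] unfolding Q_def w_def B_def by (auto simp: case_prod_unfold)
  have sm: "strict_mono w" using step(1) by (simp add: strict_mono_Suc_iff)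
  have wk: "k \<le> w k" for k using strict_mono_imp_increasing[OF sm] .
  have Bw: "B k i \<subseteq> {1..w k}" if "i \<in> I" for k i using st[of k] that unfolding staged_def by auto
  \<comment> \<open>Later stages only add elements beyond w k, so the union has exactly
    \<open>B k i\<close> as its part up to w k.\<close>
  have restr: "B l i \<inter> {1..w k} = B k i" if "k \<le> l" and i: "i \<in> I" for k l i
    using that(1)
  proof (induction l rule: dec_induct)
    case base
    then show ?case using Bw[OF i] by auto
  next
    case (step l)
    have "{1..w k} \<subseteq> {1..w l}" using strict_mono_less_eq[OF sm] step.hyps by auto
    then have "B (Suc l) i \<inter> {1..w k} = (B (Suc l) i \<inter> {1..w l}) \<inter> {1..w k}" by blast
    also have "\<dots> = B k i" using \<open>\<And>k i. i \<in> I \<Longrightarrow> B (Suc k) i \<inter> {1..w k} = B k i\<close>[OF i, of l] step.IH by simp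
    finally show ?case .
  qed
  define A where "A i = (\<Union>k. B k i)" for i
  have AB: "{a \<in> A i. real a \<le> real (w k)} = B k i" if i: "i \<in> I" for i k
  proof
    show "B k i \<subseteq> {a \<in> A i. real a \<le> real (w k)}" using Bw[OF i, of k] by (auto simp: A_def)
    show "{a \<in> A i. real a \<le> real (w k)} \<subseteq> B k i"
    proof
      fix a assume "a \<in> {a \<in> A i. real a \<le> real (w k)}"
      then obtain l where l: "a \<in> B l i" "a \<le> w k" by (auto simp: A_def)
      have "a \<ge> 1" using Bw[OF i, of l] l(1) by auto
      show "a \<in> B k i"
      proof (cases "k \<le> l")
        case True
        have "a \<in> B l i \<inter> {1..w k}" using l \<open>a \<ge> 1\<close> by simp
        then show ?thesis unfolding restr[OF True i] .
      next
        case False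
        then have lk: "l \<le> k" by simp
        have "a \<in> B k i \<inter> {1..w l}" unfolding restr[OF lk i] by (rule l(1))
        then show ?thesis by simp
      qed
    qed
  qed
  have "complement_on I A"
    unfolding complement_on_def
  proof (intro conjI ballI allI impI)
    show "A i \<subseteq> {0<..}" if "i \<in> I" for i
      unfolding A_def
    proof (rule UN_least)
      show "B k i \<subseteq> {0<..}" for k using Bw[OF that, of k] by auto
    qed
    fix n :: nat assume "n > 0"
    then have "n \<in> {1..w n}" using wk[of n] by simp
    moreover obtain j where "j \<in> I" using I by fastforce
    ultimately obtain a where "\<forall>i\<in>I. a i \<in> B n i" "n = (\<Prod>i\<in>I. a i)"
      using st[of n] unfolding staged_def by blast
    then show "\<exists>a. (\<forall>i\<in>I. a i \<in> A i) \<and> n = (\<Prod>i\<in>I. a i)" by (auto simp: A_def)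
  qed
  moreover have "\<exists>n\<ge>X. n > 1 \<and> (\<forall>i\<in>I. real (counting (A i) (real n)) / (real n / ln (real n)) \<le> 1 / real (card I) + \<epsilon>)" for X
  \<comment> \<open>The density bound belongs to stages produced by a step, hence the successor; the
    second one, with w k \<ge> k, gives w > 1 even for X = 0.\<close>
  proof (intro exI[of _ "w (Suc (Suc X))"] conjI ballI)
    show "X \<le> w (Suc (Suc X))" "1 < w (Suc (Suc X))" using wk[of "Suc (Suc X)"] by auto
    show "real (counting (A i) (real (w (Suc (Suc X))))) / (real (w (Suc (Suc X))) / ln (real (w (Suc (Suc X))))) \<le> 1 / real (card I) + \<epsilon>"
      if "i \<in> I" for i
      unfolding counting_def AB[OF that] by (rule step(3)[OF that])
  qed
  ultimately show thesis using that by blast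
qed

lemma max_counting_liminf_le:
  assumes h: "h \<ge> 2" and e: "\<epsilon> > 0"
  shows "\<exists>A. mult_complement h A \<and> max_counting_liminf h A \<le> ereal (1 / real h + \<epsilon>)"
proof -
  obtain A where A: "complement_on {1..h} A"
    "\<And>X. \<exists>n\<ge>X. n > 1 \<and> (\<forall>i\<in>{1..h}. real (counting (A i) (real n)) / (real n / ln (real n)) \<le> 1 / real (card {1..h}) + \<epsilon>)"
    using efficient_complement_exists[of "{1..h}" \<epsilon>] h e by (metis card_atLeastAtMost diff_Suc_1 finite_atLeastAtMost)
  have "max_counting_liminf h A \<le> ereal (1 / real h + \<epsilon>)"
  proof (rule ccontr)
    assume "\<not> ?thesis"
    then have "ereal (1 / real h + \<epsilon>) < Liminf at_top (\<lambda>x::real. ereal (real (MAX i\<in>{1..h}. counting (A i) x) / (x / ln x)))"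
      by (simp add: max_counting_liminf_def)
    from less_LiminfD[OF this] obtain X where
      X: "\<And>x. x \<ge> X \<Longrightarrow> 1 / real h + \<epsilon> < real (MAX i\<in>{1..h}. counting (A i) x) / (x / ln x)"
      by (auto simp: eventually_at_top_linorder)
    obtain n where n: "n \<ge> nat \<lceil>X\<rceil>" "n > 1" "\<And>i. i \<in> {1..h} \<Longrightarrow> real (counting (A i) (real n)) / (real n / ln (real n)) \<le> 1 / real h + \<epsilon>"
      using A(2)[of "nat \<lceil>X\<rceil>"] by auto
    have "(MAX i\<in>{1..h}. counting (A i) (real n)) \<in> (\<lambda>i. counting (A i) (real n)) ` {1..h}"
      using h by (intro Max_in) auto
    then obtain i where i: "i \<in> {1..h}" "(MAX i\<in>{1..h}. counting (A i) (real n)) = counting (A i) (real n)" by auto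
    have "X \<le> real n" using n(1) by linarith
    from X[OF this] show False using n(3)[OF i(1)] i(2) by simp
  qed
  then show ?thesis using A(1) by (auto simp: mult_complement_iff)
qed

text \<open>The second part is restricted to h \<ge> 2 because it fails for h = 1: there the only
  complement consists of all positive integers, and the quotient grows like ln x.\<close>

theorem theorem12:
  fixes h :: nat
  assumes "h \<ge> 1"
  shows "(\<forall>A. mult_complement h A \<longrightarrow> max_counting_liminf h A > ereal (1 / real h)) \<and>
         (h \<ge> 2 \<longrightarrow>
           (\<forall>\<epsilon>::real. \<epsilon> > 0 \<longrightarrow>
             (\<exists>A. mult_complement h A \<and> max_counting_liminf h A \<le> ereal (1 / real h + \<epsilon>))))"
  using max_counting_liminf_gt[OF assms] max_counting_liminf_le by blast

end
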